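(* Let $X$ be a spectrally positive Lévy process, so that its dual $Y:=-X$ is a spectrally negative Lévy process; let $\psi$, $\Phi$ and $W^{(p)}$ be the Laplace exponent of $Y$, its right-inverse, and the scale functions of $Y$, and let $q>0$. For $\lambda>0$ define the probability measures $\mu_1^\lambda$ on $[0,\infty)$ and $\mu_2^\lambda$ on $\mathbb R$ by $$\mu_1^\lambda(\mathrm dy):=\frac{q\,\Phi(q+\lambda)}{(\lambda+q)\Phi(q)}\Big(\delta_0(\mathrm dy)+1_{\{y>0\}}(\Phi(q+\lambda)-\Phi(q))H^{(q)}(y;\Phi(q+\lambda))\,\mathrm dy\Big),$$ $$\mu_2^\lambda(\mathrm du):=\frac{q\,\Phi(q+\lambda)}{\Phi(q)}\Big(\widehat g^{(q+\lambda)}(u)+(\Phi(q+\lambda)-\Phi(q))\int_0^\infty H^{(q)}(y;\Phi(q+\lambda))\,\widehat g^{(q+\lambda)}(u-y)\,\mathrm dy\Big)\mathrm du,$$ with $H^{(q)}$ and $\widehat g^{(q+\lambda)}$ as defined in the context. Let $\mu$ be the probability measure on $[0,\infty)$ determined by $$\int_{[0,\infty)}e^{-\theta y}\mu(\mathrm dy)=\frac{q}{\Phi(q)}\,\frac{\theta-\Phi(q)}{\psi(\theta)-q},\qquad\theta\ge0$$ (with the right-hand side understood by continuity at $\theta=\Phi(q)$). Then $\mu_1^\lambda$ and $\mu_2^\lambda$ both converge weakly to $\mu$ as $\lambda\to\infty$.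
   Context: A spectrally negative Lévy process is a real-valued Lévy process without positive jumps whose paths are not a.s. monotone; a spectrally positive one is the negative of such a process. For the spectrally negative process $Y$ with $Y(0)=0$: $\psi(\theta)=\log\mathbb E[e^{\theta Y(1)}]$, $\theta\ge0$; $\Phi(p):=\sup\{s\ge0:\psi(s)=p\}$, $p\ge0$; $W^{(p)}:\mathbb R\to[0,\infty)$ is zero on $(-\infty,0)$, and on $[0,\infty)$ is the continuous strictly increasing function with $\int_0^\infty e^{-\theta x}W^{(p)}(x)\,\mathrm dx=1/(\psi(\theta)-p)$ for $\theta>\Phi(p)$. Further, $$g^{(p)}(u):=\frac{e^{-\Phi(p)u}}{\psi'(\Phi(p))}-W^{(p)}(-u),\qquad\widehat g^{(p)}(u):=g^{(p)}(-u),\quad u\in\mathbb R,$$ ($g^{(p)}$ is the density of the $p$-resolvent of $Y$: $\mathbb E[\int_0^\infty e^{-ps}1_A(Y(s))\,\mathrm ds]=\int_Ag^{(p)}(u)\,\mathrm du$ for Borel $A\subset\mathbb R$ and $p>0$), $$Z^{(q)}(x;\theta):=e^{\theta x}\Big(1+(q-\psi(\theta))\int_0^xe^{-\theta z}W^{(q)}(z)\,\mathrm dz\Big),\quad x\in\mathbb R,\ \theta\ge0,$$ $$H^{(q)}(y;\Phi(q+\lambda)):=Z^{(q)}(y;\Phi(q+\lambda))-\frac{\lambda}{\Phi(q+\lambda)-\Phi(q)}W^{(q)}(y),\quad y\in\mathbb R;$$ this equals the expectation of $e^{-q\tau_0^-+\Phi(q+\lambda)Y(\tau_0^-)}1_{\{\tau_0^-<\infty\}}$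 when $Y(0)=y$, with $\tau_0^-:=\inf\{t>0:Y(t)<0\}$. $\delta_0$ is the Dirac measure at $0$. Measures on $[0,\infty)$ are regarded as measures on $\mathbb R$ when needed. *)

theory Defs
  imports "HOL-Probability.Probability"
begin

section \<open>Levy processes\<close>

definition levy_process :: "'a measure \<Rightarrow> (real \<Rightarrow> 'a \<Rightarrow> real) \<Rightarrow> bool" where
  "levy_process M Y \<longleftrightarrow>
     prob_space M \<and>
     (\<forall>t\<ge>0. Y t \<in> borel_measurable M) \<and>
     (AE \<omega> in M. Y 0 \<omega> = 0) \<and>
     (\<forall>(t::nat \<Rightarrow> real) n. 0 \<le> t 0 \<and> mono t \<longrightarrow>
        prob_space.indep_vars M (\<lambda>_. borel) (\<lambda>i \<omega>. Y (t (Suc i)) \<omega> - Y (t i) \<omega>) {..<n}) \<and>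
     (\<forall>s\<ge>0. \<forall>h\<ge>0. distr M borel (\<lambda>\<omega>. Y (s + h) \<omega> - Y s \<omega>) = distr M borel (Y h)) \<and>
     (AE \<omega> in M. \<forall>t\<ge>0.
        ((\<lambda>s. Y s \<omega>) \<longlongrightarrow> Y t \<omega>) (at_right t) \<and>
        (t > 0 \<longrightarrow> (\<exists>l. ((\<lambda>s. Y s \<omega>) \<longlongrightarrow> l) (at_left t))))"

definition spectrally_negative :: "'a measure \<Rightarrow> (real \<Rightarrow> 'a \<Rightarrow> real) \<Rightarrow> bool" where
  "spectrally_negative M Y \<longleftrightarrow>
     levy_process M Y \<and>
     (AE \<omega> in M. \<forall>t>0. Y t \<omega> - Lim (at_left t) (\<lambda>s. Y s \<omega>) \<le> 0) \<and>
     \<not> (AE \<omega> in M. mono_on {0..} (\<lambda>t. Y t \<omega>) \<or> antimono_on {0..} (\<lambda>t. Y t \<omega>))"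

definition spectrally_positive :: "'a measure \<Rightarrow> (real \<Rightarrow> 'a \<Rightarrow> real) \<Rightarrow> bool" where
  "spectrally_positive M X \<longleftrightarrow> spectrally_negative M (\<lambda>t \<omega>. - X t \<omega>)"

section \<open>Laplace exponent and scale functions\<close>

definition laplace_exponent :: "'a measure \<Rightarrow> (real \<Rightarrow> 'a \<Rightarrow> real) \<Rightarrow> real \<Rightarrow> real" where
  "laplace_exponent M Y \<theta> = ln (\<integral>\<omega>. exp (\<theta> * Y 1 \<omega>) \<partial>M)"

definition right_inverse :: "(real \<Rightarrow> real) \<Rightarrow> real \<Rightarrow> real" where
  "right_inverse \<psi> p = Sup {s. 0 \<le> s \<and> \<psi> s = p}"

definition is_scale_function :: "(real \<Rightarrow> real) \<Rightarrow> real \<Rightarrow> (real \<Rightarrow> real) \<Rightarrow> bool" where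
  "is_scale_function \<psi> p w \<longleftrightarrow>
     (\<forall>x. 0 \<le> w x) \<and> (\<forall>x<0. w x = 0) \<and>
     continuous_on {0..} w \<and> strict_mono_on {0..} w \<and>
     (\<forall>\<theta>>right_inverse \<psi> p.
        set_integrable lborel {0..} (\<lambda>x. exp (- \<theta> * x) * w x) \<and>
        (LBINT x:{0..}. exp (- \<theta> * x) * w x) = 1 / (\<psi> \<theta> - p))"

text \<open>
  Below, \<open>W p\<close> stands for the \<open>p\<close>-scale function. The derivative in \<open>resolvent_density\<close> is
  two-sided; this is the intended reading for \<open>p > 0\<close>, where \<open>right_inverse \<psi> p > 0\<close>.
\<close>

definition resolvent_density ::
    "(real \<Rightarrow> real) \<Rightarrow> (real \<Rightarrow> real \<Rightarrow> real) \<Rightarrow> real \<Rightarrow> real \<Rightarrow> real" where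
  "resolvent_density \<psi> W p u =
     exp (- right_inverse \<psi> p * u) / deriv \<psi> (right_inverse \<psi> p) - W p (- u)"

definition dual_resolvent_density ::
    "(real \<Rightarrow> real) \<Rightarrow> (real \<Rightarrow> real \<Rightarrow> real) \<Rightarrow> real \<Rightarrow> real \<Rightarrow> real" where
  "dual_resolvent_density \<psi> W p u = resolvent_density \<psi> W p (- u)"

definition Z_fun ::
    "(real \<Rightarrow> real) \<Rightarrow> (real \<Rightarrow> real \<Rightarrow> real) \<Rightarrow> real \<Rightarrow> real \<Rightarrow> real \<Rightarrow> real" where
  "Z_fun \<psi> W q x \<theta> =
     exp (\<theta> * x) * (1 + (q - \<psi> \<theta>) * (LBINT z=0..x. exp (- \<theta> * z) * W q z))"

definition H_fun ::
    "(real \<Rightarrow> real) \<Rightarrow> (real \<Rightarrow> real \<Rightarrow> real) \<Rightarrow> real \<Rightarrow> real \<Rightarrow> real \<Rightarrow> real" where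
  "H_fun \<psi> W q l y =
     Z_fun \<psi> W q y (right_inverse \<psi> (q + l))
     - l / (right_inverse \<psi> (q + l) - right_inverse \<psi> q) * W q y"

section \<open>The measures\<close>

definition add_measure :: "'b measure \<Rightarrow> 'b measure \<Rightarrow> 'b measure" where
  "add_measure M N = measure_of (space M) (sets M) (\<lambda>A. emeasure M A + emeasure N A)"

lemma space_add_measure [simp]: "space (add_measure M N) = space M"
  and sets_add_measure [simp, measurable_cong]: "sets (add_measure M N) = sets M"
  by (simp_all add: add_measure_def)

lemma emeasure_add_measure:
  fixes M N :: "'b measure"
  assumes "sets N = sets M" and "A \<in> sets M"
  shows "emeasure (add_measure M N) A = emeasure M A + emeasure N A"
  unfolding add_measure_def
proof (rule emeasure_measure_of_sigma)
  show "sigma_algebra (space M) (sets M)" ..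
  show "positive (sets M) (\<lambda>A. emeasure M A + emeasure N A)"
    by (simp add: positive_def)
  show "countably_additive (sets M) (\<lambda>A. emeasure M A + emeasure N A)"
  proof (rule countably_additiveI)
    fix F :: "nat \<Rightarrow> 'b set"
    assume F: "range F \<subseteq> sets M" "disjoint_family F"
    then have "(\<Sum>i. emeasure M (F i)) = emeasure M (\<Union>i. F i)"
      and "(\<Sum>i. emeasure N (F i)) = emeasure N (\<Union>i. F i)"
      using assms(1) by (auto intro!: suminf_emeasure)
    then show "(\<Sum>i. emeasure M (F i) + emeasure N (F i))
        = emeasure M (\<Union>i. F i) + emeasure N (\<Union>i. F i)"
      by (simp add: suminf_add[symmetric])
  qed
  show "A \<in> sets M" by fact
qed

text \<open>
  The coefficients and densities below are nonnegative for \<open>l > 0\<close>, so the truncation at zero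
  done by \<open>ennreal\<close> is inessential. Measures on \<open>[0, \<infinity>)\<close> are taken as measures on the line.
\<close>

definition mu1 ::
    "(real \<Rightarrow> real) \<Rightarrow> (real \<Rightarrow> real \<Rightarrow> real) \<Rightarrow> real \<Rightarrow> real \<Rightarrow> real measure" where
  "mu1 \<psi> W q l =
     (let \<Phi> = right_inverse \<psi> in
       scale_measure (ennreal (q * \<Phi> (q + l) / ((l + q) * \<Phi> q)))
         (add_measure (return borel 0)
           (density lborel
             (\<lambda>y. ennreal (indicator {0<..} y * ((\<Phi> (q + l) - \<Phi> q) * H_fun \<psi> W q l y))))))"

definition mu2 ::
    "(real \<Rightarrow> real) \<Rightarrow> (real \<Rightarrow> real \<Rightarrow> real) \<Rightarrow> real \<Rightarrow> real \<Rightarrow> real measure" where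
  "mu2 \<psi> W q l =
     (let \<Phi> = right_inverse \<psi>; gh = dual_resolvent_density \<psi> W (q + l) in
       density lborel
         (\<lambda>u. ennreal (q * \<Phi> (q + l) / \<Phi> q *
            (gh u + (\<Phi> (q + l) - \<Phi> q) *
              (LBINT y:{0..}. H_fun \<psi> W q l y * gh (u - y))))))"

text \<open>
  The transform of the limit law; its value at the removable singularity is the limit there.
\<close>

definition limit_laplace :: "(real \<Rightarrow> real) \<Rightarrow> real \<Rightarrow> real \<Rightarrow> real" where
  "limit_laplace \<psi> q \<theta> =
     (let \<Phi> = right_inverse \<psi>; F = (\<lambda>s. q / \<Phi> q * ((s - \<Phi> q) / (\<psi> s - q))) in
       if \<theta> = \<Phi> q then Lim (at (\<Phi> q)) F else F \<theta>)"

end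

theory Submission
  imports Defs "HOL-Complex_Analysis.Complex_Analysis"
begin

text \<open>
  Write \<open>\<phi> = \<Phi> q\<close>, \<open>\<beta> = \<Phi> (q + l)\<close> and let \<open>\<xi>\<close> have law \<open>\<mu>\<close>. Inverting the transform of \<open>\<mu>\<close> gives
  \<open>W q y = \<phi> / q * E[exp (\<phi> (y - \<xi>)); \<xi> \<le> y]\<close>, and then
  \<open>(\<beta> - \<phi>) H y = \<phi> l / q * E[exp (- \<beta> (\<xi> - y)); \<xi> > y]\<close>. Hence \<open>mu1\<close> is the mixture, with weights
  \<open>q / (q + l)\<close> and \<open>l / (q + l)\<close>, of the point mass at \<open>0\<close> and the law of the positive part of
  \<open>\<xi> - e / \<beta>\<close>, where \<open>e\<close> is an independent standard exponential variable; as \<open>\<beta> \<rightarrow> \<infinity>\<close>, it tends to \<open>\<mu>\<close>.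
  The measure \<open>mu2\<close> is the convolution of \<open>mu1\<close> with the law of \<open>- Y\<close> at an independent exponential
  time of rate \<open>q + l\<close>, which tends to the point mass at \<open>0\<close> since \<open>Y\<close> is right-continuous.

  The one fact needed from fluctuation theory is that \<open>Y\<close> at an exponential time of rate \<open>p\<close> has
  density \<open>p g\<close> with \<open>g\<close> the resolvent density, in particular that \<open>g\<close> is nonnegative. Its law has
  bilateral transform \<open>p / (p - \<psi> t)\<close> for \<open>0 \<le> t < \<Phi> p\<close>, and \<open>1 / \<psi>\<close> extends holomorphically to the half
  plane right of \<open>\<Phi> 0\<close> because it is the Laplace transform of \<open>W 0\<close>. Multiplied by \<open>z - \<Phi> p\<close>, the
  transform of the part of the law on the positive half line therefore continues to an entire
  function, which a Liouville argument shows to be constant: that part is exponential with rate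
  \<open>\<Phi> p\<close>. The rest of the density is then read off from the transform of \<open>W p\<close>.
\<close>

section \<open>Bilateral Laplace transforms of measures on the line\<close>

lemma norm_exp_minus_one_le:
  fixes w :: complex
  shows "norm (exp w - 1) \<le> norm w * exp (norm w)"
proof -
  have "norm (exp w - (\<Sum>k\<le>0. w ^ k / fact k)) \<le> exp \<bar>Re w\<bar> * norm w ^ Suc 0 / fact 0"
    by (rule Taylor_exp)
  also have "\<dots> \<le> exp (norm w) * norm w"
    using abs_Re_le_cmod[of w] by (auto intro!: mult_right_mono)
  finally show ?thesis by (simp add: mult.commute)
qed

lemma mgf_integrable_complex:
  fixes N :: "real measure"
  assumes [measurable_cong]: "sets N = sets borel"
    and int: "integrable N (\<lambda>x. exp (Re z * x))"
  shows "integrable N (\<lambda>x. exp (z * complex_of_real x))"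
  by (rule Bochner_Integration.integrable_bound[OF int]) (auto simp: norm_exp_eq_Re)

lemma mgf_norm_le:
  fixes N :: "real measure"
  assumes "sets N = sets borel"
    and int: "integrable N (\<lambda>x. exp (Re z * x))"
  shows "norm (\<integral>x. exp (z * complex_of_real x) \<partial>N) \<le> (\<integral>x. exp (Re z * x) \<partial>N)"
  using integral_norm_bound[of N "\<lambda>x. exp (z * complex_of_real x)"] by (simp add: norm_exp_eq_Re)

lemma mgf_of_real:
  fixes N :: "real measure"
  shows "(\<integral>x. exp (complex_of_real t * complex_of_real x) \<partial>N) = complex_of_real (\<integral>x. exp (t * x) \<partial>N)"
  unfolding of_real_mult[symmetric] exp_of_real by (rule integral_complex_of_real)

text \<open>Half of the room \<open>d\<close> in the exponent pays for the linear factor. The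
  right-hand side is written without absolute values so that it is integrable as soon as two
  neighbouring exponentials are.\<close>

lemma abs_mult_exp_le:
  fixes x d :: real
  assumes "d > 0"
  shows "\<bar>x\<bar> * exp (d / 2 * \<bar>x\<bar>) \<le> 2 / d * (exp (d * x) + exp (- d * x))"
proof -
  have "d / 2 * \<bar>x\<bar> \<le> exp (d / 2 * \<bar>x\<bar>)"
    using exp_ge_add_one_self[of "d / 2 * \<bar>x\<bar>"] by linarith
  then have "\<bar>x\<bar> \<le> 2 / d * exp (d / 2 * \<bar>x\<bar>)" using assms by (simp add: field_simps)
  then have "\<bar>x\<bar> * exp (d / 2 * \<bar>x\<bar>) \<le> 2 / d * exp (d / 2 * \<bar>x\<bar>) * exp (d / 2 * \<bar>x\<bar>)"
    by (rule mult_right_mono) simp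
  also have "\<dots> = 2 / d * exp (d * \<bar>x\<bar>)" by (simp flip: exp_add)
  also have "\<dots> \<le> 2 / d * (exp (d * x) + exp (- d * x))"
    using assms by (intro mult_left_mono) (auto simp: abs_if)
  finally show ?thesis .
qed

text \<open>Dominated convergence for the difference quotients, taken along arbitrary null sequences
  of increments. The majorant uses the exponentials at \<open>r + d\<close> and
  \<open>r - d\<close>, both of which lie in \<open>I\<close>.\<close>

lemma mgf_has_field_derivative:
  fixes N :: "real measure"
  assumes [measurable_cong]: "sets N = sets borel"
    and "open I" "Re z \<in> I"
    and int: "\<And>t. t \<in> I \<Longrightarrow> integrable N (\<lambda>x. exp (t * x))"
  shows "((\<lambda>z. \<integral>x. exp (z * complex_of_real x) \<partial>N) has_field_derivative
     (\<integral>x. complex_of_real x * exp (z * complex_of_real x) \<partial>N)) (at z)"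
proof -
  define r where "r = Re z"
  obtain d where d: "d > 0" "cball r d \<subseteq> I"
    using assms(2,3) unfolding r_def by (auto simp: open_contains_cball)
  have rI: "r + d \<in> I" "r - d \<in> I" "r \<in> I" using d by (auto simp: dist_real_def)
  define w where "w x = 2 / d * (exp ((r + d) * x) + exp ((r - d) * x))" for x
  have wint: "integrable N w" unfolding w_def using int rI by auto
  let ?B = "\<lambda>z. \<integral>x. exp (z * complex_of_real x) \<partial>N"
  let ?f = "\<lambda>h x. (exp ((z + h) * complex_of_real x) - exp (z * complex_of_real x)) / h"
  have bound: "norm (?f h x) \<le> w x" if h: "h \<noteq> 0" "norm h \<le> d / 2" for h x
  proof -
    have "?f h x = exp (z * x) * ((exp (h * x) - 1) / h)"
      using h by (simp add: field_simps flip: exp_add)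
    have "norm (?f h x) = exp (r * x) * (norm (exp (h * x) - 1) / norm h)"
      unfolding \<open>?f h x = _\<close> by (simp add: norm_mult norm_divide r_def)
    also have "\<dots> \<le> exp (r * x) * (norm (h * x) * exp (norm (h * x)) / norm h)"
      by (intro mult_left_mono divide_right_mono norm_exp_minus_one_le) auto
    also have "\<dots> = exp (r * x) * (\<bar>x\<bar> * exp (norm h * \<bar>x\<bar>))"
      using h by (simp add: norm_mult)
    also have "\<dots> \<le> exp (r * x) * (\<bar>x\<bar> * exp (d / 2 * \<bar>x\<bar>))"
      using h by (intro mult_left_mono iffD2[OF exp_le_cancel_iff] mult_right_mono) auto
    also have "\<dots> \<le> exp (r * x) * (2 / d * (exp (d * x) + exp (- d * x)))"
      using abs_mult_exp_le[OF d(1)] by (intro mult_left_mono) auto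
    also have "\<dots> = w x" unfolding w_def by (simp add: algebra_simps flip: exp_add)
    finally show ?thesis .
  qed
  have key: "(\<lambda>n. (?B (z + X n) - ?B z) / X n) \<longlonglongrightarrow> (\<integral>x. complex_of_real x * exp (z * complex_of_real x) \<partial>N)"
    if X: "\<And>n. X n \<noteq> 0" "X \<longlonglongrightarrow> 0" for X
  proof -
    \<comment> \<open>The majorant is valid only for increments of norm at most
      \<open>d / 2\<close>, so a tail of the sequence is used and the shift is undone at the
      end.\<close>
    obtain n0 where n0: "\<And>n. n \<ge> n0 \<Longrightarrow> norm (X n) < d / 2"
      using LIMSEQ_D[OF X(2), of "d / 2"] d(1) by auto
    have "(\<lambda>n. \<integral>x. ?f (X (n + n0)) x \<partial>N) \<longlonglongrightarrow> (\<integral>x. complex_of_real x * exp (z * complex_of_real x) \<partial>N)"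
    proof (rule integral_dominated_convergence[OF _ _ wint])
      show "AE x in N. (\<lambda>n. ?f (X (n + n0)) x) \<longlonglongrightarrow> complex_of_real x * exp (z * complex_of_real x)"
      proof (rule AE_I2)
        fix x
        have "((\<lambda>z. exp (z * complex_of_real x)) has_field_derivative complex_of_real x * exp (z * complex_of_real x)) (at z)"
          by (auto intro!: derivative_eq_intros)
        then have "((\<lambda>h. ?f h x) \<longlongrightarrow> complex_of_real x * exp (z * complex_of_real x)) (at 0)"
          by (simp add: DERIV_def)
        then have "(\<lambda>n. ?f (X n) x) \<longlonglongrightarrow> complex_of_real x * exp (z * complex_of_real x)"
          using X by (auto simp: tendsto_at_iff_sequentially o_def)
        then show "(\<lambda>n. ?f (X (n + n0)) x) \<longlonglongrightarrow> complex_of_real x * exp (z * complex_of_real x)"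
          by (rule LIMSEQ_ignore_initial_segment)
      qed
      show "AE x in N. norm (?f (X (n + n0)) x) \<le> w x" for n
        using bound[of "X (n + n0)"] X(1) n0[of "n + n0"] by auto
    qed auto
    moreover have "(\<integral>x. ?f (X (n + n0)) x \<partial>N) = (?B (z + X (n + n0)) - ?B z) / X (n + n0)" for n
    proof -
      have "Re (z + X (n + n0)) \<in> I"
        using n0[of "n + n0"] abs_Re_le_cmod[of "X (n + n0)"] d unfolding r_def
        by (intro subsetD[OF d(2)]) (auto simp: dist_real_def r_def)
      then have "integrable N (\<lambda>x. exp ((z + X (n + n0)) * complex_of_real x))"
        by (intro mgf_integrable_complex int assms(1))
      moreover have "integrable N (\<lambda>x. exp (z * complex_of_real x))"
        by (intro mgf_integrable_complex int assms(1,3))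
      ultimately show ?thesis by simp
    qed
    ultimately have "(\<lambda>n. (?B (z + X (n + n0)) - ?B z) / X (n + n0)) \<longlonglongrightarrow> (\<integral>x. complex_of_real x * exp (z * complex_of_real x) \<partial>N)"
      by (simp only:)
    then show ?thesis by (rule LIMSEQ_offset)
  qed
  show ?thesis
    unfolding DERIV_def tendsto_at_iff_sequentially o_def
    using key by auto
qed

lemma mgf_holomorphic:
  fixes N :: "real measure"
  assumes "sets N = sets borel" "open I"
    and "\<And>t. t \<in> I \<Longrightarrow> integrable N (\<lambda>x. exp (t * x))"
  shows "(\<lambda>z. \<integral>x. exp (z * complex_of_real x) \<partial>N) holomorphic_on {z. Re z \<in> I}"
proof -
  have "open {z. Re z \<in> I}"
    using open_vimage[OF assms(2), of Re] continuous_on_Re[OF continuous_on_id, of UNIV]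
    by (simp add: vimage_def id_def)
  then show ?thesis
    using mgf_has_field_derivative[OF assms(1,2) _ assms(3)]
    by (auto simp: holomorphic_on_open)
qed

text \<open>The identity theorem on the strip: the real segment is contained in it and accumulates
  at the point \<open>Re z\<close>.\<close>

lemma strip_identity:
  assumes "f holomorphic_on {z. Re z \<in> {a<..<b}}" "g holomorphic_on {z. Re z \<in> {a<..<b}}"
    and eq: "\<And>t. a < t \<Longrightarrow> t < b \<Longrightarrow> f (complex_of_real t) = g (complex_of_real t)"
    and z: "a < Re z" "Re z < b"
  shows "f z = g z"
proof -
  let ?S = "{z. Re z \<in> {a<..<b}}"
  have S: "?S = {z. a < Re z} \<inter> {z. Re z < b}" by auto
  have "open ?S" unfolding S by (intro open_Int open_halfspace_Re_gt open_halfspace_Re_lt)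
  have "connected ?S"
    unfolding S by (intro convex_connected convex_Int convex_halfspace_Re_gt convex_halfspace_Re_lt)
  have mem: "complex_of_real (Re z) \<in> complex_of_real ` {a<..<b}" using z by simp
  \<comment> \<open>A connected set with at least two points has no isolated point; the midpoint of
    \<open>a\<close> and \<open>Re z\<close> serves as the second point.\<close>
  have lim: "complex_of_real (Re z) islimpt complex_of_real ` {a<..<b}"
  proof (rule connected_imp_perfect[OF _ mem])
    show "connected (complex_of_real ` {a<..<b})"
      by (intro connected_continuous_image continuous_intros) auto
    have "complex_of_real ((a + Re z) / 2) \<in> complex_of_real ` {a<..<b}"
      using z by (intro imageI) simp
    moreover have "complex_of_real ((a + Re z) / 2) \<noteq> complex_of_real (Re z)"
      unfolding of_real_eq_iff using z by simp
    ultimately show "complex_of_real ` {a<..<b} \<noteq> {x}" for x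
      using mem by (metis singletonD)
  qed
  have "(\<lambda>z. f z - g z) z = 0"
  proof (rule analytic_continuation[where f = "\<lambda>z. f z - g z", OF _ \<open>open ?S\<close> \<open>connected ?S\<close> _ _ lim])
    show "(\<lambda>z. f z - g z) holomorphic_on ?S"
      by (rule holomorphic_on_diff[OF assms(1,2)])
    show "f w - g w = 0" if "w \<in> complex_of_real ` {a<..<b}" for w
      using that eq by auto
  qed (use z in auto)
  then show ?thesis by simp
qed

text \<open>Tilting by \<open>exp (r * x)\<close> at the midpoint \<open>r\<close> and normalising
  turns both measures into probability measures. The identity theorem extends the equality of the
  transforms to the vertical line through \<open>r\<close>, where they are multiples of the
  characteristic functions. Nonnegative integrals let the lemma apply to infinite measures, such as
  those with a scale function as density.\<close>

lemma mgf_unique: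
  fixes M N :: "real measure"
  assumes sets[measurable_cong]: "sets M = sets borel" "sets N = sets borel"
    and ab: "a < b"
    and eq: "\<And>t. a < t \<Longrightarrow> t < b \<Longrightarrow>
      (\<integral>\<^sup>+x. ennreal (exp (t * x)) \<partial>M) = (\<integral>\<^sup>+x. ennreal (exp (t * x)) \<partial>N)"
    and fin: "\<And>t. a < t \<Longrightarrow> t < b \<Longrightarrow> (\<integral>\<^sup>+x. ennreal (exp (t * x)) \<partial>M) < \<infinity>"
  shows "M = N"
proof -
  define r where "r = (a + b) / 2"
  have r: "a < r" "r < b" using ab by (auto simp: r_def)
  have space: "space M = UNIV" "space N = UNIV"
    using sets_eq_imp_space_eq[OF sets(1)] sets_eq_imp_space_eq[OF sets(2)] by auto
  have intM: "integrable M (\<lambda>x. exp (t * x))" if "a < t" "t < b" for t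
    using fin[OF that] by (intro integrableI_nonneg) auto
  have intN: "integrable N (\<lambda>x. exp (t * x))" if "a < t" "t < b" for t
    using fin[OF that] eq[OF that] by (intro integrableI_nonneg) auto
  define C where "C = (\<integral>x. exp (r * x) \<partial>M)"
  have CM: "(\<integral>\<^sup>+x. ennreal (exp (r * x)) \<partial>M) = ennreal C"
    unfolding C_def by (rule nn_integral_eq_integral) (use intM[OF r] in auto)
  then have CN: "(\<integral>\<^sup>+x. ennreal (exp (r * x)) \<partial>N) = ennreal C" using eq[OF r] by simp
  have eqR: "(\<integral>x. exp (t * x) \<partial>M) = (\<integral>x. exp (t * x) \<partial>N)" if "a < t" "t < b" for t
    using eq[OF that] by (simp add: integral_eq_nn_integral)
  have "C \<ge> 0" unfolding C_def by simp
  show ?thesis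
  \<comment> \<open>If \<open>C = 0\<close>, the tilt cannot be normalised; since the exponential is
    positive, both measures then vanish.\<close>
  proof (cases "C = 0")
    case True
    have "emeasure M UNIV = 0" "emeasure N UNIV = 0"
      using CM CN True space
      by (auto simp: nn_integral_0_iff_AE AE_iff_measurable[OF _ refl])
    then have "emeasure M A = 0" "emeasure N A = 0" for A
      using emeasure_space[of M A] emeasure_space[of N A] space by auto
    then show ?thesis by (intro measure_eqI) (auto simp: sets)
  next
    case False
    with \<open>C \<ge> 0\<close> have C: "C > 0" by simp
    define T where "T M = density M (\<lambda>x. ennreal (exp (r * x) / C))" for M :: "real measure"
    have distr: "real_distribution (T L)"
      if "sets L = sets borel" "(\<integral>\<^sup>+x. ennreal (exp (r * x)) \<partial>L) = ennreal C" for L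
    proof -
      note [measurable_cong] = that(1)
      have "emeasure (T L) (space (T L)) = (\<integral>\<^sup>+x. ennreal (exp (r * x) / C) \<partial>L)"
        unfolding T_def by (auto simp: emeasure_density cong: nn_integral_cong)
      also have "\<dots> = (\<integral>\<^sup>+x. ennreal (exp (r * x)) / ennreal C \<partial>L)"
        using C by (simp add: divide_ennreal)
      also have "\<dots> = 1"
        using that(2) C by (simp add: nn_integral_divide ennreal_divide_self)
      finally have "prob_space (T L)" by (rule prob_spaceI)
      then show ?thesis
        unfolding real_distribution_def real_distribution_axioms_def by (auto simp: T_def that(1))
    qed
    have untilt: "L = density (T L) (\<lambda>x. ennreal (C * exp (- r * x)))" if "sets L = sets borel" for L
    proof -
      note [measurable_cong] = that
      have "density (T L) (\<lambda>x. ennreal (C * exp (- r * x))) = density L (\<lambda>x. ennreal (exp (r * x) / C) * ennreal (C * exp (- r * x)))"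
        unfolding T_def by (rule density_density_eq) auto
      also have "\<dots> = density L (\<lambda>_. 1)"
        using C by (intro density_cong) (auto simp flip: ennreal_mult exp_add)
      finally show ?thesis by (simp add: density_1)
    qed
    have char: "char (T L) t = (\<integral>x. exp ((complex_of_real r + \<i> * t) * complex_of_real x) \<partial>L) / C"
      if "sets L = sets borel" for L t
    proof -
      note [measurable_cong] = that
      have "char (T L) t = (\<integral>x. (exp (r * x) / C) *\<^sub>R iexp (t * x) \<partial>L)"
        unfolding T_def char_def using C by (subst integral_density) auto
      also have "\<dots> = (\<integral>x. exp ((complex_of_real r + \<i> * t) * complex_of_real x) / C \<partial>L)"
        proof (intro Bochner_Integration.integral_cong refl)
        fix x
        have "exp ((complex_of_real r + \<i> * t) * complex_of_real x) = complex_of_real (exp (r * x)) * iexp (t * x)"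
          unfolding exp_of_real[symmetric] exp_add[symmetric] by (simp add: algebra_simps)
        then show "(exp (r * x) / C) *\<^sub>R iexp (t * x) = exp ((complex_of_real r + \<i> * t) * complex_of_real x) / C"
          by (simp add: scaleR_conv_of_real)
      qed
      finally show ?thesis by simp
    qed
    have "char (T M) = char (T N)"
    proof
      fix t :: real
      have "(\<integral>x. exp ((complex_of_real r + \<i> * t) * complex_of_real x) \<partial>M)
          = (\<integral>x. exp ((complex_of_real r + \<i> * t) * complex_of_real x) \<partial>N)"
      proof (rule strip_identity[where a = a and b = b
            and f = "\<lambda>z. \<integral>x. exp (z * complex_of_real x) \<partial>M"
            and g = "\<lambda>z. \<integral>x. exp (z * complex_of_real x) \<partial>N"])
        show "(\<lambda>z. \<integral>x. exp (z * complex_of_real x) \<partial>M) holomorphic_on {z. Re z \<in> {a<..<b}}"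
          "(\<lambda>z. \<integral>x. exp (z * complex_of_real x) \<partial>N) holomorphic_on {z. Re z \<in> {a<..<b}}"
          using intM intN by (intro mgf_holomorphic sets open_greaterThanLessThan; simp)+
        show "(\<integral>x. exp (complex_of_real s * complex_of_real x) \<partial>M)
            = (\<integral>x. exp (complex_of_real s * complex_of_real x) \<partial>N)" if "a < s" "s < b" for s
          unfolding mgf_of_real eqR[OF that] ..
      qed (use r in auto)
      then show "char (T M) t = char (T N) t" using sets by (simp add: char)
    qed
    then have "T M = T N"
      by (intro Levy_uniqueness distr) (auto simp: sets CM CN)
    then show ?thesis using untilt sets by metis
  qed
qed

text \<open>Dominated convergence against the functions \<open>cts_step\<close>, which suffice for
  weak convergence. The limits of laws needed later are thereby reduced to almost sure limits on one
  product space.\<close>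

lemma weak_conv_m_distr_AE:
  fixes f :: "nat \<Rightarrow> 'b \<Rightarrow> real"
  assumes "prob_space P" and [measurable]: "\<And>n. f n \<in> borel_measurable P" "g \<in> borel_measurable P"
    and lim: "AE x in P. (\<lambda>n. f n x) \<longlonglongrightarrow> g x"
  shows "weak_conv_m (\<lambda>n. distr P borel (f n)) (distr P borel g)"
proof -
  interpret prob_space P by fact
  show ?thesis
  proof (rule integral_cts_step_conv_imp_weak_conv)
    fix x y :: real assume xy: "x < y"
    have cont: "isCont (cts_step x y) z" for z
      using uniformly_continuous_imp_continuous[OF cts_step_uniformly_continuous[OF xy]]
      by (auto simp: continuous_on_eq_continuous_at)
    have [measurable]: "cts_step x y \<in> borel_measurable borel"
      using cont by (intro borel_measurable_continuous_onI) (auto simp: continuous_on_eq_continuous_at)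
    have "(\<lambda>n. \<integral>w. cts_step x y (f n w) \<partial>P) \<longlonglongrightarrow> (\<integral>w. cts_step x y (g w) \<partial>P)"
    proof (rule integral_dominated_convergence[where w = "\<lambda>_. 1"])
      show "AE w in P. (\<lambda>n. cts_step x y (f n w)) \<longlonglongrightarrow> cts_step x y (g w)"
        using lim by eventually_elim (rule isCont_tendsto_compose[OF cont])
      show "AE w in P. norm (cts_step x y (f n w)) \<le> 1" for n
        using xy by (auto simp: cts_step_def)
    qed auto
    then show "(\<lambda>n. integral\<^sup>L (distr P borel (f n)) (cts_step x y)) \<longlonglongrightarrow> integral\<^sup>L (distr P borel g) (cts_step x y)"
      by (simp add: integral_distr)
  qed auto
qed

section \<open>A Wiener--Hopf argument\<close>

text \<open>On the circle of radius \<open>R\<close> one has \<open>\<bar>z\<^sup>2 + R\<^sup>2\<bar> = 2 R \<bar>Re z\<bar>\<close>, so the factor \<open>z\<^sup>2 + R\<^sup>2\<close> cancels the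
  singularity of the bound on the imaginary axis before the maximum principle is applied.\<close>

lemma entire_affine:
  assumes hol: "f holomorphic_on UNIV" and "C \<ge> 0"
    and bound: "\<And>z. Re z \<noteq> 0 \<Longrightarrow> norm (f z) \<le> norm z * (1 + C / \<bar>Re z\<bar>)"
  obtains a b where "\<And>z. f z = a + b * z"
proof -
  have growth: "norm (f z) \<le> 8 / 3 * (2 + C) * norm z ^ 1" if z: "1 \<le> norm z" for z
  proof -
    define R where "R = 2 * norm z"
    have R: "R > 0" "norm z \<le> R" using z by (auto simp: R_def)
    define g where "g u = (u\<^sup>2 + (complex_of_real R)\<^sup>2) * f u" for u
    have hol_g: "g holomorphic_on A" for A
      unfolding g_def using holomorphic_on_subset[OF hol, of A] by (auto intro!: holomorphic_intros)
    have "norm (g z) \<le> 2 * R\<^sup>2 * (R + C)"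
    proof (rule maximum_modulus_frontier[where f = g and S = "cball (0::complex) R" and \<xi> = z])
      fix u :: complex assume "u \<in> frontier (cball 0 R)"
      then have u: "norm u = R" using R by (simp add: frontier_cball dist_norm)
      have "u * cnj u = (complex_of_real R)\<^sup>2"
        using complex_norm_square[of u] u by simp
      then have "u\<^sup>2 + (complex_of_real R)\<^sup>2 = u * (u + cnj u)"
        by (simp add: power2_eq_square algebra_simps)
      also have "\<dots> = u * complex_of_real (2 * Re u)"
        by (simp add: complex_add_cnj)
      finally have "norm (g u) = R * (2 * \<bar>Re u\<bar>) * norm (f u)"
        unfolding g_def norm_mult by (simp add: u norm_mult)
      also have "\<dots> \<le> 2 * R\<^sup>2 * (R + C)"
      proof (cases "Re u = 0")
        case False
        have "R * (2 * \<bar>Re u\<bar>) * norm (f u) \<le> R * (2 * \<bar>Re u\<bar>) * (R * (1 + C / \<bar>Re u\<bar>))"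
          using bound[OF False] R u by (intro mult_left_mono) auto
        also have "\<dots> = 2 * R\<^sup>2 * (\<bar>Re u\<bar> + C)"
          using False by (simp add: field_simps power2_eq_square)
        also have "\<dots> \<le> 2 * R\<^sup>2 * (R + C)"
          using abs_Re_le_cmod[of u] u by (intro mult_left_mono) auto
        finally show ?thesis .
      qed (use R \<open>C \<ge> 0\<close> in simp)
      finally show "norm (g u) \<le> 2 * R\<^sup>2 * (R + C)" .
    qed (use hol_g R in \<open>auto intro: holomorphic_on_imp_continuous_on\<close>)
    \<comment> \<open>The radius is twice the norm of \<open>z\<close>, so the factor has norm at
      least \<open>R\<close> squared minus a quarter of it, whence \<open>3 / 4\<close>.\<close>
    moreover have "norm (g z) \<ge> 3 / 4 * R\<^sup>2 * norm (f z)"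
    proof -
      have "norm ((complex_of_real R)\<^sup>2) - norm (z\<^sup>2) \<le> norm (z\<^sup>2 + (complex_of_real R)\<^sup>2)"
        by (metis add.commute norm_diff_ineq)
      then have "3 / 4 * R\<^sup>2 \<le> norm (z\<^sup>2 + (complex_of_real R)\<^sup>2)"
        by (simp add: norm_power R_def power_mult_distrib)
      then show ?thesis unfolding g_def norm_mult by (intro mult_right_mono) auto
    qed
    ultimately have "R\<^sup>2 * (3 / 4 * norm (f z)) \<le> R\<^sup>2 * (2 * (R + C))" by (simp add: algebra_simps)
    then have "norm (f z) \<le> 8 / 3 * (R + C)" using R by simp
    also have "\<dots> \<le> 8 / 3 * ((2 + C) * norm z)"
      using mult_left_mono[OF z \<open>C \<ge> 0\<close>] by (simp add: R_def algebra_simps)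
    finally show ?thesis by (simp only: power_one_right mult.assoc)
  qed
  have "f z = f 0 + deriv f 0 * z" for z
    using Liouville_polynomial[OF hol growth, where \<xi> = z] by (simp add: numeral_eq_Suc)
  then show ?thesis by (rule that)
qed

text \<open>The analytic input, separated from the process. In the application \<open>\<nu>\<close>
  is the law of \<open>Y\<close> at an exponential time of rate \<open>p\<close>, and
  \<open>N\<close> is the reflected \<open>0\<close>-scale function, which supplies
  \<open>1 / \<psi>\<close> as a transform. \<open>psi_le\<close> and \<open>psi_ge\<close> compare
  the convex exponent with its chord through the origin and the point over \<open>\<Phi>\<close>;
  \<open>nonlattice\<close> excludes further solutions of \<open>\<psi> = p\<close> on the vertical
  line through \<open>\<Phi>\<close>.\<close>

locale wiener_hopf =
  fixes \<nu> N :: "real measure" and p \<Phi>\<^sub>0 \<Phi> :: real and \<psi> :: "real \<Rightarrow> real"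
  assumes distr_nu: "real_distribution \<nu>"
    and pos: "p > 0" "\<Phi>\<^sub>0 \<ge> 0" "\<Phi>\<^sub>0 < \<Phi>"
    and int_nu: "\<And>t. 0 \<le> t \<Longrightarrow> t < \<Phi> \<Longrightarrow> integrable \<nu> (\<lambda>x. exp (t * x))"
    and mgf_nu: "\<And>t. 0 \<le> t \<Longrightarrow> t < \<Phi> \<Longrightarrow> (\<integral>x. exp (t * x) \<partial>\<nu>) = p / (p - \<psi> t)"
    and psi_Phi: "\<psi> \<Phi> = p"
    and psi_le: "\<And>t. 0 < t \<Longrightarrow> t < \<Phi> \<Longrightarrow> \<psi> t \<le> p * t / \<Phi>"
    and psi_ge: "\<And>t. \<Phi> < t \<Longrightarrow> p * t / \<Phi> \<le> \<psi> t"
    and psi_pos: "\<And>t. \<Phi>\<^sub>0 < t \<Longrightarrow> 0 < \<psi> t"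
    and sets_N: "sets N = sets borel"
    and int_N: "\<And>t. \<Phi>\<^sub>0 < t \<Longrightarrow> integrable N (\<lambda>x. exp (t * x))"
    and mgf_N: "\<And>t. \<Phi>\<^sub>0 < t \<Longrightarrow> (\<integral>x. exp (t * x) \<partial>N) = 1 / \<psi> t"
    and nonlattice: "\<And>s. s \<noteq> 0 \<Longrightarrow>
      (\<integral>x. exp ((complex_of_real \<Phi> + \<i> * complex_of_real s) * complex_of_real x) \<partial>N) \<noteq> 1 / p"
begin

interpretation nu: real_distribution \<nu> by (rule distr_nu)

definition "A z = p * (\<integral>x. exp (z * complex_of_real x) \<partial>N)"
text \<open>The origin is assigned to \<open>Nm\<close>, so that the transform of \<open>Np\<close>
  vanishes as the exponent tends to minus infinity.\<close>

definition "Np = density \<nu> (\<lambda>x. ennreal (indicator {0<..} x))"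
definition "Nm = density \<nu> (\<lambda>x. ennreal (indicator {..0} x))"
definition "Lp z = (\<integral>x. exp (z * complex_of_real x) \<partial>Np)"
definition "Lm z = (\<integral>x. exp (z * complex_of_real x) \<partial>Nm)"

section \<open>The two halves of the law and their transforms\<close>

lemma sets_NpNm [simp, measurable_cong]: "sets Np = sets borel" "sets Nm = sets borel"
  by (simp_all add: Np_def Nm_def)

lemma prob_UNIV: "measure \<nu> UNIV = 1"
  using nu.prob_space by simp

lemma Phi_pos: "\<Phi> > 0" using pos by simp

lemma p_minus_psi: assumes "0 < t" "t < \<Phi>" shows "p * (\<Phi> - t) / \<Phi> \<le> p - \<psi> t"
  using psi_le[OF assms] Phi_pos by (simp add: field_simps)

lemma psi_minus_p: assumes "\<Phi> < t" shows "p * (t - \<Phi>) / \<Phi> \<le> \<psi> t - p"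
  using psi_ge[OF assms] Phi_pos by (simp add: field_simps)

lemma int_Np: assumes "t < \<Phi>" shows "integrable Np (\<lambda>x. exp (t * x))"
proof -
  \<comment> \<open>For negative \<open>t\<close> the exponential is at most one on the positive
    half line, so the exponent \<open>0\<close> dominates.\<close>
  have "integrable \<nu> (\<lambda>x. exp (max t 0 * x))" using assms Phi_pos by (intro int_nu) auto
  then have "integrable \<nu> (\<lambda>x. indicator {0<..} x *\<^sub>R exp (t * x))"
    by (rule Bochner_Integration.integrable_bound)
      (auto simp: indicator_def intro!: mult_right_mono)
  then show ?thesis unfolding Np_def by (subst integrable_density) auto
qed

lemma int_Nm: assumes "t \<ge> 0" shows "integrable Nm (\<lambda>x. exp (t * x))"
proof -
  have "integrable \<nu> (\<lambda>x. indicator {..0} x *\<^sub>R exp (t * x))"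
    using assms
    by (intro nu.integrable_const_bound[where B = 1])
      (auto simp: indicator_def mult_nonneg_nonpos)
  then show ?thesis unfolding Nm_def by (subst integrable_density) auto
qed

lemma integral_Np: "(\<integral>x. exp (t * x) \<partial>Np) = (\<integral>x. indicator {0<..} x * exp (t * x) \<partial>\<nu>)"
  unfolding Np_def by (subst integral_density) auto

lemma integral_Nm: "(\<integral>x. exp (t * x) \<partial>Nm) = (\<integral>x. indicator {..0} x * exp (t * x) \<partial>\<nu>)"
  unfolding Nm_def by (subst integral_density) auto

lemma integral_Np_Nm:
  assumes "0 \<le> t" "t < \<Phi>"
  shows "(\<integral>x. exp (t * x) \<partial>Np) + (\<integral>x. exp (t * x) \<partial>Nm) = p / (p - \<psi> t)"
proof -
  have "integrable \<nu> (\<lambda>x. indicator {0<..} x * exp (t * x))" "integrable \<nu> (\<lambda>x. indicator {..0} x * exp (t * x))"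
    by (rule Bochner_Integration.integrable_bound[OF int_nu[OF assms]]; auto simp: indicator_def)+
  then have "(\<integral>x. indicator {0<..} x * exp (t * x) \<partial>\<nu>) + (\<integral>x. indicator {..0} x * exp (t * x) \<partial>\<nu>)
     = (\<integral>x. indicator {0<..} x * exp (t * x) + indicator {..0} x * exp (t * x) \<partial>\<nu>)"
    by simp
  also have "\<dots> = (\<integral>x. exp (t * x) \<partial>\<nu>)"
    by (intro Bochner_Integration.integral_cong) (auto simp: indicator_def)
  finally show ?thesis unfolding integral_Np integral_Nm mgf_nu[OF assms] .
qed

lemma norm_Lm_le: assumes "Re z \<ge> 0" shows "norm (Lm z) \<le> 1"
proof -
  have "norm (Lm z) \<le> (\<integral>x. exp (Re z * x) \<partial>Nm)"
    unfolding Lm_def by (rule mgf_norm_le) (use int_Nm assms in auto)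
  also have "\<dots> \<le> (\<integral>x. 1 \<partial>\<nu>)"
    unfolding integral_Nm using assms
    by (intro integral_mono_AE' AE_I2) (auto simp: indicator_def mult_nonneg_nonpos)
  finally show ?thesis by (simp add: prob_UNIV)
qed

text \<open>For nonpositive real part the mass bound one applies. Otherwise the transform of
  \<open>Nm\<close> is dropped from the total \<open>p / (p - \<psi> t)\<close>, and the chord
  inequality turns that into \<open>\<Phi> / (\<Phi> - t)\<close>. The common form is the one that
  \<open>entire_affine\<close> asks for.\<close>

lemma norm_Lp_le: assumes "Re z < \<Phi>" shows "norm (Lp z) \<le> 1 + \<Phi> / \<bar>Re z - \<Phi>\<bar>"
proof -
  have *: "norm (Lp z) \<le> (\<integral>x. exp (Re z * x) \<partial>Np)"
    unfolding Lp_def by (rule mgf_norm_le) (use int_Np assms in auto)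
  show ?thesis
  proof (cases "Re z \<le> 0")
    case True
    note *
    also have "(\<integral>x. exp (Re z * x) \<partial>Np) \<le> (\<integral>x. 1 \<partial>\<nu>)"
      unfolding integral_Np using True
      by (intro integral_mono_AE' AE_I2) (auto simp: indicator_def mult_nonpos_nonneg)
    also have "\<dots> \<le> 1 + \<Phi> / \<bar>Re z - \<Phi>\<bar>" using Phi_pos by (simp add: prob_UNIV)
    finally show ?thesis .
  next
    case False
    have "(\<integral>x. exp (Re z * x) \<partial>Nm) \<ge> 0" by simp
    with * have "norm (Lp z) \<le> p / (p - \<psi> (Re z))"
      using integral_Np_Nm[of "Re z"] False assms by linarith
    also have "\<dots> \<le> p / (p * (\<Phi> - Re z) / \<Phi>)"
      using False assms pos Phi_pos by (intro divide_left_mono p_minus_psi mult_pos_pos divide_pos_pos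
          less_le_trans[OF _ p_minus_psi]) auto
    also have "\<dots> = \<Phi> / \<bar>Re z - \<Phi>\<bar>" using assms pos by simp
    finally show ?thesis by simp
  qed
qed

lemma A_of_real: "t > \<Phi>\<^sub>0 \<Longrightarrow> A (complex_of_real t) = complex_of_real (p / \<psi> t)"
  unfolding A_def mgf_of_real by (simp add: mgf_N)

lemma A_Phi: "A \<Phi> = 1"
  using A_of_real[of \<Phi>] pos psi_Phi by simp

lemma norm_A_le: assumes "Re z > \<Phi>\<^sub>0" shows "norm (A z) \<le> p / \<psi> (Re z)"
proof -
  have "norm (\<integral>x. exp (z * complex_of_real x) \<partial>N) \<le> 1 / \<psi> (Re z)"
    using mgf_norm_le[OF sets_N int_N[OF assms]] mgf_N[OF assms] by simp
  then show ?thesis unfolding A_def using pos mult_left_mono[of _ "1 / \<psi> (Re z)" p] by (simp add: norm_mult)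
qed

lemma A_holomorphic: "A holomorphic_on {z. Re z \<in> {\<Phi>\<^sub>0<..}}"
  unfolding A_def by (intro holomorphic_intros mgf_holomorphic sets_N) (auto intro: int_N)

lemma Lp_holomorphic: "Lp holomorphic_on {z. Re z \<in> {..<\<Phi>}}"
  unfolding Lp_def by (intro mgf_holomorphic) (auto intro: int_Np)

lemma Lm_holomorphic: "Lm holomorphic_on {z. Re z \<in> {0<..}}"
  unfolding Lm_def by (intro mgf_holomorphic) (auto intro: int_Nm)

text \<open>On the real segment this is the algebra of \<open>p / (p - \<psi> t)\<close> and
  \<open>p / \<psi> t\<close>, and \<open>strip_identity\<close> extends it. The form without
  division also shows that \<open>A\<close> does not take the value one in the strip.\<close>

lemma Lp_Lm_A:
  assumes "\<Phi>\<^sub>0 < Re z" "Re z < \<Phi>"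
  shows "(Lp z + Lm z) * (A z - 1) = A z"
proof (rule strip_identity[where a = "\<Phi>\<^sub>0" and b = "\<Phi>" and f = "\<lambda>z. (Lp z + Lm z) * (A z - 1)"])
  show "(\<lambda>z. (Lp z + Lm z) * (A z - 1)) holomorphic_on {z. Re z \<in> {\<Phi>\<^sub>0<..<\<Phi>}}"
    using pos by (intro holomorphic_intros holomorphic_on_subset[OF Lp_holomorphic]
      holomorphic_on_subset[OF Lm_holomorphic] holomorphic_on_subset[OF A_holomorphic]) auto
  show "A holomorphic_on {z. Re z \<in> {\<Phi>\<^sub>0<..<\<Phi>}}"
    by (intro holomorphic_on_subset[OF A_holomorphic]) auto
  fix t assume t: "\<Phi>\<^sub>0 < t" "t < \<Phi>"
  have "0 < p * (\<Phi> - t) / \<Phi>" using t pos by simp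
  also have "\<dots> \<le> p - \<psi> t" using t pos by (intro p_minus_psi) auto
  finally have "p - \<psi> t > 0" .
  moreover have "\<psi> t > 0" using t by (rule_tac psi_pos)
  ultimately have "p / (p - \<psi> t) * (p / \<psi> t - 1) = p / \<psi> t" by (simp add: field_simps)
  moreover have "Lp (complex_of_real t) + Lm (complex_of_real t) = complex_of_real (p / (p - \<psi> t))"
    unfolding Lp_def Lm_def mgf_of_real using integral_Np_Nm[of t] t pos by (simp flip: of_real_add)
  ultimately show "(Lp (complex_of_real t) + Lm (complex_of_real t)) * (A (complex_of_real t) - 1) = A (complex_of_real t)"
    unfolding A_of_real[OF t(1)] by (metis of_real_1 of_real_diff of_real_mult)
qed (use assms in auto)

text \<open>Near \<open>\<Phi>\<close> the exponent equals \<open>p / A\<close> on the real line, so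
  it inherits differentiability from the holomorphic \<open>A\<close>; the derivative of
  \<open>A\<close> there is real because \<open>A\<close> is real on the line. The lower bound holds
  for every difference quotient from the right, by the chord inequality.\<close>

lemma psi_deriv:
  shows "(\<psi> has_real_derivative deriv \<psi> \<Phi>) (at \<Phi>)" and "deriv \<psi> \<Phi> \<ge> p / \<Phi>"
    and "deriv A \<Phi> = - complex_of_real (deriv \<psi> \<Phi> / p)"
proof -
  have op: "open {z. Re z \<in> {\<Phi>\<^sub>0<..}}" using open_halfspace_Re_gt[of "\<Phi>\<^sub>0"] by simp
  define D where "D = deriv A \<Phi>"
  have "(A has_field_derivative D) (at (complex_of_real \<Phi>))"
    unfolding D_def by (rule holomorphic_derivI[OF A_holomorphic op]) (use pos in auto)
  then have vd: "((\<lambda>t. A (complex_of_real t)) has_vector_derivative D) (at \<Phi>)"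
    by (rule has_vector_derivative_real_field)
  have "((\<lambda>t. Re (A (complex_of_real t))) has_real_derivative Re D) (at \<Phi>)"
    using bounded_linear.has_vector_derivative[OF bounded_linear_Re vd]
    by (simp add: has_real_derivative_iff_has_vector_derivative)
  then have d: "((\<lambda>t. p / \<psi> t) has_real_derivative Re D) (at \<Phi>)"
    by (rule has_field_derivative_transform_within_open[where S = "{\<Phi>\<^sub>0<..}"]) (use pos A_of_real in auto)
  have "((\<lambda>t. Im (A (complex_of_real t))) has_real_derivative Im D) (at \<Phi>)"
    using bounded_linear.has_vector_derivative[OF bounded_linear_Im vd]
    by (simp add: has_real_derivative_iff_has_vector_derivative)
  then have "((\<lambda>t. 0) has_real_derivative Im D) (at \<Phi>)"
    by (rule has_field_derivative_transform_within_open[where S = "{\<Phi>\<^sub>0<..}"]) (use pos A_of_real in auto)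
  then have Im: "Im D = 0" using DERIV_unique DERIV_const by blast
  have "((\<lambda>t. p / (p / \<psi> t)) has_real_derivative
      (0 * (p / \<psi> \<Phi>) - p * Re D) / (p / \<psi> \<Phi> * (p / \<psi> \<Phi>))) (at \<Phi>)"
    by (rule DERIV_divide[OF DERIV_const d]) (use pos psi_Phi in simp)
  then have "((\<lambda>t. p / (p / \<psi> t)) has_real_derivative - p * Re D) (at \<Phi>)"
    using pos psi_Phi by simp
  then have d2: "(\<psi> has_real_derivative - p * Re D) (at \<Phi>)"
    by (rule has_field_derivative_transform_within_open[where S = "{\<Phi>\<^sub>0<..}"]) (use pos in auto)
  then have eq: "deriv \<psi> \<Phi> = - p * Re D" by (rule DERIV_imp_deriv)
  show dd: "(\<psi> has_real_derivative deriv \<psi> \<Phi>) (at \<Phi>)" using d2 eq by simp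
  show "deriv A \<Phi> = - complex_of_real (deriv \<psi> \<Phi> / p)"
    using Im pos unfolding eq D_def[symmetric] by (simp add: complex_eq_iff)
  show "deriv \<psi> \<Phi> \<ge> p / \<Phi>"
  proof (rule tendsto_lowerbound)
    show "((\<lambda>t. (\<psi> t - \<psi> \<Phi>) / (t - \<Phi>)) \<longlongrightarrow> deriv \<psi> \<Phi>) (at_right \<Phi>)"
      using dd by (simp add: has_field_derivative_iff filterlim_at_split)
    show "\<forall>\<^sub>F t in at_right \<Phi>. p / \<Phi> \<le> (\<psi> t - \<psi> \<Phi>) / (t - \<Phi>)"
      using psi_minus_p psi_Phi by (auto simp: eventually_at_filter field_simps)
  qed simp
qed

lemma deriv_psi_pos: "deriv \<psi> \<Phi> > 0"
  using psi_deriv(2) pos Phi_pos by (meson divide_pos_pos less_le_trans)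

text \<open>\<open>A\<close> continues \<open>p / \<psi>\<close>, so \<open>R\<close> is \<open>A - 1\<close> with its zero at \<open>\<Phi>\<close> divided out; it has no other zeros.\<close>

definition "R z = (if z = complex_of_real \<Phi> then deriv A \<Phi> else (A z - A \<Phi>) / (z - \<Phi>))"

lemma R_holomorphic: "R holomorphic_on {z. Re z \<in> {\<Phi>\<^sub>0<..}}"
  unfolding R_def by (rule pole_lemma_open[OF A_holomorphic]) (use open_halfspace_Re_gt[of "\<Phi>\<^sub>0"] in simp)

text \<open>At \<open>\<Phi>\<close> the derivative of \<open>A\<close> is nonzero. Elsewhere
  \<open>A\<close> avoids one for three reasons: \<open>Lp_Lm_A\<close> to the left of the line
  through \<open>\<Phi>\<close>, \<open>nonlattice\<close> on it, and a modulus below one to its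
  right, where \<open>\<psi>\<close> exceeds \<open>p\<close>.\<close>

lemma R_nonzero:
  assumes "Re z > \<Phi>\<^sub>0"
  shows "R z \<noteq> 0"
proof (cases "z = \<Phi>")
  case True
  then show ?thesis using psi_deriv(3) deriv_psi_pos pos by (simp add: R_def)
next
  case False
  have "A z \<noteq> 1"
  proof -
    consider "Re z < \<Phi>" | "Re z = \<Phi>" | "Re z > \<Phi>" by linarith
    then show ?thesis
    proof cases
      case 1
      then show ?thesis using Lp_Lm_A[OF assms] by auto
    next
      case 2
      with False have "z = complex_of_real \<Phi> + \<i> * complex_of_real (Im z)" "Im z \<noteq> 0"
        by (auto simp: complex_eq_iff)
      then show ?thesis
        using nonlattice[of "Im z"] pos unfolding A_def by (auto simp: field_simps)
    next
      case 3
      have "p < p * Re z / \<Phi>" using 3 pos Phi_pos by (simp add: field_simps)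
      with psi_ge[OF 3] have "p < \<psi> (Re z)" by linarith
      with norm_A_le[OF assms] pos have "norm (A z) < 1"
        by (smt (verit) divide_less_eq_1_pos)
      then show ?thesis by auto
    qed
  qed
  then show ?thesis using False by (simp add: R_def A_Phi)
qed

text \<open>The two branches agree on the strip between \<open>\<Phi>\<^sub>0\<close> and \<open>\<Phi>\<close> by \<open>Lp_Lm_A\<close>.\<close>

definition "E z = (if z \<in> {z. Re z \<in> {..<\<Phi>}} then (z - \<Phi>) * Lp z else A z / R z - (z - \<Phi>) * Lm z)"

lemma E_holomorphic: "E holomorphic_on UNIV"
proof -
  have "E holomorphic_on {z. Re z \<in> {..<\<Phi>}} \<union> {z. Re z \<in> {\<Phi>\<^sub>0<..}}"
    unfolding E_def
  proof (rule holomorphic_on_If_Un)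
    show "(\<lambda>z. (z - \<Phi>) * Lp z) holomorphic_on {z. Re z \<in> {..<\<Phi>}}"
      by (intro holomorphic_intros Lp_holomorphic)
    show "(\<lambda>z. A z / R z - (z - \<Phi>) * Lm z) holomorphic_on {z. Re z \<in> {\<Phi>\<^sub>0<..}}"
      using pos R_nonzero
      by (intro holomorphic_intros A_holomorphic R_holomorphic holomorphic_on_subset[OF Lm_holomorphic]) auto
    fix z assume z: "z \<in> {z. Re z \<in> {..<\<Phi>}}" "z \<in> {z. Re z \<in> {\<Phi>\<^sub>0<..}}"
    then have zn: "z \<noteq> \<Phi>" by auto
    from z have "R z \<noteq> 0" by (intro R_nonzero) auto
    then have "A z - 1 \<noteq> 0" using zn by (auto simp: R_def A_Phi)
    then have "A z / R z = (z - \<Phi>) * (A z / (A z - 1))" using zn by (simp add: R_def A_Phi)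
    also have "A z / (A z - 1) = Lp z + Lm z"
      using Lp_Lm_A[of z] z \<open>A z - 1 \<noteq> 0\<close> by (simp add: nonzero_divide_eq_eq)
    finally show "(z - \<Phi>) * Lp z = A z / R z - (z - \<Phi>) * Lm z" by (simp add: algebra_simps)
  qed (use open_halfspace_Re_gt[of "\<Phi>\<^sub>0"] open_halfspace_Re_lt[of \<Phi>] in auto)
  moreover have "{z. Re z \<in> {..<\<Phi>}} \<union> {z. Re z \<in> {\<Phi>\<^sub>0<..}} = UNIV" using pos by auto
  ultimately show ?thesis by simp
qed

section \<open>Growth of the entire function and its evaluation\<close>

lemma E_right:
  assumes "Re z > \<Phi>"
  shows "E z = (z - \<Phi>) * (A z / (A z - 1) - Lm z)"
proof -
  have "z \<noteq> \<Phi>" using assms by auto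
  then show ?thesis using assms by (simp add: E_def R_def A_Phi right_diff_distrib left_diff_distrib mult.commute)
qed

text \<open>To the right of \<open>\<Phi>\<close>, with \<open>a = p / \<psi> (Re z)\<close>, the
  quotient \<open>A / (A - 1)\<close> has norm at most
  \<open>a / (1 - a) = p / (\<psi> (Re z) - p)\<close>, which the chord inequality bounds by
  \<open>\<Phi> / (Re z - \<Phi>)\<close>; \<open>Lm\<close> adds at most one. This matches the
  bound for \<open>Lp\<close> on the left.\<close>

lemma norm_E_le:
  assumes "Re z \<noteq> \<Phi>"
  shows "norm (E z) \<le> norm (z - \<Phi>) * (1 + \<Phi> / \<bar>Re z - \<Phi>\<bar>)"
proof (cases "Re z < \<Phi>")
  case True
  then show ?thesis using norm_Lp_le[OF True] by (auto simp: E_def norm_mult intro!: mult_left_mono)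
next
  case False
  with assms have z: "Re z > \<Phi>" by simp
  let ?x = "Re z"
  have "0 < p * (?x - \<Phi>) / \<Phi>" using z pos by simp
  also have "\<dots> \<le> \<psi> ?x - p" using z by (rule psi_minus_p)
  finally have psi: "\<psi> ?x > p" by simp
  have a: "norm (A z) \<le> p / \<psi> ?x" using z pos by (intro norm_A_le) auto
  have "p / \<psi> ?x < 1" using psi pos by simp
  have "norm (A z / (A z - 1)) \<le> (p / \<psi> ?x) / (1 - p / \<psi> ?x)"
    unfolding norm_divide
  proof (rule frac_le)
    show "1 - p / \<psi> ?x \<le> norm (A z - 1)"
      using a norm_triangle_ineq2[of 1 "A z"] by (simp add: norm_minus_commute)
  qed (use a \<open>p / \<psi> ?x < 1\<close> psi pos in auto)
  also have "\<dots> = p / (\<psi> ?x - p)" using psi pos by (simp add: field_simps)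
  also have "\<dots> \<le> p / (p * (?x - \<Phi>) / \<Phi>)"
    using z pos psi by (intro divide_left_mono psi_minus_p) auto
  also have "\<dots> = \<Phi> / \<bar>?x - \<Phi>\<bar>" using z pos by simp
  finally have "norm (A z / (A z - 1) - Lm z) \<le> \<Phi> / \<bar>?x - \<Phi>\<bar> + 1"
    using norm_Lm_le[of z] z Phi_pos by (intro order_trans[OF norm_triangle_ineq4] add_mono) auto
  then show ?thesis unfolding E_right[OF z] norm_mult
    by (intro mult_left_mono) auto
qed

text \<open>\<open>Np\<close> charges only the open half line, where the exponentials decay. This
  limit removes the linear term of the affine function \<open>E\<close>.\<close>

lemma Lp_tendsto_0: "(\<lambda>n. Lp (complex_of_real (\<Phi> - real (Suc n)))) \<longlonglongrightarrow> 0"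
proof -
  have "(\<lambda>n. \<integral>x. exp ((\<Phi> - real (Suc n)) * x) \<partial>Np) \<longlonglongrightarrow> (\<integral>x. 0 \<partial>Np)"
  proof (rule integral_dominated_convergence[where w = "\<lambda>x. exp ((\<Phi> - 1) * x)"])
    have AE_pos: "AE x in Np. x > 0"
      unfolding Np_def by (subst AE_density) (auto simp: indicator_def)
    show "AE x in Np. (\<lambda>n. exp ((\<Phi> - real (Suc n)) * x)) \<longlonglongrightarrow> 0"
      using AE_pos
    proof eventually_elim
      case (elim x)
      then show ?case by real_asymp
    qed
    show "AE x in Np. norm (exp ((\<Phi> - real (Suc n)) * x)) \<le> exp ((\<Phi> - 1) * x)" for n
      using AE_pos by eventually_elim (auto intro!: mult_right_mono)
    show "integrable Np (\<lambda>x. exp ((\<Phi> - 1) * x))" by (rule int_Np) simp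
  qed auto
  then show ?thesis unfolding Lp_def mgf_of_real using tendsto_of_real by fastforce
qed

lemma E_const: "E z = - complex_of_real (p / deriv \<psi> \<Phi>)"
proof -
  have "(\<lambda>z. E (z + \<Phi>)) holomorphic_on UNIV"
    using holomorphic_on_compose_gen[OF _ E_holomorphic, of "\<lambda>z. z + complex_of_real \<Phi>" UNIV]
    by (simp add: o_def holomorphic_on_add)
  moreover have "norm (E (z + \<Phi>)) \<le> norm z * (1 + \<Phi> / \<bar>Re z\<bar>)" if "Re z \<noteq> 0" for z
    using norm_E_le[of "z + \<Phi>"] that by simp
  ultimately obtain a b where ab: "\<And>z. E (z + complex_of_real \<Phi>) = a + b * z"
    using entire_affine[of "\<lambda>z. E (z + \<Phi>)" \<Phi>] Phi_pos by (metis less_imp_le)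
  \<comment> \<open>At distance \<open>Suc n\<close> to the left of \<open>\<Phi>\<close>, dividing
    the affine formula by \<open>- Suc n\<close> leaves the slope \<open>b\<close> plus a vanishing
    term, so \<open>b\<close> is the limit of \<open>Lp\<close>.\<close>
  have "Lp (complex_of_real (\<Phi> - real (Suc n))) = b - a / of_nat (Suc n)" for n
  proof -
    have "E (- of_nat (Suc n) + complex_of_real \<Phi>) = - of_nat (Suc n) * Lp (complex_of_real (\<Phi> - real (Suc n)))"
      by (simp add: E_def del: of_nat_Suc)
    then have "a + b * - of_nat (Suc n) = - of_nat (Suc n) * Lp (complex_of_real (\<Phi> - real (Suc n)))"
      unfolding ab .
    then show ?thesis by (simp add: field_simps del: of_nat_Suc)
  qed
  then have "(\<lambda>n. b - a / of_nat (Suc n)) \<longlonglongrightarrow> 0" using Lp_tendsto_0 by simp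
  moreover have "(\<lambda>n. b - a / of_nat (Suc n)) \<longlonglongrightarrow> b - 0"
    by (intro tendsto_diff tendsto_const LIMSEQ_Suc[OF lim_const_over_n])
  ultimately have "b = 0" using LIMSEQ_unique by fastforce
  then have "E z = E \<Phi>" for z using ab[of "z - \<Phi>"] ab[of 0] by simp
  \<comment> \<open>At \<open>\<Phi>\<close> the second branch applies, the term with
    \<open>Lm\<close> vanishes, and the value is \<open>1 / deriv A \<Phi>\<close>.\<close>
  moreover have "E \<Phi> = - complex_of_real (p / deriv \<psi> \<Phi>)"
    by (simp add: E_def R_def A_Phi psi_deriv(3))
  ultimately show ?thesis by simp
qed

text \<open>The left branch of the constant \<open>E\<close>, solved for the transform: it is that
  of a multiple of the exponential law of rate \<open>\<Phi>\<close>.\<close>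

lemma integral_positive:
  assumes "t < \<Phi>"
  shows "(\<integral>x. exp (t * x) \<partial>Np) = p / (deriv \<psi> \<Phi> * (\<Phi> - t))"
proof -
  have "complex_of_real ((t - \<Phi>) * (\<integral>x. exp (t * x) \<partial>Np)) = complex_of_real (- (p / deriv \<psi> \<Phi>))"
    using E_const[of t] assms unfolding E_def Lp_def mgf_of_real by simp
  then have "(t - \<Phi>) * (\<integral>x. exp (t * x) \<partial>Np) = - (p / deriv \<psi> \<Phi>)" unfolding of_real_eq_iff .
  then show ?thesis using assms deriv_psi_pos by (simp add: field_simps)
qed

text \<open>The right branch of the constant \<open>E\<close>. The first term is the transform of
  the exponential density of \<open>integral_positive\<close> continued to the negative half line;
  the second will be recognised as that of the reflected \<open>p\<close>-scale function times
  \<open>p\<close>.\<close>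

lemma integral_negative:
  assumes "\<Phi> < t"
  shows "(\<integral>x. exp (t * x) \<partial>Nm) = p / (deriv \<psi> \<Phi> * (t - \<Phi>)) - p / (\<psi> t - p)"
proof -
  let ?L = "\<integral>x. exp (t * x) \<partial>Nm" and ?a = "p / \<psi> t"
  have "0 < p * (t - \<Phi>) / \<Phi>" using assms pos by simp
  also have "\<dots> \<le> \<psi> t - p" using assms by (rule psi_minus_p)
  finally have psi: "\<psi> t > p" by simp
  have "complex_of_real ((t - \<Phi>) * (?a / (?a - 1) - ?L)) = complex_of_real (- (p / deriv \<psi> \<Phi>))"
    using E_const[of t] E_right[of t] assms pos A_of_real[of t] unfolding Lm_def mgf_of_real by simp
  then have "(t - \<Phi>) * (?a / (?a - 1) - ?L) = - (p / deriv \<psi> \<Phi>)" unfolding of_real_eq_iff .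
  then have "?a / (?a - 1) - ?L = - (p / (deriv \<psi> \<Phi> * (t - \<Phi>)))"
    using assms deriv_psi_pos by (simp add: field_simps)
  moreover have "?a / (?a - 1) = - (p / (\<psi> t - p))" using psi pos by (simp add: field_simps)
  ultimately show ?thesis by simp
qed

end

section \<open>The Laplace exponent and the scale functions\<close>

lemma not_AE_lborel_nonpos: "\<not> (AE x in lborel. (x::real) \<le> 0)"
proof
  assume "AE x in lborel. (x::real) \<le> 0"
  then have "AE x in lborel. (x::real) \<notin> {0<..<1}" by eventually_elim auto
  then have "{0<..<1::real} \<in> null_sets lborel" by (subst AE_iff_null_sets) auto
  then show False by (simp add: null_sets_def)
qed

lemma exp_mult_le:
  fixes t u y :: real
  assumes "0 \<le> t" "t \<le> u"
  shows "exp (t * y) \<le> 1 + exp (u * y)"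
proof (cases "y \<le> 0")
  case True
  then have "exp (t * y) \<le> 1" using assms by (simp add: mult_nonneg_nonpos)
  then show ?thesis by (rule order_trans) simp
next
  case False
  then have "exp (t * y) \<le> exp (u * y)" using assms by (auto intro!: mult_right_mono)
  then show ?thesis by (rule order_trans) simp
qed

text \<open>Everything about the exponent and its right-inverse is derived from the variable
  \<open>Y\<^sub>1\<close> and the scale functions; the path of the process enters only in
  \<open>levy_scale\<close>.\<close>

locale scale_functions = prob_space M for M :: "'a measure" +
  fixes Y\<^sub>1 :: "'a \<Rightarrow> real" and \<psi> :: "real \<Rightarrow> real" and W :: "real \<Rightarrow> real \<Rightarrow> real"
  assumes Y1 [measurable]: "Y\<^sub>1 \<in> borel_measurable M"
    and psi: "\<And>t. \<psi> t = ln (\<integral>\<omega>. exp (t * Y\<^sub>1 \<omega>) \<partial>M)"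
    and scale: "\<And>p. p \<ge> 0 \<Longrightarrow> is_scale_function \<psi> p (W p)"
begin

abbreviation "\<Phi> \<equiv> right_inverse \<psi>"

lemma W_nonneg: "p \<ge> 0 \<Longrightarrow> 0 \<le> W p x"
  and W_neg: "p \<ge> 0 \<Longrightarrow> x < 0 \<Longrightarrow> W p x = 0"
  using scale[of p] unfolding is_scale_function_def by auto

lemma W_pos: "p \<ge> 0 \<Longrightarrow> 0 < x \<Longrightarrow> 0 < W p x"
  using scale[of p] W_nonneg[of p 0] unfolding is_scale_function_def
  by (smt (verit) atLeast_iff strict_mono_onD)

lemma W_measurable [measurable]: assumes "p \<ge> 0" shows "W p \<in> borel_measurable borel"
proof -
  have "(\<lambda>x. indicator {0..} x *\<^sub>R W p x) \<in> borel_measurable borel"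
    using scale[OF assms] unfolding is_scale_function_def
    by (intro borel_measurable_continuous_on_indicator) auto
  moreover have "(\<lambda>x. indicator {0..} x *\<^sub>R W p x) = W p"
    using W_neg[OF assms] by (auto simp: indicator_def fun_eq_iff)
  ultimately show ?thesis by simp
qed

lemma W_laplace:
  assumes "p \<ge> 0" "t > \<Phi> p"
  shows "integrable lborel (\<lambda>x. exp (- t * x) * W p x)"
    and "(\<integral>x. exp (- t * x) * W p x \<partial>lborel) = 1 / (\<psi> t - p)"
proof -
  have *: "(\<lambda>x. indicator {0..} x *\<^sub>R (exp (- t * x) * W p x)) = (\<lambda>x. exp (- t * x) * W p x)"
    using W_neg[OF assms(1)] by (auto simp: indicator_def fun_eq_iff)
  show "integrable lborel (\<lambda>x. exp (- t * x) * W p x)" "(\<integral>x. exp (- t * x) * W p x \<partial>lborel) = 1 / (\<psi> t - p)"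
    using scale[OF assms(1)] assms(2) *
    unfolding is_scale_function_def set_integrable_def set_lebesgue_integral_def by auto
qed

text \<open>The transform of \<open>W p\<close> is strictly positive, because \<open>W p\<close> is
  positive on the open half line; so its value \<open>1 / (\<psi> t - p)\<close> is positive. This
  also excludes \<open>\<psi> t = p\<close>, where the quotient would be zero by convention.\<close>

lemma psi_gt:
  assumes "p \<ge> 0" "t > \<Phi> p"
  shows "\<psi> t > p"
proof -
  have "(\<integral>x. exp (- t * x) * W p x \<partial>lborel) \<noteq> 0"
  proof
    assume "(\<integral>x. exp (- t * x) * W p x \<partial>lborel) = 0"
    then have "AE x in lborel. exp (- t * x) * W p x = 0"
      using W_laplace(1)[OF assms] W_nonneg[OF assms(1)]
      by (subst (asm) integral_nonneg_eq_0_iff_AE) auto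
    then have "AE x in lborel. x \<le> (0::real)"
    proof eventually_elim
      case (elim x)
      then have "W p x = 0" by simp
      then show ?case using W_pos[OF assms(1), of x] by (cases "x \<le> 0") auto
    qed
    then show False using not_AE_lborel_nonpos by simp
  qed
  moreover have "(\<integral>x. exp (- t * x) * W p x \<partial>lborel) \<ge> 0"
    using W_nonneg[OF assms(1)] by (intro integral_nonneg_AE) auto
  ultimately have "1 / (\<psi> t - p) > 0" unfolding W_laplace(2)[OF assms] by linarith
  then show ?thesis by simp
qed

text \<open>Without integrability at \<open>u\<close>, \<open>\<psi> u\<close> would be the junk value \<open>ln 0 = 0\<close>, against \<open>psi_gt\<close>.\<close>

lemma exp_integrable:
  assumes "t \<ge> 0"
  shows "integrable M (\<lambda>\<omega>. exp (t * Y\<^sub>1 \<omega>))"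
proof -
  define u where "u = max t (\<Phi> 0) + 1"
  have "\<psi> u > 0" by (rule psi_gt) (auto simp: u_def)
  then have "integrable M (\<lambda>\<omega>. exp (u * Y\<^sub>1 \<omega>))"
    unfolding psi using not_integrable_integral_eq[of M "\<lambda>\<omega>. exp (u * Y\<^sub>1 \<omega>)"] by fastforce
  then have int: "integrable M (\<lambda>\<omega>. 1 + exp (u * Y\<^sub>1 \<omega>))" by auto
  show ?thesis
  proof (rule Bochner_Integration.integrable_bound[OF int])
    show "AE \<omega> in M. norm (exp (t * Y\<^sub>1 \<omega>)) \<le> norm (1 + exp (u * Y\<^sub>1 \<omega>))"
      using exp_mult_le[of t u] assms by (intro AE_I2) (auto simp: u_def abs_of_pos add_pos_pos)
  qed auto
qed

lemma exp_psi:
  assumes "t \<ge> 0"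
  shows "exp (\<psi> t) = (\<integral>\<omega>. exp (t * Y\<^sub>1 \<omega>) \<partial>M)"
proof -
  have "(\<integral>\<omega>. exp (t * Y\<^sub>1 \<omega>) \<partial>M) \<noteq> 0"
  proof
    assume "(\<integral>\<omega>. exp (t * Y\<^sub>1 \<omega>) \<partial>M) = 0"
    then have "AE \<omega> in M. exp (t * Y\<^sub>1 \<omega>) = 0"
      using exp_integrable[OF assms] by (subst (asm) integral_nonneg_eq_0_iff_AE) auto
    then show False by simp
  qed
  moreover have "(\<integral>\<omega>. exp (t * Y\<^sub>1 \<omega>) \<partial>M) \<ge> 0" by simp
  ultimately have "(\<integral>\<omega>. exp (t * Y\<^sub>1 \<omega>) \<partial>M) > 0" by linarith
  then show ?thesis unfolding psi by simp
qed

section \<open>Convexity and continuity of the exponent, and its right-inverse\<close>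

lemma psi_0: "\<psi> 0 = 0"
  using psi[of 0] prob_space by simp

text \<open>Convexity along rays from the origin. Convexity of \<open>exp\<close> is applied
  pointwise to \<open>t * y - \<psi> t\<close>, whose exponential has mean one under the law of
  \<open>Y\<^sub>1\<close>; taking expectations bounds the mean of the exponential of
  \<open>s\<close> times it by one.\<close>

lemma psi_star:
  assumes "t \<ge> 0" "0 \<le> s" "s \<le> 1"
  shows "\<psi> (s * t) \<le> s * \<psi> t"
proof -
  have "exp (s * a) \<le> (1 - s) + s * exp a" for a :: real
    using convex_onD[OF exp_convex, of s 0 a] assms by simp
  note this[of "t * y - \<psi> t" for y]
  moreover have "exp (s * (t * y - \<psi> t)) = exp (s * t * y) * exp (- s * \<psi> t)" for y
    unfolding exp_add[symmetric] by (simp add: algebra_simps)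
  moreover have "exp (t * y - \<psi> t) = exp (t * y) * exp (- \<psi> t)" for y
    unfolding exp_add[symmetric] by simp
  ultimately have "exp (s * t * y) * exp (- s * \<psi> t) \<le> (1 - s) + s * (exp (t * y) * exp (- \<psi> t))" for y
    by simp
  then have "(\<integral>\<omega>. exp (s * t * Y\<^sub>1 \<omega>) * exp (- s * \<psi> t) \<partial>M)
      \<le> (\<integral>\<omega>. (1 - s) + s * (exp (t * Y\<^sub>1 \<omega>) * exp (- \<psi> t)) \<partial>M)"
    using exp_integrable[of "s * t"] exp_integrable[of t] assms
    by (intro integral_mono) auto
  also have "\<dots> = (1 - s) + s * (exp (\<psi> t) * exp (- \<psi> t))"
    using exp_integrable[of t] assms by (simp add: prob_space exp_psi)
  also have "\<dots> = 1" by (simp flip: exp_add)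
  finally have "exp (\<psi> (s * t)) * exp (- s * \<psi> t) \<le> 1"
    using assms by (simp add: exp_psi)
  then have "exp (\<psi> (s * t) + - s * \<psi> t) \<le> 1" unfolding exp_add .
  then show ?thesis by simp
qed

lemma psi_continuous: "continuous_on {0..} \<psi>"
proof -
  have "continuous_on {0..} (\<lambda>t. \<integral>\<omega>. exp (t * Y\<^sub>1 \<omega>) \<partial>M)"
    unfolding continuous_on_sequentially o_def
  proof (intro allI ballI impI, elim conjE)
    fix X :: "nat \<Rightarrow> real" and t :: real assume X: "\<forall>n. X n \<in> {0..}" "X \<longlonglongrightarrow> t"
    obtain K where K: "\<And>n. norm (X n) \<le> K"
      using convergent_imp_bounded[OF X(2)] by (auto simp: bounded_iff)
    then have "K \<ge> 0" using norm_ge_zero order_trans by blast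
    show "(\<lambda>n. \<integral>\<omega>. exp (X n * Y\<^sub>1 \<omega>) \<partial>M) \<longlonglongrightarrow> (\<integral>\<omega>. exp (t * Y\<^sub>1 \<omega>) \<partial>M)"
    proof (rule integral_dominated_convergence[where w = "\<lambda>\<omega>. 1 + exp (K * Y\<^sub>1 \<omega>)"])
      show "AE \<omega> in M. (\<lambda>n. exp (X n * Y\<^sub>1 \<omega>)) \<longlonglongrightarrow> exp (t * Y\<^sub>1 \<omega>)"
        by (intro AE_I2 tendsto_intros X)
      show "integrable M (\<lambda>\<omega>. 1 + exp (K * Y\<^sub>1 \<omega>))" using exp_integrable[OF \<open>K \<ge> 0\<close>] by auto
      show "AE \<omega> in M. norm (exp (X n * Y\<^sub>1 \<omega>)) \<le> 1 + exp (K * Y\<^sub>1 \<omega>)" for n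
        using exp_mult_le[of "X n" K] K[of n] X(1) by auto
    qed auto
  qed
  then have "continuous_on {0..} (\<lambda>t. ln (\<integral>\<omega>. exp (t * Y\<^sub>1 \<omega>) \<partial>M))"
    by (intro continuous_on_ln) (auto simp flip: exp_psi)
  then show ?thesis unfolding psi[abs_def] .
qed

text \<open>The supremum is attained: the set of roots is nonempty by the intermediate value theorem
  and closed by continuity. It is bounded by the number \<open>\<Phi> p\<close> itself, since
  \<open>psi_gt\<close> excludes roots beyond that number whatever its origin.\<close>

lemma Phi_mem:
  assumes "p \<ge> 0"
  shows "\<Phi> p \<ge> 0" "\<psi> (\<Phi> p) = p"
proof -
  let ?S = "{s. 0 \<le> s \<and> \<psi> s = p}"
  define u where "u = max 0 (\<Phi> p) + 1"
  have u: "\<psi> u > p" by (rule psi_gt[OF assms]) (simp add: u_def)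
  have "\<exists>s\<ge>0. s \<le> u \<and> \<psi> s = p"
    using u assms psi_0 by (intro IVT') (auto simp: u_def intro: continuous_on_subset[OF psi_continuous])
  then have ne: "?S \<noteq> {}" by auto
  have bdd: "bdd_above ?S"
    by (rule bdd_aboveI[of _ "\<Phi> p"]) (use psi_gt[OF assms] in force)
  have "closed ({0..} \<inter> \<psi> -` {p})"
    by (intro continuous_closed_preimage psi_continuous) auto
  moreover have "{0..} \<inter> \<psi> -` {p} = ?S" by auto
  ultimately have "Sup ?S \<in> ?S" using ne bdd by (intro closed_contains_Sup) auto
  then show "\<Phi> p \<ge> 0" "\<psi> (\<Phi> p) = p" unfolding right_inverse_def by auto
qed

lemma Phi_pos: "p > 0 \<Longrightarrow> \<Phi> p > 0"
  using Phi_mem[of p] psi_0 by (metis less_eq_real_def less_irrefl)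

text \<open>This and \<open>psi_ge\<close> are the chord inequalities, from \<open>psi_star\<close>
  with the ratio \<open>t / \<Phi> p\<close> below \<open>\<Phi> p\<close> and the inverse ratio
  above it.\<close>

lemma psi_le: assumes "p > 0" "0 < t" "t \<le> \<Phi> p" shows "\<psi> t \<le> p * t / \<Phi> p"
  using psi_star[of "\<Phi> p" "t / \<Phi> p"] Phi_mem[of p] Phi_pos[of p] assms by (simp add: mult.commute)

lemma psi_ge: assumes "p > 0" "\<Phi> p \<le> t" shows "p * t / \<Phi> p \<le> \<psi> t"
proof -
  have t: "t > 0" using Phi_pos[OF assms(1)] assms(2) by simp
  have "p \<le> \<Phi> p / t * \<psi> t"
    using psi_star[of t "\<Phi> p / t"] Phi_mem[of p] t assms by simp
  then show ?thesis using t Phi_pos[OF assms(1)] by (simp add: field_simps)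
qed

lemma Phi_less:
  assumes "0 \<le> r" "r < p"
  shows "\<Phi> r < \<Phi> p"
proof (rule ccontr)
  assume "\<not> \<Phi> r < \<Phi> p"
  then have le: "\<Phi> p \<le> \<Phi> r" by simp
  have p: "p > 0" using assms by simp
  have "p \<le> p * \<Phi> r / \<Phi> p" using le Phi_pos[OF p] p by (simp add: field_simps)
  also have "\<dots> \<le> \<psi> (\<Phi> r)" using p le by (rule psi_ge)
  also have "\<dots> = r" using assms by (simp add: Phi_mem)
  finally show False using assms by simp
qed

lemma Phi_at_top: "filterlim \<Phi> at_top at_top"
  unfolding filterlim_at_top
proof
  fix K :: real
  define K' where "K' = max K 1"
  show "\<forall>\<^sub>F p in at_top. K \<le> \<Phi> p"
    using eventually_gt_at_top[of "max 0 (\<psi> K')"]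
  proof eventually_elim
    case (elim p)
    show ?case
    proof (rule ccontr)
      assume "\<not> K \<le> \<Phi> p"
      then have lt: "\<Phi> p < K'" by (simp add: K'_def)
      have "p \<le> p * K' / \<Phi> p" using lt Phi_pos[of p] elim by (simp add: field_simps)
      also have "\<dots> \<le> \<psi> K'" using elim lt by (intro psi_ge) auto
      finally show False using elim by simp
    qed
  qed
qed

text \<open>Reflected to the negative half line, so that its transform in \<open>exp (t * x)\<close>
  converges for \<open>t\<close> beyond \<open>\<Phi> p\<close>, with the sign convention used for
  the law of \<open>Y\<close>.\<close>

definition "Wm p = density lborel (\<lambda>x. ennreal (W p (- x)))"

lemma sets_Wm [simp, measurable_cong]: "sets (Wm p) = sets borel"
  by (simp add: Wm_def)

lemma
  assumes "p \<ge> 0" "t > \<Phi> p"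
  shows Wm_integrable: "integrable (Wm p) (\<lambda>x. exp (t * x))"
    and Wm_integral: "(\<integral>x. exp (t * x) \<partial>Wm p) = 1 / (\<psi> t - p)"
proof -
  note [measurable] = W_measurable[OF assms(1)]
  have nn: "AE x in lborel. 0 \<le> W p (- x)" using W_nonneg[OF assms(1)] by simp
  have int: "integrable lborel (\<lambda>x. W p (- x) *\<^sub>R exp (t * x))"
    using lborel_integrable_real_affine[OF W_laplace(1)[OF assms], of "- 1" 0] by (simp add: mult.commute)
  then show "integrable (Wm p) (\<lambda>x. exp (t * x))"
    unfolding Wm_def using nn by (subst integrable_density) auto
  have "(\<integral>x. exp (t * x) \<partial>Wm p) = (\<integral>x. W p (- x) *\<^sub>R exp (t * x) \<partial>lborel)"
    unfolding Wm_def using nn by (subst integral_density) auto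
  also have "\<dots> = (\<integral>x. exp (- t * x) * W p x \<partial>lborel)"
    by (subst (2) lborel_integral_real_affine[of "- 1" _ 0]) (auto simp: mult.commute)
  finally show "(\<integral>x. exp (t * x) \<partial>Wm p) = 1 / (\<psi> t - p)" using W_laplace(2)[OF assms] by simp
qed

text \<open>Equality would give the integral of
  \<open>exp (\<Phi> p * x) * (1 - cos (s * x))\<close> against \<open>Wm 0\<close> the value zero.
  But \<open>W 0\<close> is positive on the open half line, and the cosine is below one for nonzero
  \<open>x\<close> of modulus less than \<open>pi / \<bar>s\<bar>\<close>.\<close>

lemma Wm_nonlattice:
  assumes "p > 0" "s \<noteq> 0"
  shows "(\<integral>x. exp ((complex_of_real (\<Phi> p) + \<i> * complex_of_real s) * complex_of_real x) \<partial>Wm 0) \<noteq> 1 / p"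
proof
  note [measurable] = W_measurable[of 0, simplified]
  let ?t = "\<Phi> p" and ?z = "complex_of_real (\<Phi> p) + \<i> * complex_of_real s"
  have t: "?t > \<Phi> 0" using Phi_less[of 0 p] assms by simp
  assume eq: "(\<integral>x. exp (?z * complex_of_real x) \<partial>Wm 0) = 1 / p"
  have int: "integrable (Wm 0) (\<lambda>x. exp (?z * complex_of_real x))"
    by (rule mgf_integrable_complex) (use Wm_integrable[OF _ t] in auto)
  have Re_eq: "Re (exp (?z * complex_of_real x)) = exp (?t * x) * cos (s * x)" for x
    by (simp add: Re_exp)
  have i1: "integrable (Wm 0) (\<lambda>x. exp (?t * x) * cos (s * x))"
    using integrable_Re[OF int] unfolding Re_eq .
  have "(\<integral>x. exp (?t * x) * cos (s * x) \<partial>Wm 0) = 1 / p"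
    using integral_Re[OF int] eq unfolding Re_eq by simp
  moreover have "(\<integral>x. exp (?t * x) \<partial>Wm 0) = 1 / p"
    using Wm_integral[OF _ t] Phi_mem[of p] assms by simp
  ultimately have "(\<integral>x. exp (?t * x) - exp (?t * x) * cos (s * x) \<partial>Wm 0) = 0"
    using i1 Wm_integrable[OF _ t] by simp
  moreover have "exp (?t * x) - exp (?t * x) * cos (s * x) = exp (?t * x) * (1 - cos (s * x))" for x
    by (simp add: algebra_simps)
  ultimately have "AE x in Wm 0. exp (?t * x) * (1 - cos (s * x)) = 0"
    using Bochner_Integration.integrable_diff[OF Wm_integrable[OF _ t] i1]
    by (subst (asm) integral_nonneg_eq_0_iff_AE) auto
  then have "AE x in lborel. 0 < W 0 (- x) \<longrightarrow> cos (s * x) = 1"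
    unfolding Wm_def by (subst (asm) AE_density) auto
  then have "AE x in lborel. x \<notin> {- (pi / \<bar>s\<bar>)<..<0}"
  proof eventually_elim
    case (elim x)
    show ?case
    proof
      assume x: "x \<in> {- (pi / \<bar>s\<bar>)<..<0}"
      then have "cos (s * x) = 1" using elim W_pos[of 0 "- x"] by auto
      then have c: "cos \<bar>s * x\<bar> = 1" by simp
      have "\<bar>s * x\<bar> = \<bar>s\<bar> * - x" using x by (simp add: abs_mult)
      moreover have "- x > 0" "- x < pi / \<bar>s\<bar>" using x by auto
      ultimately have "\<bar>s * x\<bar> < pi"
        using assms(2) by (simp add: pos_less_divide_eq mult.commute)
      moreover have "\<bar>s * x\<bar> > 0" using x assms(2) by auto
      ultimately show False using c cos_monotone_0_pi[of 0 "\<bar>s * x\<bar>"] by simp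
    qed
  qed
  then have "{- (pi / \<bar>s\<bar>)<..<0} \<in> null_sets lborel" by (subst AE_iff_null_sets) auto
  then show False using assms by (simp add: null_sets_def)
qed

end

section \<open>A Levy process at an independent exponential time\<close>

lemma nn_integral_exp_Ici:
  assumes "0 < l"
  shows "(\<integral>\<^sup>+x. ennreal (indicator {0..} x * exp (- l * x)) \<partial>lborel) = ennreal (1 / l)"
proof -
  interpret E: prob_space "density lborel (exponential_density l)"
    by (rule prob_space_exponential_density[OF assms])
  have "ennreal l * (\<integral>\<^sup>+x. ennreal (indicator {0..} x * exp (- l * x)) \<partial>lborel)
      = (\<integral>\<^sup>+x. ennreal (exponential_density l x) \<partial>lborel)"
    using assms by (subst nn_integral_cmult[symmetric])
      (auto intro!: nn_integral_cong simp: exponential_density_def mult.commute simp flip: ennreal_mult' split: split_indicator)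
  also have "\<dots> = 1"
    using E.emeasure_space_1 by (subst (asm) emeasure_density) auto
  finally have "ennreal (1 / l) * (ennreal l * (\<integral>\<^sup>+x. ennreal (indicator {0..} x * exp (- l * x)) \<partial>lborel)) = ennreal (1 / l)"
    by simp
  then show ?thesis using assms by (simp add: mult.assoc[symmetric] flip: ennreal_mult')
qed

lemma nn_integral_add_measure:
  assumes sets: "sets N = sets M" and f: "f \<in> borel_measurable M"
  shows "(\<integral>\<^sup>+x. f x \<partial>add_measure M N) = (\<integral>\<^sup>+x. f x \<partial>M) + (\<integral>\<^sup>+x. f x \<partial>N)"
proof -
  note [measurable_cong] = sets
  from f show ?thesis
  proof induct
    case (cong f g)
    then show ?case using sets_eq_imp_space_eq[OF sets]
      by (simp cong: nn_integral_cong_simp)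
  next
    case (set A)
    then show ?case using emeasure_add_measure[OF sets] sets by simp
  next
    case (mult u c)
    then show ?case by (simp add: nn_integral_cmult distrib_left)
  next
    case (add u v)
    then show ?case by (simp add: nn_integral_add ac_simps)
  next
    case (seq U)
    note [measurable] = seq(1)
    have inc: "incseq (\<lambda>i. \<integral>\<^sup>+x. U i x \<partial>L)" for L
      using seq(4) by (auto simp: mono_def le_fun_def intro!: nn_integral_mono)
    have "(\<integral>\<^sup>+x. (SUP i. U i x) \<partial>L) = (SUP i. \<integral>\<^sup>+x. U i x \<partial>L)" if "sets L = sets M" for L
    proof -
      note [measurable_cong] = that
      show ?thesis using seq(4) by (intro nn_integral_monotone_convergence_SUP) auto
    qed
    then show ?case
      using sets seq(3) by (simp add: SUP_apply image_image ennreal_SUP_add[OF inc inc])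
  qed
qed

lemma AE_pair_fst:
  assumes "sigma_finite_measure B" and "AE x in A. P x"
  shows "AE z in A \<Otimes>\<^sub>M B. P (fst z)"
proof -
  interpret B: sigma_finite_measure B by fact
  obtain N where N: "{x \<in> space A. \<not> P x} \<subseteq> N" "N \<in> sets A" "emeasure A N = 0"
    using assms(2) by (rule AE_E)
  then have "emeasure (A \<Otimes>\<^sub>M B) (N \<times> space B) = 0" by (simp add: B.emeasure_pair_measure_Times)
  then show ?thesis using N by (intro AE_I[of _ _ "N \<times> space B"]) (auto simp: space_pair_measure)
qed

lemma AE_pair_snd:
  assumes "sigma_finite_measure B" and "AE x in B. P x"
  shows "AE z in A \<Otimes>\<^sub>M B. P (snd z)"
proof -
  interpret B: sigma_finite_measure B by fact
  obtain N where N: "{x \<in> space B. \<not> P x} \<subseteq> N" "N \<in> sets B" "emeasure B N = 0"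
    using assms(2) by (rule AE_E)
  then have "emeasure (A \<Otimes>\<^sub>M B) (space A \<times> N) = 0" by (simp add: B.emeasure_pair_measure_Times)
  then show ?thesis using N by (intro AE_I[of _ _ "space A \<times> N"]) (auto simp: space_pair_measure)
qed

text \<open>The paths of \<open>Y\<close> are only almost surely right-continuous, so \<open>Y\<close> need not be jointly measurable;
  the limit along these grid points, which approach \<open>t\<close> strictly from the right, is.\<close>

definition "right_grid n t = (real (nat \<lfloor>real (Suc n) * t\<rfloor>) + 1) / real (Suc n)"

lemma right_grid:
  assumes "t \<ge> 0"
  shows "t < right_grid n t" "right_grid n t \<le> t + 1 / real (Suc n)"
proof -
  let ?k = "real (nat \<lfloor>real (Suc n) * t\<rfloor>)"
  have k: "?k \<le> real (Suc n) * t" "real (Suc n) * t < ?k + 1"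
    using assms by (auto simp del: of_nat_Suc)
  from k(1) have "?k / real (Suc n) \<le> t" by (subst pos_divide_le_eq) (auto simp: mult.commute)
  then show "right_grid n t \<le> t + 1 / real (Suc n)"
    by (simp add: right_grid_def add_divide_distrib del: of_nat_Suc)
  from k(2) show "t < right_grid n t"
    unfolding right_grid_def by (subst pos_less_divide_eq) (auto simp: mult.commute)
qed

lemma right_grid_tendsto:
  assumes "t \<ge> 0"
  shows "filterlim (\<lambda>n. right_grid n t) (at_right t) sequentially"
proof -
  have "(\<lambda>n. right_grid n t) \<longlonglongrightarrow> t"
  proof (rule real_tendsto_sandwich)
    show "(\<lambda>n. t) \<longlonglongrightarrow> t" by simp
    show "(\<lambda>n. t + 1 / real (Suc n)) \<longlonglongrightarrow> t" by real_asymp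
  qed (use right_grid[OF assms] in \<open>auto intro!: always_eventually less_imp_le\<close>)
  moreover have "right_grid n t \<in> {t<..} \<and> right_grid n t \<noteq> t" for n
    using right_grid(1)[OF assms, of n] by simp
  ultimately show ?thesis unfolding filterlim_at by simp
qed

locale levy_scale = scale_functions M "Y 1" \<psi> W
  for M :: "'a measure" and Y :: "real \<Rightarrow> 'a \<Rightarrow> real" and \<psi> W +
  assumes levy: "levy_process M Y"
begin

section \<open>Exponential moments at all times\<close>

lemma Y_measurable [measurable]: "t \<ge> 0 \<Longrightarrow> Y t \<in> borel_measurable M"
  and Y_0: "AE \<omega> in M. Y 0 \<omega> = 0"
  and Y_right: "AE \<omega> in M. \<forall>t\<ge>0. ((\<lambda>s. Y s \<omega>) \<longlongrightarrow> Y t \<omega>) (at_right t)"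
  using levy unfolding levy_process_def by auto

lemma Y_grid: "AE \<omega> in M. \<forall>t\<ge>0. (\<lambda>n. Y (right_grid n t) \<omega>) \<longlonglongrightarrow> Y t \<omega>"
  using Y_right
proof eventually_elim
  case (elim \<omega>)
  then show ?case by (intro allI impI filterlim_compose[OF _ right_grid_tendsto]) auto
qed

text \<open>A nonnegative integral, so that multiplicativity in time can be proved before finiteness
  is known.\<close>

definition "exp_moment t s = (\<integral>\<^sup>+\<omega>. ennreal (exp (t * Y s \<omega>)) \<partial>M)"

lemma exp_moment_0: "exp_moment t 0 = 1"
proof -
  have "exp_moment t 0 = (\<integral>\<^sup>+\<omega>. 1 \<partial>M)"
    unfolding exp_moment_def using Y_0 by (intro nn_integral_cong_AE) auto
  then show ?thesis by (simp add: emeasure_space_1)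
qed

lemma exp_moment_add:
  assumes "r \<ge> 0" "s \<ge> 0"
  shows "exp_moment t (r + s) = exp_moment t r * exp_moment t s"
proof -
  \<comment> \<open>\<open>levy_process\<close> speaks of an infinite monotone sequence of times;
    this one runs through \<open>0\<close>, \<open>r\<close> and \<open>r + s\<close> and then stays
    constant, and only its first two increments are used.\<close>
  define \<tau> where "\<tau> i = (if i = 0 then 0 else if i = Suc 0 then r else r + s)" for i :: nat
  have \<tau>: "0 \<le> \<tau> 0" "mono \<tau>" using assms by (auto simp: \<tau>_def mono_def)
  have stat: "distr M borel (\<lambda>\<omega>. Y (u + h) \<omega> - Y u \<omega>) = distr M borel (Y h)" if "u \<ge> 0" "h \<ge> 0" for u h
    using levy that unfolding levy_process_def by auto
  have exp_moment_incr: "(\<integral>\<^sup>+\<omega>. ennreal (exp (t * (Y (u + h) \<omega> - Y u \<omega>))) \<partial>M) = exp_moment t h" if "u \<ge> 0" "h \<ge> 0" for u h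
  proof -
    have [measurable]: "Y (u + h) \<in> borel_measurable M" "Y u \<in> borel_measurable M" "Y h \<in> borel_measurable M"
      using that by auto
    have "(\<integral>\<^sup>+\<omega>. ennreal (exp (t * (Y (u + h) \<omega> - Y u \<omega>))) \<partial>M)
        = (\<integral>\<^sup>+x. ennreal (exp (t * x)) \<partial>distr M borel (\<lambda>\<omega>. Y (u + h) \<omega> - Y u \<omega>))"
      by (subst nn_integral_distr) auto
    also have "\<dots> = exp_moment t h" unfolding stat[OF that] exp_moment_def by (subst nn_integral_distr) auto
    finally show ?thesis .
  qed
  have "indep_vars (\<lambda>_. borel) (\<lambda>i \<omega>. Y (\<tau> (Suc i)) \<omega> - Y (\<tau> i) \<omega>) {..<2}"
    using levy \<tau> unfolding levy_process_def by blast
  then have "indep_vars (\<lambda>_. borel) (\<lambda>i \<omega>. ennreal (exp (t * (Y (\<tau> (Suc i)) \<omega> - Y (\<tau> i) \<omega>)))) {..<2}"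
    by (rule indep_vars_compose2) auto
  then have "(\<integral>\<^sup>+\<omega>. (\<Prod>i<2. ennreal (exp (t * (Y (\<tau> (Suc i)) \<omega> - Y (\<tau> i) \<omega>)))) \<partial>M)
      = (\<Prod>i<2. \<integral>\<^sup>+\<omega>. ennreal (exp (t * (Y (\<tau> (Suc i)) \<omega> - Y (\<tau> i) \<omega>))) \<partial>M)"
    by (intro indep_vars_nn_integral) auto
  also have "\<dots> = (\<integral>\<^sup>+\<omega>. ennreal (exp (t * (Y r \<omega> - Y 0 \<omega>))) \<partial>M) * (\<integral>\<^sup>+\<omega>. ennreal (exp (t * (Y (r + s) \<omega> - Y r \<omega>))) \<partial>M)"
    by (simp add: numeral_2_eq_2 \<tau>_def)
  also have "\<dots> = exp_moment t r * exp_moment t s" using exp_moment_incr[of 0 r] exp_moment_incr[of r s] assms by simp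
  also have "(\<integral>\<^sup>+\<omega>. (\<Prod>i<2. ennreal (exp (t * (Y (\<tau> (Suc i)) \<omega> - Y (\<tau> i) \<omega>)))) \<partial>M)
      = (\<integral>\<^sup>+\<omega>. ennreal (exp (t * (Y r \<omega> - Y 0 \<omega>))) * ennreal (exp (t * (Y (r + s) \<omega> - Y r \<omega>))) \<partial>M)"
    by (simp add: numeral_2_eq_2 \<tau>_def)
  also have "\<dots> = exp_moment t (r + s)"
    unfolding exp_moment_def using Y_0
    by (intro nn_integral_cong_AE) (auto simp: algebra_simps simp flip: ennreal_mult' exp_add)
  finally show ?thesis .
qed

lemma exp_moment_1: "t \<ge> 0 \<Longrightarrow> exp_moment t 1 = ennreal (exp (\<psi> t))"
  unfolding exp_moment_def exp_psi using exp_integrable[of t] by (intro nn_integral_eq_integral) auto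

lemma exp_moment_mult: "s \<ge> 0 \<Longrightarrow> exp_moment t (real n * s) = exp_moment t s ^ n"
  by (induction n) (auto simp: exp_moment_0 exp_moment_add distrib_right)

lemma exp_moment_nat: "t \<ge> 0 \<Longrightarrow> exp_moment t (real n) = ennreal (exp (\<psi> t * real n))"
  using exp_moment_mult[of 1 t n] exp_moment_1[of t] by (simp add: ennreal_power exp_of_nat2_mult)

lemma exp_moment_rat:
  assumes "t \<ge> 0"
  shows "exp_moment t (real k / real (Suc n)) = ennreal (exp (\<psi> t * (real k / real (Suc n))))"
proof -
  let ?e = "exp (\<psi> t * (real k / real (Suc n)))"
  have "exp_moment t (real k / real (Suc n)) ^ Suc n = exp_moment t (real (Suc n) * (real k / real (Suc n)))"
    by (rule exp_moment_mult[symmetric]) simp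
  also have "real (Suc n) * (real k / real (Suc n)) = real k" by simp
  also have "exp_moment t (real k) = ennreal (?e ^ Suc n)"
    unfolding exp_moment_nat[OF assms] exp_of_nat2_mult[symmetric] by simp
  finally have eq: "exp_moment t (real k / real (Suc n)) ^ Suc n = ennreal (?e ^ Suc n)" .
  \<comment> \<open>A power equal to a finite value forces a finite base, so the root can be taken
    among nonnegative reals, where it is unique.\<close>
  then have "exp_moment t (real k / real (Suc n)) \<noteq> \<infinity>"
    by (metis ennreal_neq_top power_eq_top_ennreal infinity_ennreal_def nat.simps(3))
  then obtain x where x: "exp_moment t (real k / real (Suc n)) = ennreal x" "x \<ge> 0"
    by (cases "exp_moment t (real k / real (Suc n))") auto
  with eq have "x ^ Suc n = ?e ^ Suc n" by (simp add: ennreal_power del: power_Suc)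
  then have "x = ?e" using x(2) by (metis exp_ge_zero power_inject_base)
  then show ?thesis using x by simp
qed

text \<open>Fatou's lemma only gives an upper bound at irrational times; multiplicativity then turns it
  into an equality.\<close>

lemma exp_moment_le:
  assumes "t \<ge> 0" "s \<ge> 0"
  shows "exp_moment t s \<le> ennreal (exp (\<psi> t * s))"
proof -
  have meas [measurable]: "Y (right_grid n s) \<in> borel_measurable M" for n
    using right_grid(1)[OF assms(2), of n] assms(2) by (intro Y_measurable) simp
  have "exp_moment t s = (\<integral>\<^sup>+\<omega>. liminf (\<lambda>n. ennreal (exp (t * Y (right_grid n s) \<omega>))) \<partial>M)"
    unfolding exp_moment_def using Y_grid
  proof (intro nn_integral_cong_AE, eventually_elim)
    case (elim \<omega>)
    then have "(\<lambda>n. ennreal (exp (t * Y (right_grid n s) \<omega>))) \<longlonglongrightarrow> ennreal (exp (t * Y s \<omega>))"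
      using assms by (intro tendsto_intros tendsto_ennrealI) auto
    from lim_imp_Liminf[OF _ this] show ?case by simp
  qed
  also have "\<dots> \<le> liminf (\<lambda>n. \<integral>\<^sup>+\<omega>. ennreal (exp (t * Y (right_grid n s) \<omega>)) \<partial>M)"
    by (rule nn_integral_liminf) auto
  also have "(\<lambda>n. \<integral>\<^sup>+\<omega>. ennreal (exp (t * Y (right_grid n s) \<omega>)) \<partial>M) = (\<lambda>n. ennreal (exp (\<psi> t * right_grid n s)))"
    using exp_moment_rat[OF assms(1), of "nat \<lfloor>real (Suc n) * s\<rfloor> + 1" n for n] by (auto simp: exp_moment_def right_grid_def add.commute)
  also have "liminf \<dots> = ennreal (exp (\<psi> t * s))"
  proof (rule lim_imp_Liminf)
    have "(\<lambda>n. right_grid n s) \<longlonglongrightarrow> s"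
      using right_grid_tendsto[OF assms(2)] by (simp add: filterlim_at)
    then show "(\<lambda>n. ennreal (exp (\<psi> t * right_grid n s))) \<longlonglongrightarrow> ennreal (exp (\<psi> t * s))"
      by (intro tendsto_intros tendsto_ennrealI)
  qed simp
  finally show ?thesis .
qed

lemma exp_moment_eq:
  assumes "t \<ge> 0" "s \<ge> 0"
  shows "exp_moment t s = ennreal (exp (\<psi> t * s))"
proof -
  obtain n where n: "s \<le> real n" using real_arch_simple by blast
  have fin: "exp_moment t s < \<infinity>" "exp_moment t (real n - s) < \<infinity>"
    using exp_moment_le[OF assms] exp_moment_le[OF assms(1), of "real n - s"] n by (auto intro: le_less_trans)
  then obtain x y where x: "exp_moment t s = ennreal x" "x \<ge> 0" and y: "exp_moment t (real n - s) = ennreal y" "y \<ge> 0"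
    by (cases "exp_moment t s"; cases "exp_moment t (real n - s)") auto
  have "exp_moment t s * exp_moment t (real n - s) = exp_moment t (real n)" using exp_moment_add[of s "real n - s" t] assms n by simp
  then have xy: "x * y = exp (\<psi> t * real n)"
    using x y exp_moment_nat[OF assms(1), of n] by (simp flip: ennreal_mult)
  have xl: "x \<le> exp (\<psi> t * s)" using exp_moment_le[OF assms] x by simp
  have yl: "y \<le> exp (\<psi> t * (real n - s))" using exp_moment_le[OF assms(1), of "real n - s"] y n by simp
  \<comment> \<open>The product over the complementary times \<open>s\<close> and
    \<open>real n - s\<close> is known exactly at the integer \<open>n\<close>. As each factor is at
    most its claimed value, neither can fall short of it.\<close>
  have "exp (\<psi> t * s) * exp (\<psi> t * (real n - s)) = x * y"
    unfolding xy exp_add[symmetric] by (simp add: algebra_simps)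
  also have "\<dots> \<le> x * exp (\<psi> t * (real n - s))" using yl x by (intro mult_left_mono) auto
  finally have "exp (\<psi> t * s) \<le> x" by simp
  with xl x show ?thesis by simp
qed

section \<open>A jointly measurable version and the law at an exponential time\<close>

definition "Y' t \<omega> = lim (\<lambda>n. Y (right_grid n t) \<omega>)"

lemma Y'_eq: "AE \<omega> in M. \<forall>t\<ge>0. Y' t \<omega> = Y t \<omega>"
  using Y_grid by eventually_elim (auto simp: Y'_def intro: limI)

lemma Y'_measurable [measurable]: "(\<lambda>(t, \<omega>). Y' t \<omega>) \<in> borel_measurable (borel \<Otimes>\<^sub>M M)"
proof -
  have "(\<lambda>z. Y (right_grid n (fst z)) (snd z)) \<in> borel_measurable (borel \<Otimes>\<^sub>M M)" for n
  proof -
    have [measurable]: "Y ((real k + 1) / real (Suc n)) \<in> borel_measurable M" for k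
      by (rule Y_measurable) simp
    \<comment> \<open>For fixed \<open>n\<close> the grid point takes countably many values, so
      joint measurability follows by splitting over the index.\<close>
    have "(\<lambda>z. (\<lambda>k z. Y ((real k + 1) / real (Suc n)) (snd z)) (nat \<lfloor>real (Suc n) * fst z\<rfloor>) z)
        \<in> borel_measurable (borel \<Otimes>\<^sub>M M)"
      proof (rule measurable_compose_countable[where f = "\<lambda>k z. Y ((real k + 1) / real (Suc n)) (snd z)"])
      show "(\<lambda>z. Y ((real k + 1) / real (Suc n)) (snd z)) \<in> borel_measurable (borel \<Otimes>\<^sub>M M)" for k
        by (rule measurable_compose[OF measurable_snd]) measurable
      show "(\<lambda>z. nat \<lfloor>real (Suc n) * fst z\<rfloor>) \<in> borel \<Otimes>\<^sub>M M \<rightarrow>\<^sub>M count_space UNIV"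
        by measurable
    qed
    then show ?thesis by (simp add: right_grid_def)
  qed
  then show ?thesis unfolding Y'_def case_prod_beta by (rule borel_measurable_lim_metric)
qed

definition "exp_law = density lborel (exponential_density 1)"

lemma exp_law: "prob_space exp_law" and sets_exp_law [simp, measurable_cong]: "sets exp_law = sets borel"
  unfolding exp_law_def by (auto intro: prob_space_exponential_density)

lemma exp_law_pos: "AE s in exp_law. s > 0"
proof -
  have "AE s in lborel. s \<noteq> (0::real)" by (rule AE_lborel_singleton)
  then show ?thesis unfolding exp_law_def
    by (subst AE_density) (auto simp: exponential_density_def)
qed

text \<open>The law of \<open>Y\<close> at an exponential time of rate \<open>p\<close>. One
  standard exponential variable is rescaled for every \<open>p\<close>, so that all these laws come
  from a single probability space and \<open>kappa_tendsto\<close> can argue almost surely.\<close>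

definition "\<kappa> p = distr (exp_law \<Otimes>\<^sub>M M) borel (\<lambda>(s, \<omega>). Y' (s / p) \<omega>)"

lemma Y'_scaled_measurable [measurable]: "(\<lambda>(s, \<omega>). Y' (s / p) \<omega>) \<in> borel_measurable (exp_law \<Otimes>\<^sub>M M)"
proof -
  have "(\<lambda>z. (\<lambda>(t, \<omega>). Y' t \<omega>) (fst z / p, snd z)) \<in> borel_measurable (exp_law \<Otimes>\<^sub>M M)" by measurable
  then show ?thesis by (simp add: case_prod_beta)
qed

lemma prob_space_exp_law_M: "prob_space (exp_law \<Otimes>\<^sub>M M)"
proof -
  interpret exp_law: prob_space exp_law by (rule exp_law)
  interpret pair: pair_prob_space exp_law M ..
  show ?thesis by (rule pair.P.prob_space_axioms)
qed

lemma kappa_distribution: "real_distribution (\<kappa> p)"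
  unfolding \<kappa>_def by (intro prob_space.real_distribution_distr prob_space_exp_law_M) measurable

text \<open>By Fubini, given the value \<open>s\<close> of the exponential variable the moment is
  \<open>exp (\<psi> t * (s / p))\<close>; integration against the exponential density converges
  because \<open>\<psi> t < p\<close>, by the chord inequality.\<close>

lemma kappa_mgf:
  assumes "p > 0" "0 \<le> t" "t < \<Phi> p"
  shows "(\<integral>\<^sup>+x. ennreal (exp (t * x)) \<partial>\<kappa> p) = ennreal (p / (p - \<psi> t))"
proof -
  have lt: "\<psi> t < p"
  proof (cases "t = 0")
    case True then show ?thesis using assms psi_0 by simp
  next
    case False
    then have "\<psi> t \<le> p * t / \<Phi> p" using assms by (intro psi_le) auto
    also have "\<dots> < p" using assms Phi_pos[of p] by (simp add: field_simps)
    finally show ?thesis .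
  qed
  define l where "l = 1 - \<psi> t / p"
  have l: "l > 0" using lt assms by (simp add: l_def)
  have "(\<integral>\<^sup>+x. ennreal (exp (t * x)) \<partial>\<kappa> p) = (\<integral>\<^sup>+z. ennreal (exp (t * (case z of (s, \<omega>) \<Rightarrow> Y' (s / p) \<omega>))) \<partial>(exp_law \<Otimes>\<^sub>M M))"
    unfolding \<kappa>_def by (subst nn_integral_distr) auto
  also have "\<dots> = (\<integral>\<^sup>+s. \<integral>\<^sup>+\<omega>. ennreal (exp (t * Y' (s / p) \<omega>)) \<partial>M \<partial>exp_law)"
    by (subst nn_integral_fst[symmetric]) auto
  also have "\<dots> = (\<integral>\<^sup>+s. ennreal (exp (\<psi> t * (s / p))) \<partial>exp_law)"
    using exp_law_pos
  proof (intro nn_integral_cong_AE, eventually_elim)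
    case (elim s)
    have "(\<integral>\<^sup>+\<omega>. ennreal (exp (t * Y' (s / p) \<omega>)) \<partial>M) = exp_moment t (s / p)"
      unfolding exp_moment_def using Y'_eq
      by (intro nn_integral_cong_AE, eventually_elim) (use elim assms in auto)
    also have "\<dots> = ennreal (exp (\<psi> t * (s / p)))" using elim assms by (intro exp_moment_eq) auto
    finally show ?case .
  qed
  also have "\<dots> = (\<integral>\<^sup>+s. ennreal (indicator {0..} s * exp (- l * s)) \<partial>lborel)"
    unfolding exp_law_def
    by (subst nn_integral_density)
      (auto intro!: nn_integral_cong simp: exponential_density_def l_def algebra_simps simp flip: ennreal_mult' exp_add split: split_indicator)
  also have "\<dots> = ennreal (1 / l)" using l by (rule nn_integral_exp_Ici)
  also have "1 / l = p / (p - \<psi> t)" using assms lt by (simp add: l_def field_simps)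
  finally show ?thesis .
qed

text \<open>The times \<open>s / p n\<close> tend to \<open>0\<close> from the right, where the path
  is right-continuous with value \<open>0\<close>. The reflection is the one required by the dual
  resolvent density.\<close>

lemma kappa_tendsto:
  assumes "\<And>n. p n > 0" "filterlim p at_top sequentially"
  shows "weak_conv_m (\<lambda>n. distr (\<kappa> (p n)) borel uminus) (return borel 0)"
proof -
  interpret P: prob_space "exp_law \<Otimes>\<^sub>M M" by (rule prob_space_exp_law_M)
  have "weak_conv_m (\<lambda>n. distr (exp_law \<Otimes>\<^sub>M M) borel (\<lambda>(s, \<omega>). - Y' (s / p n) \<omega>))
      (distr (exp_law \<Otimes>\<^sub>M M) borel (\<lambda>_. 0))"
  proof (rule weak_conv_m_distr_AE[OF prob_space_exp_law_M])
    have "AE \<omega> in M. (\<forall>t\<ge>0. Y' t \<omega> = Y t \<omega>) \<and> Y 0 \<omega> = 0 \<and> ((\<lambda>s. Y s \<omega>) \<longlongrightarrow> Y 0 \<omega>) (at_right 0)"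
      using Y'_eq Y_0 Y_right by eventually_elim auto
    from AE_pair_snd[OF sigma_finite_measure_axioms this] AE_pair_fst[OF sigma_finite_measure_axioms exp_law_pos]
    show "AE z in exp_law \<Otimes>\<^sub>M M. (\<lambda>n. case z of (s, \<omega>) \<Rightarrow> - Y' (s / p n) \<omega>) \<longlonglongrightarrow> 0"
    proof eventually_elim
      case (elim z)
      obtain s \<omega> where z: "z = (s, \<omega>)" by (cases z)
      have s: "s > 0" using elim z by simp
      have "(\<lambda>n. s / p n) \<longlonglongrightarrow> 0"
        using assms(2) by (intro tendsto_divide_0[OF tendsto_const] filterlim_at_top_imp_at_infinity)
      moreover have "s / p n \<in> {0<..} \<and> s / p n \<noteq> 0" for n
        using s assms(1)[of n] by simp
      ultimately have "filterlim (\<lambda>n. s / p n) (at_right 0) sequentially"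
        unfolding filterlim_at by simp
      then have "(\<lambda>n. Y (s / p n) \<omega>) \<longlonglongrightarrow> 0"
        using elim z by (auto intro: filterlim_compose)
      moreover have "Y (s / p n) \<omega> = Y' (s / p n) \<omega>" for n
        using elim z s assms(1)[of n] by simp
      ultimately show ?case using tendsto_minus z by fastforce
    qed
  next
    show "(\<lambda>(s, \<omega>). - Y' (s / p n) \<omega>) \<in> borel_measurable (exp_law \<Otimes>\<^sub>M M)" for n
      using Y'_scaled_measurable[of "p n"] by (simp add: case_prod_beta)
  qed simp
  moreover have "distr (exp_law \<Otimes>\<^sub>M M) borel (\<lambda>(s, \<omega>). - Y' (s / p n) \<omega>) = distr (\<kappa> (p n)) borel uminus" for n
    unfolding \<kappa>_def by (subst distr_distr) (auto simp: o_def case_prod_unfold)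
  moreover have "distr (exp_law \<Otimes>\<^sub>M M) borel (\<lambda>_. 0) = return borel (0::real)"
    by (intro P.distr_const) simp
  ultimately show ?thesis by simp
qed

end

text \<open>Comparison of the integrals on the set where \<open>w\<close> exceeds \<open>f\<close>
  shows that \<open>max f w\<close> and \<open>f\<close> define the same measure; densities with
  respect to Lebesgue measure are unique almost everywhere.\<close>

lemma density_le_imp_AE_le:
  fixes f w :: "real \<Rightarrow> ennreal"
  assumes [measurable]: "f \<in> borel_measurable borel" "w \<in> borel_measurable borel"
    and le: "\<And>A. A \<in> sets borel \<Longrightarrow> (\<integral>\<^sup>+x\<in>A. w x \<partial>lborel) \<le> (\<integral>\<^sup>+x\<in>A. f x \<partial>lborel)"
  shows "AE x in lborel. w x \<le> f x"
proof -
  have "density lborel (\<lambda>x. max (f x) (w x)) = density lborel f"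
  proof (rule measure_eqI)
    fix A assume "A \<in> sets (density lborel (\<lambda>x. max (f x) (w x)))"
    then have A [measurable]: "A \<in> sets borel" by simp
    define B where "B = {x. f x < w x}"
    have [measurable]: "B \<in> sets borel" unfolding B_def by measurable
    have "(\<integral>\<^sup>+x\<in>A. max (f x) (w x) \<partial>lborel) = (\<integral>\<^sup>+x\<in>A \<inter> B. w x \<partial>lborel) + (\<integral>\<^sup>+x\<in>A - B. f x \<partial>lborel)"
      by (subst nn_integral_add[symmetric]) (auto intro!: nn_integral_cong simp: B_def max_def split: split_indicator)
    also have "\<dots> \<le> (\<integral>\<^sup>+x\<in>A \<inter> B. f x \<partial>lborel) + (\<integral>\<^sup>+x\<in>A - B. f x \<partial>lborel)"
      by (intro add_mono le) auto
    also have "\<dots> = (\<integral>\<^sup>+x\<in>A. f x \<partial>lborel)"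
      by (subst nn_integral_add[symmetric]) (auto intro!: nn_integral_cong split: split_indicator)
    finally have "(\<integral>\<^sup>+x\<in>A. max (f x) (w x) \<partial>lborel) \<le> (\<integral>\<^sup>+x\<in>A. f x \<partial>lborel)" .
    moreover have "(\<integral>\<^sup>+x\<in>A. f x \<partial>lborel) \<le> (\<integral>\<^sup>+x\<in>A. max (f x) (w x) \<partial>lborel)"
      by (intro nn_integral_mono mult_right_mono) auto
    ultimately show "emeasure (density lborel (\<lambda>x. max (f x) (w x))) A = emeasure (density lborel f) A"
      by (simp add: emeasure_density)
  qed simp
  then have "AE x in lborel. max (f x) (w x) = f x"
    by (intro sigma_finite_measure.density_unique[OF lborel.sigma_finite_measure_axioms]) auto
  then show ?thesis by eventually_elim (metis max.cobounded2)
qed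

lemma nn_integral_exp_Iic:
  assumes "0 < l"
  shows "(\<integral>\<^sup>+x. ennreal (indicator {..0} x * exp (l * x)) \<partial>lborel) = ennreal (1 / l)"
proof -
  have "(\<integral>\<^sup>+x. ennreal (indicator {..0} x * exp (l * x)) \<partial>lborel)
      = (\<integral>\<^sup>+x. ennreal (indicator {0..} x * exp (- l * x)) \<partial>lborel)"
    by (subst nn_integral_real_affine[of _ "- 1" 0]) (auto intro!: nn_integral_cong simp: one_ennreal_def[symmetric] split: split_indicator)
  then show ?thesis using nn_integral_exp_Ici[OF assms] by simp
qed

section \<open>The resolvent density as a density at an exponential time\<close>

context levy_scale
begin

lemma wiener_hopf_kappa:
  assumes p: "p > 0"
  shows "wiener_hopf (\<kappa> p) (Wm 0) p (\<Phi> 0) (\<Phi> p) \<psi>"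
proof (rule wiener_hopf.intro)
  show "real_distribution (\<kappa> p)" by (rule kappa_distribution)
  then interpret k: real_distribution "\<kappa> p" .
  show int: "integrable (\<kappa> p) (\<lambda>x. exp (t * x))" if "0 \<le> t" "t < \<Phi> p" for t
    using kappa_mgf[OF p that] by (intro integrableI_nonneg) auto
  show "(\<integral>x. exp (t * x) \<partial>\<kappa> p) = p / (p - \<psi> t)" if t: "0 \<le> t" "t < \<Phi> p" for t
  proof -
    have "\<psi> t \<le> p"
    proof (cases "t = 0")
      case True then show ?thesis using p psi_0 by simp
    next
      case False
      then have "\<psi> t \<le> p * t / \<Phi> p" using t p by (intro psi_le) auto
      also have "\<dots> \<le> p" using t p Phi_pos[of p] by (simp add: field_simps)
      finally show ?thesis .
    qed
    then show ?thesis
      using kappa_mgf[OF p t] p by (simp add: integral_eq_nn_integral)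
  qed
  show "0 \<le> \<Phi> 0" by (rule Phi_mem) simp
  show "\<Phi> 0 < \<Phi> p" using p by (intro Phi_less) auto
  show "\<psi> (\<Phi> p) = p" using p by (intro Phi_mem) simp
  show "\<psi> t \<le> p * t / \<Phi> p" if "0 < t" "t < \<Phi> p" for t using psi_le[OF p] that by simp
  show "p * t / \<Phi> p \<le> \<psi> t" if "\<Phi> p < t" for t using psi_ge[OF p] that by simp
  show "0 < \<psi> t" if "\<Phi> 0 < t" for t using psi_gt[of 0] that by simp
  show "integrable (Wm 0) (\<lambda>x. exp (t * x))" if "\<Phi> 0 < t" for t using Wm_integrable[of 0] that by simp
  show "(\<integral>x. exp (t * x) \<partial>Wm 0) = 1 / \<psi> t" if "\<Phi> 0 < t" for t using Wm_integral[of 0] that by simp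
  show "(\<integral>x. exp ((complex_of_real (\<Phi> p) + \<i> * complex_of_real s) * complex_of_real x) \<partial>Wm 0) \<noteq> 1 / p"
    if "s \<noteq> 0" for s using Wm_nonlattice[OF p that] .
qed (use p in auto)

lemma resolvent_density_measurable [measurable]:
  assumes "p \<ge> 0"
  shows "resolvent_density \<psi> W p \<in> borel_measurable borel"
proof -
  note [measurable] = W_measurable[OF assms]
  show ?thesis unfolding resolvent_density_def[abs_def] by measurable
qed

text \<open>The two halves of the law are identified separately by \<open>mgf_unique\<close>: the
  positive half from exponents between \<open>0\<close> and \<open>\<Phi> p\<close>, the other from
  exponents just above \<open>\<Phi> p\<close>, where the transform of \<open>W p\<close> converges.
  Nonnegativity comes out on the way, since \<open>w\<close> is dominated by a sum of measures with
  density \<open>f\<close>.\<close>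

lemma
  assumes p: "p > 0"
  shows resolvent_density_nonneg: "AE u in lborel. 0 \<le> resolvent_density \<psi> W p u"
    and kappa_density: "\<kappa> p = density lborel (\<lambda>u. ennreal (p * resolvent_density \<psi> W p u))"
proof -
  interpret wh: wiener_hopf "\<kappa> p" "Wm 0" p "\<Phi> 0" "\<Phi> p" \<psi> by (rule wiener_hopf_kappa[OF p])
  interpret k: real_distribution "\<kappa> p" by (rule kappa_distribution)
  have "p \<ge> 0" using p by simp
  note [measurable] = W_measurable[OF this] resolvent_density_measurable[OF this]
  let ?g = "resolvent_density \<psi> W p"
  define c where "c = p / deriv \<psi> (\<Phi> p)"
  have c: "c > 0" using wh.deriv_psi_pos p by (simp add: c_def)
  define a where "a u = c * exp (- \<Phi> p * u)" for u
  have a: "a u > 0" for u using c by (simp add: a_def)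
  have [measurable]: "a \<in> borel_measurable borel" unfolding a_def by measurable
  have pg: "p * ?g u = a u - p * W p (- u)" for u
    using p by (simp add: resolvent_density_def a_def c_def algebra_simps)
  have Np: "wh.Np = density lborel (\<lambda>u. ennreal (indicator {0..} u * a u))"
  proof (rule mgf_unique[of _ _ 0 "\<Phi> p"])
    fix t assume t: "0 < t" "t < \<Phi> p"
    have eq: "(\<integral>\<^sup>+x. ennreal (exp (t * x)) \<partial>wh.Np) = ennreal (c / (\<Phi> p - t))"
      using wh.int_Np[OF t(2)] wh.integral_positive[OF t(2)]
      by (subst nn_integral_eq_integral) (auto simp: c_def)
    show "(\<integral>\<^sup>+x. ennreal (exp (t * x)) \<partial>wh.Np) < \<infinity>" unfolding eq by simp
    have "(\<integral>\<^sup>+x. ennreal (exp (t * x)) \<partial>density lborel (\<lambda>u. ennreal (indicator {0..} u * a u)))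
        = (\<integral>\<^sup>+x. ennreal c * ennreal (indicator {0..} x * exp (- (\<Phi> p - t) * x)) \<partial>lborel)"
      using c a by (subst nn_integral_density)
        (auto intro!: nn_integral_cong simp: a_def algebra_simps less_imp_le simp flip: ennreal_mult' exp_add split: split_indicator)
    also have "\<dots> = ennreal (c / (\<Phi> p - t))"
      using t c by (subst nn_integral_cmult) (auto simp: nn_integral_exp_Ici[of "\<Phi> p - t", simplified] simp flip: ennreal_mult')
    finally show "(\<integral>\<^sup>+x. ennreal (exp (t * x)) \<partial>wh.Np)
       = (\<integral>\<^sup>+x. ennreal (exp (t * x)) \<partial>density lborel (\<lambda>u. ennreal (indicator {0..} u * a u)))"
      using eq by simp
  qed (use Phi_pos[OF p] in auto)
  define w where "w u = ennreal (p * W p (- u))" for u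
  define f where "f u = ennreal (indicator {..0} u * a u)" for u
  have [measurable]: "w \<in> borel_measurable borel" "f \<in> borel_measurable borel"
    unfolding w_def f_def by measurable
  have mgf_w: "(\<integral>\<^sup>+u. ennreal (exp (t * u)) \<partial>density lborel w) = ennreal (p / (\<psi> t - p))" if t: "\<Phi> p < t" for t
  proof -
    have "(\<integral>\<^sup>+u. ennreal (exp (t * u)) \<partial>density lborel w)
        = (\<integral>\<^sup>+u. ennreal p * (ennreal (W p (- u)) * ennreal (exp (t * u))) \<partial>lborel)"
      unfolding w_def using p W_nonneg by (subst nn_integral_density)
        (auto intro!: nn_integral_cong simp: ennreal_mult' mult.assoc)
    also have "\<dots> = ennreal p * (\<integral>\<^sup>+u. ennreal (exp (t * u)) \<partial>Wm p)"
      unfolding Wm_def by (subst nn_integral_density) (auto simp: nn_integral_cmult)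
    also have "(\<integral>\<^sup>+u. ennreal (exp (t * u)) \<partial>Wm p) = ennreal (1 / (\<psi> t - p))"
      using Wm_integrable[of p t] Wm_integral[of p t] p t by (subst nn_integral_eq_integral) auto
    finally show ?thesis using p by (simp flip: ennreal_mult')
  qed
  have mgf_f: "(\<integral>\<^sup>+u. ennreal (exp (t * u)) \<partial>density lborel f) = ennreal (c / (t - \<Phi> p))" if t: "\<Phi> p < t" for t
  proof -
    have "(\<integral>\<^sup>+u. ennreal (exp (t * u)) \<partial>density lborel f)
        = (\<integral>\<^sup>+x. ennreal c * ennreal (indicator {..0} x * exp ((t - \<Phi> p) * x)) \<partial>lborel)"
      unfolding f_def using c a by (subst nn_integral_density)
        (auto intro!: nn_integral_cong simp: a_def algebra_simps less_imp_le simp flip: ennreal_mult' exp_add split: split_indicator)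
    also have "\<dots> = ennreal (c / (t - \<Phi> p))"
      using t c by (subst nn_integral_cmult) (auto simp: nn_integral_exp_Iic[of "t - \<Phi> p", simplified] simp flip: ennreal_mult')
    finally show ?thesis .
  qed
  have mgf_Nm: "(\<integral>\<^sup>+u. ennreal (exp (t * u)) \<partial>wh.Nm) + ennreal (p / (\<psi> t - p)) = ennreal (c / (t - \<Phi> p))" if t: "\<Phi> p < t" for t
  proof -
    have t0: "t \<ge> 0" using t Phi_pos[OF p] by simp
    have pos: "p / (\<psi> t - p) \<ge> 0" using psi_gt[of p t] t p by simp
    have "(\<integral>\<^sup>+u. ennreal (exp (t * u)) \<partial>wh.Nm) = ennreal (c / (t - \<Phi> p) - p / (\<psi> t - p))"
      using wh.int_Nm[OF t0] wh.integral_negative[OF t]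
      by (subst nn_integral_eq_integral) (auto simp: c_def)
    moreover have "c / (t - \<Phi> p) - p / (\<psi> t - p) \<ge> 0"
    proof -
      have "(\<integral>x. exp (t * x) \<partial>wh.Nm) \<ge> 0" by simp
      then show ?thesis using wh.integral_negative[OF t] by (simp add: c_def)
    qed
    ultimately show ?thesis using pos by (simp flip: ennreal_plus)
  qed
  \<comment> \<open>The sign of \<open>f - w\<close> is not known yet, so only the sums of positive measures can be compared.\<close>
  have sum: "add_measure wh.Nm (density lborel w) = density lborel f"
  proof (rule mgf_unique[of _ _ "\<Phi> p" "\<Phi> p + 1"])
    fix t assume t: "\<Phi> p < t" "t < \<Phi> p + 1"
    have eq: "(\<integral>\<^sup>+x. ennreal (exp (t * x)) \<partial>add_measure wh.Nm (density lborel w)) = ennreal (c / (t - \<Phi> p))"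
      using mgf_Nm[OF t(1)] mgf_w[OF t(1)] by (subst nn_integral_add_measure) auto
    then show "(\<integral>\<^sup>+x. ennreal (exp (t * x)) \<partial>add_measure wh.Nm (density lborel w))
       = (\<integral>\<^sup>+x. ennreal (exp (t * x)) \<partial>density lborel f)" using mgf_f[OF t(1)] by simp
    show "(\<integral>\<^sup>+x. ennreal (exp (t * x)) \<partial>add_measure wh.Nm (density lborel w)) < \<infinity>" unfolding eq by simp
  qed auto
  have "AE u in lborel. w u \<le> f u"
  proof (rule density_le_imp_AE_le)
    fix A :: "real set" assume A: "A \<in> sets borel"
    have "emeasure wh.Nm A + emeasure (density lborel w) A = emeasure (density lborel f) A"
      using A by (simp add: sum[symmetric] emeasure_add_measure)
    moreover have "emeasure (density lborel w) A \<le> emeasure wh.Nm A + emeasure (density lborel w) A"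
      by simp
    ultimately have "emeasure (density lborel w) A \<le> emeasure (density lborel f) A" by metis
    then show "(\<integral>\<^sup>+u\<in>A. w u \<partial>lborel) \<le> (\<integral>\<^sup>+u\<in>A. f u \<partial>lborel)"
      using A by (simp add: emeasure_density)
  qed measurable
  then have ge: "AE u in lborel. p * W p (- u) \<le> indicator {..0} u * a u"
    by eventually_elim (use a in \<open>auto simp: w_def f_def less_imp_le\<close>)
  then have pg_nonneg: "AE u in lborel. 0 \<le> p * ?g u"
    unfolding pg
  proof eventually_elim
    case (elim u)
    also have "indicator {..0} u * a u \<le> a u" using a[of u] by (simp add: indicator_def)
    finally show ?case by simp
  qed
  then show "AE u in lborel. 0 \<le> ?g u" using p by (simp add: zero_le_mult_iff)
  have Nm: "wh.Nm = density lborel (\<lambda>u. ennreal (indicator {..0} u * (p * ?g u)))"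
  proof (rule mgf_unique[of _ _ "\<Phi> p" "\<Phi> p + 1"])
    fix t assume t: "\<Phi> p < t" "t < \<Phi> p + 1"
    let ?D = "density lborel (\<lambda>u. ennreal (indicator {..0} u * (p * ?g u)))"
    have "(\<integral>\<^sup>+x. ennreal (exp (t * x)) \<partial>?D) + (\<integral>\<^sup>+x. ennreal (exp (t * x)) \<partial>density lborel w)
        = (\<integral>\<^sup>+x. ennreal (exp (t * x)) \<partial>density lborel f)"
    proof -
      have dens: "(\<integral>\<^sup>+u. ennreal (exp (t * u)) \<partial>density lborel h) = (\<integral>\<^sup>+u. h u * ennreal (exp (t * u)) \<partial>lborel)"
        if "h \<in> borel_measurable borel" for h
        using that by (subst nn_integral_density) auto
      have "(\<integral>\<^sup>+u. ennreal (indicator {..0} u * (p * ?g u)) * ennreal (exp (t * u)) \<partial>lborel)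
          + (\<integral>\<^sup>+u. w u * ennreal (exp (t * u)) \<partial>lborel)
        = (\<integral>\<^sup>+u. ennreal (indicator {..0} u * (p * ?g u)) * ennreal (exp (t * u)) + w u * ennreal (exp (t * u)) \<partial>lborel)"
        by (rule nn_integral_add[symmetric]) auto
      also have "\<dots> = (\<integral>\<^sup>+u. f u * ennreal (exp (t * u)) \<partial>lborel)"
        using ge
      proof (intro nn_integral_cong_AE, eventually_elim)
        case (elim u)
        have "ennreal (indicator {..0} u * (p * ?g u)) + w u = f u"
          unfolding w_def f_def pg using elim a[of u] p W_nonneg[of p "- u"] W_neg[of p "- u"]
          by (cases "u \<le> 0") (auto simp flip: ennreal_plus)
        then show ?case by (metis distrib_right)
      qed
      finally show ?thesis by (simp add: dens)
    qed
    then have "(\<integral>\<^sup>+x. ennreal (exp (t * x)) \<partial>?D) + ennreal (p / (\<psi> t - p)) = (\<integral>\<^sup>+x. ennreal (exp (t * x)) \<partial>wh.Nm) + ennreal (p / (\<psi> t - p))"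
      unfolding mgf_w[OF t(1)] mgf_f[OF t(1)] mgf_Nm[OF t(1)] .
    \<comment> \<open>The common summand is finite, so it cancels in the extended reals.\<close>
    then show "(\<integral>\<^sup>+x. ennreal (exp (t * x)) \<partial>wh.Nm) = (\<integral>\<^sup>+x. ennreal (exp (t * x)) \<partial>?D)"
      by simp
    show "(\<integral>\<^sup>+x. ennreal (exp (t * x)) \<partial>wh.Nm) < \<infinity>"
    proof -
      have "(\<integral>\<^sup>+x. ennreal (exp (t * x)) \<partial>wh.Nm) \<le> ennreal (c / (t - \<Phi> p))"
        unfolding mgf_Nm[OF t(1), symmetric] by simp
      also have "\<dots> < \<infinity>" by simp
      finally show ?thesis .
    qed
  qed auto
  show "\<kappa> p = density lborel (\<lambda>u. ennreal (p * ?g u))"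
  proof (rule measure_eqI)
    fix A assume "A \<in> sets (\<kappa> p)"
    then have A [measurable]: "A \<in> sets borel" by simp
    have "emeasure (\<kappa> p) A = (\<integral>\<^sup>+x. indicator A x \<partial>\<kappa> p)" by simp
    also have "\<dots> = (\<integral>\<^sup>+x. ennreal (indicator {0<..} x) * indicator A x + ennreal (indicator {..0} x) * indicator A x \<partial>\<kappa> p)"
      by (intro nn_integral_cong) (auto split: split_indicator)
    also have "\<dots> = (\<integral>\<^sup>+x\<in>A. ennreal (indicator {0<..} x) \<partial>\<kappa> p) + (\<integral>\<^sup>+x\<in>A. ennreal (indicator {..0} x) \<partial>\<kappa> p)"
      by (rule nn_integral_add) auto
    also have "\<dots> = emeasure wh.Np A + emeasure wh.Nm A"
      by (simp add: wh.Np_def wh.Nm_def emeasure_density)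
    also have "\<dots> = (\<integral>\<^sup>+u\<in>A. ennreal (indicator {0..} u * a u) \<partial>lborel) + (\<integral>\<^sup>+u\<in>A. ennreal (indicator {..0} u * (p * ?g u)) \<partial>lborel)"
      unfolding Np Nm by (simp add: emeasure_density)
    also have "\<dots> = (\<integral>\<^sup>+u. ennreal (indicator {0..} u * a u) * indicator A u + ennreal (indicator {..0} u * (p * ?g u)) * indicator A u \<partial>lborel)"
      by (rule nn_integral_add[symmetric]) auto
    also have "\<dots> = (\<integral>\<^sup>+u\<in>A. ennreal (p * ?g u) \<partial>lborel)"
      \<comment> \<open>The two half-line densities overlap only at \<open>0\<close>, a null set; to
        the right of it the scale function term vanishes.\<close>
      using AE_lborel_singleton[of "0::real"]
    proof (intro nn_integral_cong_AE, eventually_elim)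
      case (elim u)
      then show ?case using W_neg[of p "- u"] p by (cases "u < 0") (auto simp: pg split: split_indicator)
    qed
    finally show "emeasure (\<kappa> p) A = emeasure (density lborel (\<lambda>u. ennreal (p * ?g u))) A"
      by (simp add: emeasure_density)
  qed simp
qed

end

section \<open>The measures on the half line\<close>

lemma nn_integral_exp_atLeast:
  assumes "0 < l"
  shows "(\<integral>\<^sup>+x. ennreal (indicator {a..} x * exp (- l * x)) \<partial>lborel) = ennreal (exp (- l * a) / l)"
proof -
  have "(\<integral>\<^sup>+x. ennreal (indicator {a..} x * exp (- l * x)) \<partial>lborel)
      = (\<integral>\<^sup>+x. ennreal (exp (- l * a)) * ennreal (indicator {0..} x * exp (- l * x)) \<partial>lborel)"
    by (subst nn_integral_real_affine[of _ 1 a])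
      (auto intro!: nn_integral_cong simp: one_ennreal_def[symmetric] algebra_simps simp flip: ennreal_mult' exp_add split: split_indicator)
  also have "\<dots> = ennreal (exp (- l * a)) * (\<integral>\<^sup>+x. ennreal (indicator {0..} x * exp (- l * x)) \<partial>lborel)"
    by (rule nn_integral_cmult) measurable
  also have "\<dots> = ennreal (exp (- l * a)) * ennreal (1 / l)"
    unfolding nn_integral_exp_Ici[OF assms] ..
  finally show ?thesis by (simp flip: ennreal_mult')
qed

text \<open>The transform of \<open>\<mu>\<close> is recorded beyond \<open>\<Phi> q\<close>, away
  from the removable singularity: on that range the transform of \<open>W q\<close> converges and
  the two can be compared.\<close>

locale limit_law = levy_scale M Y \<psi> W
  for M :: "'a measure" and Y :: "real \<Rightarrow> 'a \<Rightarrow> real" and \<psi> W +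
  fixes q :: real and \<mu> :: "real measure"
  assumes q: "q > 0"
    and mu_distr: "real_distribution \<mu>"
    and mu_nonneg: "AE y in \<mu>. 0 \<le> y"
    and mu_laplace: "\<And>t. t > \<Phi> q \<Longrightarrow> (\<integral>y. exp (- t * y) \<partial>\<mu>) = q / \<Phi> q * ((t - \<Phi> q) / (\<psi> t - q))"
begin

interpretation mu: real_distribution \<mu> by (rule mu_distr)

section \<open>The scale function and \<open>H_fun\<close> as mixtures over the limit law\<close>

lemma phi_pos: "\<Phi> q > 0" using Phi_pos q .

lemma Wq_measurable [measurable]: "W q \<in> borel_measurable borel"
  using q by (intro W_measurable) simp

lemma mu_exp_integrable: "t \<ge> 0 \<Longrightarrow> integrable \<mu> (\<lambda>y. exp (- t * y))"
  by (rule mu.integrable_const_bound[where B = 1]) (use mu_nonneg in \<open>auto elim!: eventually_mono\<close>)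

lemma mu_laplace_nn:
  assumes "t > \<Phi> q"
  shows "(\<integral>\<^sup>+y. ennreal (exp (- t * y)) \<partial>\<mu>) = ennreal (q / \<Phi> q * ((t - \<Phi> q) / (\<psi> t - q)))"
  using mu_exp_integrable[of t] mu_laplace[OF assms] assms phi_pos
  by (subst nn_integral_eq_integral) auto

text \<open>The exponential function of rate \<open>\<Phi> q\<close> started at \<open>x\<close>;
  its Laplace transform at \<open>s\<close> beyond \<open>\<Phi> q\<close> is
  \<open>exp (- s * x) / (s - \<Phi> q)\<close>.\<close>

definition "exp_kernel x y = (if x \<le> y then exp (\<Phi> q * (y - x)) else 0)"

lemma exp_kernel_measurable [measurable (raw)]:
  assumes [measurable]: "u \<in> borel_measurable N" "v \<in> borel_measurable N"
  shows "(\<lambda>z. exp_kernel (u z) (v z)) \<in> borel_measurable N"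
  unfolding exp_kernel_def by measurable

text \<open>Mixing the kernel over \<open>\<mu>\<close> divides the transform of
  \<open>\<mu>\<close> by \<open>s - \<Phi> q\<close>, which cancels the numerator and leaves
  \<open>1 / (\<psi> s - q)\<close> up to the constant. Uniqueness of transforms gives equality of
  the measures, hence of the densities almost everywhere.\<close>

lemma W_eq: "AE y in lborel. ennreal (W q y) = ennreal (\<Phi> q / q) * (\<integral>\<^sup>+x. ennreal (exp_kernel x y) \<partial>\<mu>)"
proof -
  let ?\<phi> = "\<Phi> q"
  let ?k = "\<lambda>x y. ennreal (exp_kernel x y)"
  let ?K = "\<lambda>y. ennreal (?\<phi> / q) * (\<integral>\<^sup>+x. ?k x y \<partial>\<mu>)"
  have [measurable]: "?K \<in> borel_measurable borel" by measurable
  interpret L: pair_sigma_finite \<mu> lborel ..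
  have "density lborel (\<lambda>y. ennreal (W q y)) = density lborel ?K"
  \<comment> \<open>\<open>mgf_unique\<close> uses exponents \<open>t * y\<close>, so the Laplace
    variable is \<open>- t\<close>, which ranges just above \<open>\<Phi> q\<close>.\<close>
  proof (rule mgf_unique[of _ _ "- ?\<phi> - 1" "- ?\<phi>"])
    fix t assume t: "- ?\<phi> - 1 < t" "t < - ?\<phi>"
    then have t': "- t > ?\<phi>" by simp
    have "(\<integral>\<^sup>+y. ennreal (exp (t * y)) \<partial>density lborel (\<lambda>y. ennreal (W q y)))
        = (\<integral>\<^sup>+y. ennreal (exp (- (- t) * y) * W q y) \<partial>lborel)"
      by (subst nn_integral_density) (auto intro!: nn_integral_cong simp: mult.commute simp flip: ennreal_mult'')
    also have "\<dots> = ennreal (1 / (\<psi> (- t) - q))"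
      using W_laplace[of q "- t"] t' q W_nonneg[of q] by (subst nn_integral_eq_integral) auto
    finally have 1: "(\<integral>\<^sup>+y. ennreal (exp (t * y)) \<partial>density lborel (\<lambda>y. ennreal (W q y))) = ennreal (1 / (\<psi> (- t) - q))" .
    show "(\<integral>\<^sup>+y. ennreal (exp (t * y)) \<partial>density lborel (\<lambda>y. ennreal (W q y))) < \<infinity>" unfolding 1 by simp
    have "(\<integral>\<^sup>+y. ennreal (exp (t * y)) \<partial>density lborel ?K)
        = (\<integral>\<^sup>+y. ennreal (?\<phi> / q) * (\<integral>\<^sup>+x. ennreal (exp (t * y)) * ?k x y \<partial>\<mu>) \<partial>lborel)"
      by (subst nn_integral_density) (auto intro!: nn_integral_cong simp: nn_integral_cmult mult_ac)
    also have "\<dots> = ennreal (?\<phi> / q) * (\<integral>\<^sup>+y. (\<integral>\<^sup>+x. ennreal (exp (t * y)) * ?k x y \<partial>\<mu>) \<partial>lborel)"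
      by (rule nn_integral_cmult) measurable
    also have "(\<integral>\<^sup>+y. (\<integral>\<^sup>+x. ennreal (exp (t * y)) * ?k x y \<partial>\<mu>) \<partial>lborel)
        = (\<integral>\<^sup>+x. (\<integral>\<^sup>+y. ennreal (exp (t * y)) * ?k x y \<partial>lborel) \<partial>\<mu>)"
      by (rule L.Fubini') measurable
    also have "\<dots> = (\<integral>\<^sup>+x. ennreal (1 / (- t - ?\<phi>)) * ennreal (exp (- (- t) * x)) \<partial>\<mu>)"
    proof (intro nn_integral_cong)
      fix x
      have "(\<integral>\<^sup>+y. ennreal (exp (t * y)) * ?k x y \<partial>lborel)
          = (\<integral>\<^sup>+y. ennreal (exp (- ?\<phi> * x)) * ennreal (indicator {x..} y * exp (- (- t - ?\<phi>) * y)) \<partial>lborel)"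
        by (intro nn_integral_cong) (auto simp: exp_kernel_def algebra_simps simp flip: ennreal_mult' exp_add split: split_indicator)
      also have "\<dots> = ennreal (exp (- ?\<phi> * x)) * ennreal (exp (- (- t - ?\<phi>) * x) / (- t - ?\<phi>))"
        using nn_integral_exp_atLeast[of "- t - ?\<phi>" x] t' by (subst nn_integral_cmult) auto
      also have "\<dots> = ennreal (1 / (- t - ?\<phi>)) * ennreal (exp (- (- t) * x))"
      proof -
        have "exp (- ?\<phi> * x) * exp (- (- t - ?\<phi>) * x) = exp (- (- t) * x)"
          unfolding exp_add[symmetric] by (simp add: algebra_simps)
        then show ?thesis using t' by (simp flip: ennreal_mult')
      qed
      finally show "(\<integral>\<^sup>+y. ennreal (exp (t * y)) * ?k x y \<partial>lborel) = ennreal (1 / (- t - ?\<phi>)) * ennreal (exp (- (- t) * x))" .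
    qed
    also have "\<dots> = ennreal (1 / (- t - ?\<phi>)) * ennreal (q / ?\<phi> * ((- t - ?\<phi>) / (\<psi> (- t) - q)))"
      using mu_laplace_nn[OF t'] by (subst nn_integral_cmult) auto
    also have "ennreal (?\<phi> / q) * \<dots> = ennreal (1 / (\<psi> (- t) - q))"
    proof -
      define s d where "s = - t - ?\<phi>" and "d = \<psi> (- t) - q"
      have sd: "s > 0" "d > 0" using t' psi_gt[of q "- t"] q by (auto simp: s_def d_def)
      have "ennreal (1 / s) * ennreal (q / ?\<phi> * (s / d)) = ennreal (1 / s * (q / ?\<phi> * (s / d)))"
        by (rule ennreal_mult'[symmetric]) (use sd in simp)
      moreover have "ennreal (?\<phi> / q) * ennreal (1 / s * (q / ?\<phi> * (s / d))) = ennreal (?\<phi> / q * (1 / s * (q / ?\<phi> * (s / d))))"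
        by (rule ennreal_mult'[symmetric]) (use phi_pos q in simp)
      moreover have "?\<phi> / q * (1 / s * (q / ?\<phi> * (s / d))) = 1 / d" using sd phi_pos q by simp
      ultimately show ?thesis unfolding s_def[symmetric] d_def[symmetric] by simp
    qed
    finally show "(\<integral>\<^sup>+y. ennreal (exp (t * y)) \<partial>density lborel (\<lambda>y. ennreal (W q y)))
        = (\<integral>\<^sup>+y. ennreal (exp (t * y)) \<partial>density lborel ?K)" using 1 by simp
  qed auto
  then show ?thesis
    by (intro sigma_finite_measure.density_unique[OF lborel.sigma_finite_measure_axioms]) auto
qed

text \<open>The function \<open>(\<Phi> (q + l) - \<Phi> q) * H_fun\<close> written as an overshoot
  expectation of \<open>\<mu>\<close> beyond \<open>y\<close>, from which its nonnegativity is
  visible.\<close>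

definition "H_mixture l y = \<Phi> q / q * l * (\<integral>x. indicator {y<..} x * exp (- \<Phi> (q + l) * (x - y)) \<partial>\<mu>)"

lemma H_mixture_nonneg: "l > 0 \<Longrightarrow> 0 \<le> H_mixture l y"
  using phi_pos q unfolding H_mixture_def by (intro mult_nonneg_nonneg integral_nonneg_AE) auto

lemma Phi_shift: assumes "l > 0" shows "\<Phi> q < \<Phi> (q + l)" "\<psi> (\<Phi> (q + l)) = q + l"
  using Phi_less[of q "q + l"] Phi_mem[of "q + l"] assms q by auto

text \<open>Insert \<open>W_eq\<close> and integrate over \<open>z\<close> first: the kernel and the
  tail together restrict \<open>z\<close> to values at least \<open>max x y\<close>, which leaves an
  exponential tail of rate \<open>\<beta> - \<Phi> q\<close>.\<close>

lemma W_tail: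
  assumes l: "l > 0" and y: "y \<ge> 0"
  defines "\<beta> \<equiv> \<Phi> (q + l)"
  shows "(\<integral>z. indicator {y..} z * (exp (- \<beta> * z) * W q z) \<partial>lborel)
    = \<Phi> q / q / (\<beta> - \<Phi> q) * (\<integral>x. exp (- \<Phi> q * x - (\<beta> - \<Phi> q) * max x y) \<partial>\<mu>)"
proof -
  let ?\<phi> = "\<Phi> q"
  let ?k = "\<lambda>x z. ennreal (exp_kernel x z)"
  let ?h = "\<lambda>z. ennreal (indicator {y..} z * exp (- \<beta> * z))"
  have \<beta>: "\<beta> > ?\<phi>" using Phi_shift(1)[OF l] by (simp add: \<beta>_def)
  interpret L: pair_sigma_finite \<mu> lborel ..
  have "(\<integral>\<^sup>+z. ennreal (indicator {y..} z * (exp (- \<beta> * z) * W q z)) \<partial>lborel)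
     = (\<integral>\<^sup>+z. ?h z * ennreal (W q z) \<partial>lborel)"
    using q W_nonneg[of q] by (intro nn_integral_cong) (auto simp: mult.assoc simp flip: ennreal_mult'')
  also have "\<dots> = (\<integral>\<^sup>+z. ennreal (?\<phi> / q) * (\<integral>\<^sup>+x. ?h z * ?k x z \<partial>\<mu>) \<partial>lborel)"
    using W_eq by (intro nn_integral_cong_AE, eventually_elim) (simp add: nn_integral_cmult mult.left_commute)
  also have "\<dots> = ennreal (?\<phi> / q) * (\<integral>\<^sup>+z. (\<integral>\<^sup>+x. ?h z * ?k x z \<partial>\<mu>) \<partial>lborel)"
    by (rule nn_integral_cmult) measurable
  also have "(\<integral>\<^sup>+z. (\<integral>\<^sup>+x. ?h z * ?k x z \<partial>\<mu>) \<partial>lborel) = (\<integral>\<^sup>+x. (\<integral>\<^sup>+z. ?h z * ?k x z \<partial>lborel) \<partial>\<mu>)"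
    by (rule L.Fubini') measurable
  also have "\<dots> = (\<integral>\<^sup>+x. ennreal (1 / (\<beta> - ?\<phi>)) * ennreal (exp (- ?\<phi> * x - (\<beta> - ?\<phi>) * max x y)) \<partial>\<mu>)"
  proof (intro nn_integral_cong)
    fix x
    have "(\<integral>\<^sup>+z. ?h z * ?k x z \<partial>lborel)
        = (\<integral>\<^sup>+z. ennreal (exp (- ?\<phi> * x)) * ennreal (indicator {max x y..} z * exp (- (\<beta> - ?\<phi>) * z)) \<partial>lborel)"
      by (intro nn_integral_cong) (auto simp: exp_kernel_def algebra_simps simp flip: ennreal_mult' exp_add split: split_indicator)
    also have "\<dots> = ennreal (exp (- ?\<phi> * x)) * ennreal (exp (- (\<beta> - ?\<phi>) * max x y) / (\<beta> - ?\<phi>))"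
      using nn_integral_exp_atLeast[of "\<beta> - ?\<phi>" "max x y"] \<beta> by (subst nn_integral_cmult) auto
    also have "\<dots> = ennreal (1 / (\<beta> - ?\<phi>)) * ennreal (exp (- ?\<phi> * x - (\<beta> - ?\<phi>) * max x y))"
    proof -
      have "exp (- ?\<phi> * x) * exp (- (\<beta> - ?\<phi>) * max x y) = exp (- ?\<phi> * x - (\<beta> - ?\<phi>) * max x y)"
        unfolding exp_add[symmetric] by (simp only: mult_minus_left add_uminus_conv_diff)
      then show ?thesis using \<beta> by (simp flip: ennreal_mult')
    qed
    finally show "(\<integral>\<^sup>+z. ?h z * ?k x z \<partial>lborel) = ennreal (1 / (\<beta> - ?\<phi>)) * ennreal (exp (- ?\<phi> * x - (\<beta> - ?\<phi>) * max x y))" .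
  qed
  also have "\<dots> = ennreal (1 / (\<beta> - ?\<phi>)) * (\<integral>\<^sup>+x. ennreal (exp (- ?\<phi> * x - (\<beta> - ?\<phi>) * max x y)) \<partial>\<mu>)"
    by (rule nn_integral_cmult) measurable
  also have "(\<integral>\<^sup>+x. ennreal (exp (- ?\<phi> * x - (\<beta> - ?\<phi>) * max x y)) \<partial>\<mu>) = ennreal (\<integral>x. exp (- ?\<phi> * x - (\<beta> - ?\<phi>) * max x y) \<partial>\<mu>)"
  proof (rule nn_integral_eq_integral)
    show "integrable \<mu> (\<lambda>x. exp (- ?\<phi> * x - (\<beta> - ?\<phi>) * max x y))"
    proof (rule mu.integrable_const_bound[where B = 1])
      show "AE x in \<mu>. norm (exp (- ?\<phi> * x - (\<beta> - ?\<phi>) * max x y)) \<le> 1"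
        using mu_nonneg
      proof eventually_elim
        case (elim x)
        have "0 \<le> ?\<phi> * x" "0 \<le> (\<beta> - ?\<phi>) * max x y" using elim phi_pos \<beta> by auto
        then show ?case by simp
      qed
    qed measurable
  qed simp
  finally have nn: "(\<integral>\<^sup>+z. ennreal (indicator {y..} z * (exp (- \<beta> * z) * W q z)) \<partial>lborel)
     = ennreal (?\<phi> / q) * (ennreal (1 / (\<beta> - ?\<phi>)) * ennreal (\<integral>x. exp (- ?\<phi> * x - (\<beta> - ?\<phi>) * max x y) \<partial>\<mu>))" .
  have "(\<integral>z. indicator {y..} z * (exp (- \<beta> * z) * W q z) \<partial>lborel)
    = enn2real (\<integral>\<^sup>+z. ennreal (indicator {y..} z * (exp (- \<beta> * z) * W q z)) \<partial>lborel)"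
    using q W_nonneg[of q] by (intro integral_eq_nn_integral) auto
  also have "\<dots> = ?\<phi> / q / (\<beta> - ?\<phi>) * (\<integral>x. exp (- ?\<phi> * x - (\<beta> - ?\<phi>) * max x y) \<partial>\<mu>)"
    unfolding nn using \<beta> phi_pos q by (simp add: enn2real_mult)
  finally show ?thesis .
qed

text \<open>With \<open>\<beta> = \<Phi> (q + l)\<close>, the factor
  \<open>q - \<psi> \<beta>\<close> is \<open>- l\<close> and the full transform of
  \<open>W q\<close> at \<open>\<beta>\<close> is \<open>1 / l\<close>, so \<open>Z_fun\<close> is
  \<open>l * exp (\<beta> * y)\<close> times the tail integral of \<open>W_tail\<close>. Of the
  mixture over \<open>\<mu>\<close>, the part with \<open>x\<close> at most \<open>y\<close>
  reproduces \<open>W q y\<close> and cancels the subtracted term of \<open>H_fun\<close>; the part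
  beyond \<open>y\<close> remains.\<close>

lemma H_eq:
  assumes l: "l > 0"
  shows "AE y in lborel. y \<ge> 0 \<longrightarrow> (\<Phi> (q + l) - \<Phi> q) * H_fun \<psi> W q l y = H_mixture l y"
  using W_eq
proof eventually_elim
  case (elim y)
  let ?\<phi> = "\<Phi> q" and ?\<beta> = "\<Phi> (q + l)"
  have \<beta>: "?\<phi> < ?\<beta>" "\<psi> ?\<beta> = q + l" using Phi_shift[OF l] .
  show ?case
  proof
    assume y: "y \<ge> 0"
    let ?w = "\<lambda>z. exp (- ?\<beta> * z) * W q z"
    have int: "integrable lborel ?w" "integral\<^sup>L lborel ?w = 1 / l"
      using W_laplace[of q ?\<beta>] q \<beta> by auto
    have "(LBINT z=0..y. ?w z) = (LBINT z:{0<..<y}. ?w z)"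
      using interval_integral_Ioo[of 0 y ?w] y by (simp add: zero_ereal_def)
    also have "\<dots> = (\<integral>z. indicator {0<..<y} z * ?w z \<partial>lborel)"
      by (simp add: set_lebesgue_integral_def)
    finally have I: "(LBINT z=0..y. ?w z) = (\<integral>z. indicator {0<..<y} z * ?w z \<partial>lborel)" .
    have ints: "integrable lborel (\<lambda>z. indicator {0<..<y} z * ?w z)" "integrable lborel (\<lambda>z. indicator {y..} z * ?w z)"
      by (rule Bochner_Integration.integrable_bound[OF int(1)]; auto simp: indicator_def)+
    have "1 / l = (\<integral>z. indicator {0<..<y} z * ?w z + indicator {y..} z * ?w z \<partial>lborel)"
      unfolding int(2)[symmetric]
    proof (rule integral_cong_AE)
      show "AE z in lborel. ?w z = indicator {0<..<y} z * ?w z + indicator {y..} z * ?w z"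
        using AE_lborel_singleton[of 0]
      proof eventually_elim
        case (elim z)
        then show ?case using W_neg[of q z] q y by (cases "z < 0") (auto simp: indicator_def)
      qed
    qed measurable
    also have "\<dots> = (LBINT z=0..y. ?w z) + (\<integral>z. indicator {y..} z * ?w z \<partial>lborel)"
      unfolding I using ints by (rule Bochner_Integration.integral_add)
    finally have split: "1 / l = (LBINT z=0..y. ?w z) + (\<integral>z. indicator {y..} z * ?w z \<partial>lborel)" .
    have Z: "Z_fun \<psi> W q y ?\<beta> = exp (?\<beta> * y) * (l * (\<integral>z. indicator {y..} z * ?w z \<partial>lborel))"
    proof -
      have "1 = l * ((LBINT z=0..y. ?w z) + (\<integral>z. indicator {y..} z * ?w z \<partial>lborel))"
        unfolding split[symmetric] using l by simp
      then have "1 + (q - (q + l)) * (LBINT z=0..y. ?w z) = l * (\<integral>z. indicator {y..} z * ?w z \<partial>lborel)"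
        by (simp only: distrib_left) simp
      then show ?thesis unfolding Z_fun_def \<beta>(2) by (simp only:)
    qed
    define A where "A = (\<integral>x. indicator {..y} x * exp (?\<phi> * (y - x)) \<partial>\<mu>)"
    define B where "B = (\<integral>x. indicator {y<..} x * exp (- ?\<beta> * (x - y)) \<partial>\<mu>)"
    have intA: "integrable \<mu> (\<lambda>x. indicator {..y} x * exp (?\<phi> * (y - x)))"
    proof (rule mu.integrable_const_bound[where B = "exp (?\<phi> * y)"])
      show "AE x in \<mu>. norm (indicator {..y} x * exp (?\<phi> * (y - x))) \<le> exp (?\<phi> * y)"
        using mu_nonneg by eventually_elim (use phi_pos in \<open>auto simp: indicator_def\<close>)
    qed measurable
    have intB: "integrable \<mu> (\<lambda>x. indicator {y<..} x * exp (- ?\<beta> * (x - y)))"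
      by (rule mu.integrable_const_bound[where B = 1]) (use \<beta> phi_pos in \<open>auto simp: indicator_def\<close>)
    \<comment> \<open>According to whether \<open>x\<close> is at most \<open>y\<close> or beyond
      it, \<open>max x y\<close> is \<open>y\<close> or \<open>x\<close>, and the exponent becomes
      \<open>?\<phi> * (y - x)\<close> or \<open>- ?\<beta> * (x - y)\<close>.\<close>
    have "exp (?\<beta> * y) * (\<integral>x. exp (- ?\<phi> * x - (?\<beta> - ?\<phi>) * max x y) \<partial>\<mu>)
       = (\<integral>x. indicator {..y} x * exp (?\<phi> * (y - x)) + indicator {y<..} x * exp (- ?\<beta> * (x - y)) \<partial>\<mu>)"
      by (subst integral_mult_right_zero[symmetric], intro Bochner_Integration.integral_cong)
        (auto simp: indicator_def max_def algebra_simps simp flip: exp_add)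
    also have "\<dots> = A + B" unfolding A_def B_def using intA intB by (rule Bochner_Integration.integral_add)
    finally have AB: "exp (?\<beta> * y) * (\<integral>x. exp (- ?\<phi> * x - (?\<beta> - ?\<phi>) * max x y) \<partial>\<mu>) = A + B" .
    have "ennreal (W q y) = ennreal (?\<phi> / q) * (\<integral>\<^sup>+x. ennreal (indicator {..y} x * exp (?\<phi> * (y - x))) \<partial>\<mu>)"
      unfolding elim by (intro arg_cong2[where f = times] nn_integral_cong refl) (auto simp: exp_kernel_def indicator_def)
    also have "(\<integral>\<^sup>+x. ennreal (indicator {..y} x * exp (?\<phi> * (y - x))) \<partial>\<mu>) = ennreal A"
      unfolding A_def by (rule nn_integral_eq_integral[OF intA]) auto
    also have "ennreal (?\<phi> / q) * ennreal A = ennreal (?\<phi> / q * A)"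
      using phi_pos q by (simp flip: ennreal_mult')
    finally have "ennreal (W q y) = ennreal (?\<phi> / q * A)" .
    moreover have "A \<ge> 0" unfolding A_def by (intro integral_nonneg_AE) auto
    ultimately have W: "W q y = ?\<phi> / q * A"
      using W_nonneg[of q y] q phi_pos by simp
    define \<delta> where "\<delta> = ?\<beta> - ?\<phi>"
    have \<delta>: "\<delta> \<noteq> 0" using \<beta> by (simp add: \<delta>_def)
    have "\<delta> * Z_fun \<psi> W q y ?\<beta> = l * ?\<phi> / q * (A + B)"
      unfolding Z W_tail[OF l y] AB[symmetric] \<delta>_def[symmetric] using \<delta> by simp
    then have "\<delta> * H_fun \<psi> W q l y = l * ?\<phi> / q * (A + B) - l * W q y"
      unfolding H_fun_def \<delta>_def[symmetric] using \<delta> by (simp add: right_diff_distrib)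
    also have "\<dots> = ?\<phi> / q * l * B" unfolding W by (simp add: algebra_simps add_divide_distrib)
    finally show "(?\<beta> - ?\<phi>) * H_fun \<psi> W q l y = H_mixture l y" by (simp add: H_mixture_def B_def \<delta>_def)
  qed
qed

end

section \<open>The first family as a mixture, and its limit\<close>

context limit_law
begin

interpretation mu: real_distribution \<mu> by (rule mu_distr)

definition "\<nu> l = distr (\<mu> \<Otimes>\<^sub>M exp_law) borel (\<lambda>(x, s). max 0 (x - s / \<Phi> (q + l)))"

lemma prob_space_mu_exp_law: "prob_space (\<mu> \<Otimes>\<^sub>M exp_law)"
proof -
  interpret exp_law: prob_space exp_law by (rule exp_law)
  interpret pair: pair_prob_space \<mu> exp_law ..
  show ?thesis by (rule pair.P.prob_space_axioms)
qed

lemma nu_distribution: "real_distribution (\<nu> l)"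
  unfolding \<nu>_def by (intro prob_space.real_distribution_distr prob_space_mu_exp_law) measurable

text \<open>Given \<open>x\<close> drawn from \<open>\<mu>\<close>, truncation at \<open>0\<close>
  has probability \<open>exp (- \<beta> * x)\<close>, and its mean is the atom, given by the
  transform at \<open>\<beta>\<close>. Otherwise \<open>y = x - s / \<beta>\<close> has density
  \<open>\<beta> * exp (- \<beta> * (x - y))\<close> between \<open>0\<close> and \<open>x\<close>;
  mixing over \<open>x\<close> produces \<open>H_mixture\<close>.\<close>

lemma emeasure_nu:
  assumes l: "l > 0" and A: "A \<in> sets borel"
  defines "\<beta> \<equiv> \<Phi> (q + l)"
  shows "emeasure (\<nu> l) A = ennreal (q / \<Phi> q * ((\<beta> - \<Phi> q) / l)) * indicator A 0
     + ennreal (\<beta> * q / (\<Phi> q * l)) * (\<integral>\<^sup>+y\<in>A. ennreal (indicator {0<..} y * H_mixture l y) \<partial>lborel)"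
proof -
  note [measurable] = A
  interpret exp_law: prob_space exp_law by (rule exp_law)
  interpret L: pair_sigma_finite \<mu> lborel ..
  have \<beta>: "\<beta> > 0" "\<beta> > \<Phi> q" "\<psi> \<beta> = q + l"
    using Phi_shift[OF l] phi_pos by (auto simp: \<beta>_def)
  define E where "E x y = (if y < x then exp (- \<beta> * (x - y)) else 0)" for x y
  have E_nonneg: "0 \<le> E x y" for x y by (simp add: E_def)
  have E_measurable [measurable (raw)]: "(\<lambda>z. E (u z) (v z)) \<in> borel_measurable N"
    if [measurable]: "u \<in> borel_measurable N" "v \<in> borel_measurable N" for u v and N :: "'x measure"
    unfolding E_def by measurable
  have inner: "(\<integral>\<^sup>+s. indicator A (max 0 (x - s / \<beta>)) \<partial>exp_law)
      = indicator A 0 * ennreal (exp (- \<beta> * x)) + (\<integral>\<^sup>+y. ennreal \<beta> * (ennreal (E x y) * indicator ({0<..} \<inter> A) y) \<partial>lborel)"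
    if x: "x \<ge> 0" for x
  proof -
    have "(\<integral>\<^sup>+s. indicator A (max 0 (x - s / \<beta>)) \<partial>exp_law)
        = (\<integral>\<^sup>+s. ennreal (exponential_density 1 s) * indicator A (max 0 (x - s / \<beta>)) \<partial>lborel)"
      unfolding exp_law_def by (subst nn_integral_density) auto
    \<comment> \<open>The substitution \<open>s = \<beta> * (x - y)\<close>, so that
      \<open>y\<close> is the value before truncation.\<close>
    also have "\<dots> = ennreal \<beta> * (\<integral>\<^sup>+y. ennreal (exponential_density 1 (\<beta> * x + - \<beta> * y)) * indicator A (max 0 (x - (\<beta> * x + - \<beta> * y) / \<beta>)) \<partial>lborel)"
      using \<beta> by (subst nn_integral_real_affine[of _ "- \<beta>" "\<beta> * x"]) auto
    also have "(\<integral>\<^sup>+y. ennreal (exponential_density 1 (\<beta> * x + - \<beta> * y)) * indicator A (max 0 (x - (\<beta> * x + - \<beta> * y) / \<beta>)) \<partial>lborel)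
        = (\<integral>\<^sup>+y. indicator A 0 * (ennreal (exp (- \<beta> * x)) * ennreal (indicator {..0} y * exp (\<beta> * y))) + ennreal (E x y) * indicator ({0<..} \<inter> A) y \<partial>lborel)"
      \<comment> \<open>At \<open>y = x\<close> the exponential density is one while
        \<open>E x y\<close> is zero; this point is discarded.\<close>
      using AE_lborel_singleton[of x]
    proof (intro nn_integral_cong_AE, eventually_elim)
      case (elim y)
      have "x - (\<beta> * x + - \<beta> * y) / \<beta> = y" using \<beta> by (simp add: field_simps)
      moreover have "\<beta> * x + - \<beta> * y < 0 \<longleftrightarrow> x < y" using \<beta> by simp
      moreover have "- (\<beta> * x + - \<beta> * y) = - \<beta> * x + \<beta> * y" by simp
      moreover have "- \<beta> * (x - y) = - \<beta> * x + \<beta> * y" by (simp add: algebra_simps)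
      moreover have "exp (\<beta> * y - \<beta> * x) = exp (- (\<beta> * x)) * exp (\<beta> * y)" by (simp flip: exp_add)
      ultimately show ?case
        using elim x by (cases "y \<le> 0"; cases "y < x")
          (auto simp: exponential_density_def E_def indicator_def max_def exp_add simp flip: ennreal_mult')
    qed
    also have "\<dots> = indicator A 0 * (ennreal (exp (- \<beta> * x)) * (\<integral>\<^sup>+y. ennreal (indicator {..0} y * exp (\<beta> * y)) \<partial>lborel)) + (\<integral>\<^sup>+y. ennreal (E x y) * indicator ({0<..} \<inter> A) y \<partial>lborel)"
      by (subst nn_integral_add) (auto simp: nn_integral_cmult)
    also have "ennreal \<beta> * \<dots> = indicator A 0 * (ennreal (exp (- \<beta> * x)) * (ennreal \<beta> * (\<integral>\<^sup>+y. ennreal (indicator {..0} y * exp (\<beta> * y)) \<partial>lborel))) + ennreal \<beta> * (\<integral>\<^sup>+y. ennreal (E x y) * indicator ({0<..} \<inter> A) y \<partial>lborel)"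
      by (simp add: distrib_left mult_ac)
    also have "ennreal \<beta> * (\<integral>\<^sup>+y. ennreal (indicator {..0} y * exp (\<beta> * y)) \<partial>lborel) = 1"
      unfolding nn_integral_exp_Iic[OF \<beta>(1)] using \<beta> by (simp flip: ennreal_mult')
    finally show ?thesis by (simp add: nn_integral_cmult)
  qed
  have "emeasure (\<nu> l) A = (\<integral>\<^sup>+z. indicator A (case z of (x, s) \<Rightarrow> max 0 (x - s / \<beta>)) \<partial>(\<mu> \<Otimes>\<^sub>M exp_law))"
    unfolding \<nu>_def \<beta>_def using A by (subst nn_integral_indicator[symmetric], simp, subst nn_integral_distr) auto
  also have "\<dots> = (\<integral>\<^sup>+x. \<integral>\<^sup>+s. indicator A (max 0 (x - s / \<beta>)) \<partial>exp_law \<partial>\<mu>)"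
    by (subst exp_law.nn_integral_fst[symmetric]) auto
  also have "\<dots> = (\<integral>\<^sup>+x. indicator A 0 * ennreal (exp (- \<beta> * x)) + (\<integral>\<^sup>+y. ennreal \<beta> * (ennreal (E x y) * indicator ({0<..} \<inter> A) y) \<partial>lborel) \<partial>\<mu>)"
    using mu_nonneg by (intro nn_integral_cong_AE, eventually_elim) (rule inner)
  also have "\<dots> = indicator A 0 * (\<integral>\<^sup>+x. ennreal (exp (- \<beta> * x)) \<partial>\<mu>) + (\<integral>\<^sup>+x. \<integral>\<^sup>+y. ennreal \<beta> * (ennreal (E x y) * indicator ({0<..} \<inter> A) y) \<partial>lborel \<partial>\<mu>)"
    by (subst nn_integral_add) (auto simp: nn_integral_cmult)
  also have "(\<integral>\<^sup>+x. ennreal (exp (- \<beta> * x)) \<partial>\<mu>) = ennreal (q / \<Phi> q * ((\<beta> - \<Phi> q) / l))"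
    unfolding mu_laplace_nn[OF \<beta>(2)] by (simp add: \<beta>)
  also have "(\<integral>\<^sup>+x. \<integral>\<^sup>+y. ennreal \<beta> * (ennreal (E x y) * indicator ({0<..} \<inter> A) y) \<partial>lborel \<partial>\<mu>)
      = (\<integral>\<^sup>+y. \<integral>\<^sup>+x. ennreal \<beta> * (ennreal (E x y) * indicator ({0<..} \<inter> A) y) \<partial>\<mu> \<partial>lborel)"
    by (rule L.Fubini'[symmetric]) measurable
  also have "\<dots> = (\<integral>\<^sup>+y. ennreal (\<beta> * q / (\<Phi> q * l)) * (ennreal (indicator {0<..} y * H_mixture l y) * indicator A y) \<partial>lborel)"
  proof (intro nn_integral_cong)
    fix y
    have int: "integrable \<mu> (\<lambda>x. E x y)"
      by (rule mu.integrable_const_bound[where B = 1]) (use \<beta> in \<open>auto simp: E_def\<close>)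
    have DE: "H_mixture l y = \<Phi> q / q * l * (\<integral>x. E x y \<partial>\<mu>)"
      unfolding H_mixture_def \<beta>_def[symmetric]
      by (intro arg_cong2[where f = times] Bochner_Integration.integral_cong refl) (auto simp: E_def indicator_def)
    have I: "(\<integral>x. E x y \<partial>\<mu>) \<ge> 0" using E_nonneg by simp
    have "(\<integral>\<^sup>+x. ennreal \<beta> * (ennreal (E x y) * indicator ({0<..} \<inter> A) y) \<partial>\<mu>)
        = ennreal \<beta> * (ennreal (\<integral>x. E x y \<partial>\<mu>) * indicator ({0<..} \<inter> A) y)"
      using int E_nonneg by (simp add: nn_integral_cmult nn_integral_multc nn_integral_eq_integral)
    also have "ennreal \<beta> * ennreal (\<integral>x. E x y \<partial>\<mu>) = ennreal (\<beta> * q / (\<Phi> q * l)) * ennreal (H_mixture l y)"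
      unfolding DE using \<beta> l phi_pos q I by (subst (1 2) ennreal_mult'[symmetric]) auto
    then have "ennreal \<beta> * (ennreal (\<integral>x. E x y \<partial>\<mu>) * indicator ({0<..} \<inter> A) y)
        = ennreal (\<beta> * q / (\<Phi> q * l)) * (ennreal (indicator {0<..} y * H_mixture l y) * indicator A y)"
      by (auto simp: mult.assoc[symmetric] indicator_def)
    finally show "(\<integral>\<^sup>+x. ennreal \<beta> * (ennreal (E x y) * indicator ({0<..} \<inter> A) y) \<partial>\<mu>)
      = ennreal (\<beta> * q / (\<Phi> q * l)) * (ennreal (indicator {0<..} y * H_mixture l y) * indicator A y)" .
  qed
  also have "\<dots> = ennreal (\<beta> * q / (\<Phi> q * l)) * (\<integral>\<^sup>+y\<in>A. ennreal (indicator {0<..} y * H_mixture l y) \<partial>lborel)"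
  proof (rule nn_integral_cmult)
    have "H_mixture l = (\<lambda>y. \<Phi> q / q * l * (\<integral>x. E x y \<partial>\<mu>))"
      unfolding H_mixture_def \<beta>_def[symmetric]
      by (intro ext arg_cong2[where f = times] Bochner_Integration.integral_cong refl) (auto simp: E_def indicator_def)
    then have [measurable]: "H_mixture l \<in> borel_measurable borel" by simp
    show "(\<lambda>y. ennreal (indicator {0<..} y * H_mixture l y) * indicator A y) \<in> borel_measurable lborel" by measurable
  qed
  finally show ?thesis by (simp add: mult.commute)
qed

text \<open>For nonnegative \<open>y\<close> the variable endpoint of the interval integral is moved
  into the integrand, which makes it a parametrised Lebesgue integral, measurable in
  \<open>y\<close>.\<close>

lemma H_measurable [measurable]:
  "(\<lambda>y. indicator {0..} y * H_fun \<psi> W q l y) \<in> borel_measurable borel"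
proof -
  let ?\<beta> = "\<Phi> (q + l)"
  let ?w = "\<lambda>z. exp (- ?\<beta> * z) * W q z"
  let ?J = "\<lambda>y. \<integral>z. (if 0 < z \<and> z < y then ?w z else 0) \<partial>lborel"
  have "(\<lambda>y. indicator {0..} y * H_fun \<psi> W q l y)
    = (\<lambda>y. indicator {0..} y * (exp (?\<beta> * y) * (1 + (q - \<psi> ?\<beta>) * ?J y) - l / (?\<beta> - \<Phi> q) * W q y))"
  proof
    fix y
    show "indicator {0..} y * H_fun \<psi> W q l y
      = indicator {0..} y * (exp (?\<beta> * y) * (1 + (q - \<psi> ?\<beta>) * ?J y) - l / (?\<beta> - \<Phi> q) * W q y)"
    proof (cases "y \<ge> 0")
      case True
      then have "(LBINT z=0..y. ?w z) = (LBINT z:{0<..<y}. ?w z)"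
        using interval_integral_Ioo[of 0 y ?w] by (simp add: zero_ereal_def)
      also have "\<dots> = ?J y"
        unfolding set_lebesgue_integral_def
        by (intro Bochner_Integration.integral_cong) (auto simp: indicator_def)
      finally show ?thesis unfolding H_fun_def Z_fun_def by simp
    qed (simp add: indicator_def)
  qed
  then show ?thesis by simp
qed

text \<open>By \<open>H_eq\<close> the densities agree up to the matching constant. The coefficient
  of the point mass splits into the weight \<open>q / (l + q)\<close> and \<open>l / (l + q)\<close>
  times the atom of \<open>\<nu> l\<close>, because
  \<open>\<beta> = \<Phi> q + (\<beta> - \<Phi> q)\<close> for
  \<open>\<beta> = \<Phi> (q + l)\<close>.\<close>

lemma emeasure_mu1:
  assumes l: "l > 0" and A: "A \<in> sets borel"
  shows "emeasure (mu1 \<psi> W q l) A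
     = ennreal (q / (l + q)) * indicator A 0 + ennreal (l / (l + q)) * emeasure (\<nu> l) A"
proof -
  note [measurable] = A
  let ?\<phi> = "\<Phi> q" and ?\<beta> = "\<Phi> (q + l)"
  have \<beta>: "?\<beta> > ?\<phi>" using Phi_shift[OF l] by auto
  let ?I = "\<integral>\<^sup>+y\<in>A. ennreal (indicator {0<..} y * H_mixture l y) \<partial>lborel"
  have "emeasure (density lborel (\<lambda>y. ennreal (indicator {0<..} y * ((?\<beta> - ?\<phi>) * H_fun \<psi> W q l y)))) A
      = (\<integral>\<^sup>+y\<in>A. ennreal (indicator {0<..} y * ((?\<beta> - ?\<phi>) * H_fun \<psi> W q l y)) \<partial>lborel)"
  proof (rule emeasure_density)
    have "(\<lambda>y. indicator {0<..} y * ((?\<beta> - ?\<phi>) * (indicator {0..} y * H_fun \<psi> W q l y))) \<in> borel_measurable borel"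
      by measurable
    also have "(\<lambda>y. indicator {0<..} y * ((?\<beta> - ?\<phi>) * (indicator {0..} y * H_fun \<psi> W q l y)))
       = (\<lambda>y. indicator {0<..} y * ((?\<beta> - ?\<phi>) * H_fun \<psi> W q l y))"
      by (auto simp: indicator_def)
    finally show "(\<lambda>y. ennreal (indicator {0<..} y * ((?\<beta> - ?\<phi>) * H_fun \<psi> W q l y))) \<in> borel_measurable lborel"
      by simp
  qed simp
  also have "\<dots> = ?I"
    using H_eq[OF l] by (intro nn_integral_cong_AE, eventually_elim) (auto simp: indicator_def)
  finally have "emeasure (mu1 \<psi> W q l) A = ennreal (q * ?\<beta> / ((l + q) * ?\<phi>)) * (indicator A 0 + ?I)"
    unfolding mu1_def Let_def using A by (simp add: emeasure_add_measure)
  also have "\<dots> = ennreal (q * ?\<beta> / ((l + q) * ?\<phi>)) * indicator A 0 + ennreal (q * ?\<beta> / ((l + q) * ?\<phi>)) * ?I"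
    by (rule distrib_left)
  also have "ennreal (q * ?\<beta> / ((l + q) * ?\<phi>)) * indicator A 0
      = ennreal (q / (l + q)) * indicator A 0 + ennreal (l / (l + q)) * (ennreal (q / ?\<phi> * ((?\<beta> - ?\<phi>) / l)) * indicator A 0)"
  proof -
    have "q * ?\<beta> / ((l + q) * ?\<phi>) = q / (l + q) + l / (l + q) * (q / ?\<phi> * ((?\<beta> - ?\<phi>) / l))"
    proof -
      have "l / (l + q) * (q / ?\<phi> * ((?\<beta> - ?\<phi>) / l)) = q * (?\<beta> - ?\<phi>) / ((l + q) * ?\<phi>)"
        using l by simp
      moreover have "q / (l + q) = q * ?\<phi> / ((l + q) * ?\<phi>)" using phi_pos by simp
      moreover have "q * ?\<beta> = q * ?\<phi> + q * (?\<beta> - ?\<phi>)" by (simp add: algebra_simps)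
      ultimately show ?thesis by (simp only: add_divide_distrib)
    qed
    also have "ennreal \<dots> = ennreal (q / (l + q)) + ennreal (l / (l + q) * (q / ?\<phi> * ((?\<beta> - ?\<phi>) / l)))"
      using l q phi_pos \<beta> by (intro ennreal_plus) auto
    also have "ennreal (l / (l + q) * (q / ?\<phi> * ((?\<beta> - ?\<phi>) / l))) = ennreal (l / (l + q)) * ennreal (q / ?\<phi> * ((?\<beta> - ?\<phi>) / l))"
      using l q by (intro ennreal_mult') auto
    finally show ?thesis by (simp only: distrib_right mult.assoc)
  qed
  also have "ennreal (q * ?\<beta> / ((l + q) * ?\<phi>)) = ennreal (l / (l + q)) * ennreal (?\<beta> * q / (?\<phi> * l))"
    using l q by (subst ennreal_mult'[symmetric]) (auto simp: mult_ac)
  finally show ?thesis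
    unfolding emeasure_nu[OF l A] by (simp only: distrib_left mult.assoc add.assoc)
qed

lemma sets_mu1 [simp, measurable_cong]: "sets (mu1 \<psi> W q l) = sets borel"
  by (simp add: mu1_def Let_def)

lemma mu1_distribution:
  assumes l: "l > 0"
  shows "real_distribution (mu1 \<psi> W q l)" and "AE y in mu1 \<psi> W q l. 0 \<le> y"
proof -
  interpret nu: real_distribution "\<nu> l" by (rule nu_distribution)
  have space: "space (mu1 \<psi> W q l) = UNIV"
    using sets_eq_imp_space_eq[OF sets_mu1] by simp
  have "ennreal (q / (l + q)) + ennreal (l / (l + q)) = 1"
    using l q by (subst ennreal_plus[symmetric]) (auto simp: add_divide_distrib[symmetric] add.commute)
  then have "emeasure (mu1 \<psi> W q l) (space (mu1 \<psi> W q l)) = 1"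
    using emeasure_mu1[OF l, of UNIV] nu.emeasure_space_1 unfolding space by simp
  then have "prob_space (mu1 \<psi> W q l)" by (rule prob_spaceI)
  then show "real_distribution (mu1 \<psi> W q l)"
    unfolding real_distribution_def real_distribution_axioms_def by simp
  have "emeasure (\<nu> l) {..<0} = 0"
  proof -
    have "(\<lambda>(x, s). max 0 (x - s / \<Phi> (q + l))) -` {..<0} \<inter> space (\<mu> \<Otimes>\<^sub>M exp_law) = {}"
      by auto
    then show ?thesis unfolding \<nu>_def by (subst emeasure_distr) simp_all
  qed
  then have "emeasure (mu1 \<psi> W q l) {..<0} = 0"
    using emeasure_mu1[OF l, of "{..<0}"] by simp
  then show "AE y in mu1 \<psi> W q l. 0 \<le> y"
    by (intro AE_I[of _ _ "{..<0}"]) auto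
qed

lemma cdf_mu1:
  assumes l: "l > 0"
  shows "cdf (mu1 \<psi> W q l) x = q / (l + q) * indicator {..x} 0 + l / (l + q) * cdf (\<nu> l) x"
proof -
  interpret mu1: real_distribution "mu1 \<psi> W q l" by (rule mu1_distribution[OF l])
  interpret nu: real_distribution "\<nu> l" by (rule nu_distribution)
  have "ennreal (cdf (mu1 \<psi> W q l) x) = ennreal (q / (l + q)) * indicator {..x} 0 + ennreal (l / (l + q)) * ennreal (cdf (\<nu> l) x)"
    using emeasure_mu1[OF l, of "{..x}"] by (simp add: cdf_def mu1.emeasure_eq_measure nu.emeasure_eq_measure)
  also have "ennreal (q / (l + q)) * indicator {..x} 0 = ennreal (q / (l + q) * indicator {..x} 0)"
    by (simp add: indicator_def)
  also have "ennreal (l / (l + q)) * ennreal (cdf (\<nu> l) x) = ennreal (l / (l + q) * cdf (\<nu> l) x)"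
    by (rule ennreal_mult'[symmetric]) (use l q in simp)
  also have "ennreal (q / (l + q) * indicator {..x} 0) + \<dots> = ennreal (q / (l + q) * indicator {..x} 0 + l / (l + q) * cdf (\<nu> l) x)"
    by (rule ennreal_plus[symmetric]) (use l q nu.cdf_nonneg in auto)
  finally have "ennreal (cdf (mu1 \<psi> W q l) x) = ennreal (q / (l + q) * indicator {..x} 0 + l / (l + q) * cdf (\<nu> l) x)" .
  moreover have "0 \<le> q / (l + q) * indicator {..x} 0 + l / (l + q) * cdf (\<nu> l) x"
    using l q nu.cdf_nonneg[of x] by (intro add_nonneg_nonneg mult_nonneg_nonneg) auto
  ultimately show ?thesis using mu1.cdf_nonneg[of x] ennreal_inj by blast
qed

lemma Phi_tendsto:
  assumes "filterlim l at_top sequentially"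
  shows "filterlim (\<lambda>n. \<Phi> (q + l n)) at_top sequentially"
  by (rule filterlim_compose[OF Phi_at_top], rule filterlim_tendsto_add_at_top[OF tendsto_const assms])

text \<open>Almost surely \<open>s / \<Phi> (q + l n)\<close> vanishes in the limit, and
  \<open>max 0 x = x\<close> because \<open>\<mu>\<close> is concentrated on the half line.\<close>

lemma nu_tendsto:
  assumes "\<And>n. l n > 0" "filterlim l at_top sequentially"
  shows "weak_conv_m (\<lambda>n. \<nu> (l n)) \<mu>"
proof -
  interpret exp_law: prob_space exp_law by (rule exp_law)
  have "weak_conv_m (\<lambda>n. distr (\<mu> \<Otimes>\<^sub>M exp_law) borel (\<lambda>(x, s). max 0 (x - s / \<Phi> (q + l n)))) (distr (\<mu> \<Otimes>\<^sub>M exp_law) borel fst)"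
  proof (rule weak_conv_m_distr_AE[OF prob_space_mu_exp_law])
    show "AE z in \<mu> \<Otimes>\<^sub>M exp_law. (\<lambda>n. case z of (x, s) \<Rightarrow> max 0 (x - s / \<Phi> (q + l n))) \<longlonglongrightarrow> fst z"
      using AE_pair_fst[OF exp_law.sigma_finite_measure_axioms mu_nonneg]
    proof eventually_elim
      case (elim z)
      obtain x s where z: "z = (x, s)" by (cases z)
      have "(\<lambda>n. s / \<Phi> (q + l n)) \<longlonglongrightarrow> 0"
        by (intro tendsto_divide_0[OF tendsto_const] filterlim_at_top_imp_at_infinity Phi_tendsto assms)
      then have "(\<lambda>n. max 0 (x - s / \<Phi> (q + l n))) \<longlonglongrightarrow> max 0 (x - 0)"
        by (intro tendsto_intros)
      then show ?case using elim z by simp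
    qed
  qed measurable
  moreover have "distr (\<mu> \<Otimes>\<^sub>M exp_law) borel fst = \<mu>"
  proof -
    have "distr (\<mu> \<Otimes>\<^sub>M exp_law) borel fst = distr (\<mu> \<Otimes>\<^sub>M exp_law) \<mu> fst"
      by (intro distr_cong) auto
    also have "\<dots> = \<mu>" by (rule exp_law.distr_pair_fst)
    finally show ?thesis .
  qed
  ultimately show ?thesis by (simp add: \<nu>_def)
qed

text \<open>The distribution functions converge at continuity points: the weight of the point mass
  tends to zero and that of \<open>\<nu> (l n)\<close> to one.\<close>

lemma mu1_tendsto:
  assumes l: "\<And>n. l n > 0" "filterlim l at_top sequentially"
  shows "weak_conv_m (\<lambda>n. mu1 \<psi> W q (l n)) \<mu>"
  unfolding weak_conv_m_def weak_conv_def
proof (intro allI impI)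
  fix x assume x: "isCont (cdf \<mu>) x"
  have nu: "(\<lambda>n. cdf (\<nu> (l n)) x) \<longlonglongrightarrow> cdf \<mu> x"
    using nu_tendsto[OF l] x unfolding weak_conv_m_def weak_conv_def by blast
  have 0: "(\<lambda>n. q / (l n + q)) \<longlonglongrightarrow> 0"
    by (rule tendsto_divide_0[OF tendsto_const], rule filterlim_at_top_imp_at_infinity,
        subst add.commute, rule filterlim_tendsto_add_at_top[OF tendsto_const l(2)])
  have 1: "(\<lambda>n. l n / (l n + q)) \<longlonglongrightarrow> 1 - 0"
  proof (rule Lim_transform_eventually[OF tendsto_diff[OF tendsto_const 0]])
    show "\<forall>\<^sub>F n in sequentially. 1 - q / (l n + q) = l n / (l n + q)"
      using l(1) q by (intro always_eventually allI) (metis add_diff_cancel_right' add_pos_pos diff_divide_distrib divide_self less_irrefl)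
  qed
  have "(\<lambda>n. q / (l n + q) * indicator {..x} 0 + l n / (l n + q) * cdf (\<nu> (l n)) x) \<longlonglongrightarrow> 0 * indicator {..x} 0 + (1 - 0) * cdf \<mu> x"
    by (intro tendsto_intros 0 1 nu)
  then show "(\<lambda>n. cdf (mu1 \<psi> W q (l n)) x) \<longlonglongrightarrow> cdf \<mu> x"
    using l(1) by (simp add: cdf_mu1)
qed

end

section \<open>The convolved measures\<close>

lemma char_convolution:
  assumes "real_distribution M" "real_distribution N"
  shows "char (M \<star> N) t = char M t * char N t"
proof -
  interpret M: real_distribution M by fact
  interpret N: real_distribution N by fact
  interpret P: pair_prob_space M N ..
  have "char (M \<star> N) t = (\<integral>z. iexp (t * (fst z + snd z)) \<partial>(M \<Otimes>\<^sub>M N))"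
    unfolding char_def convolution_def by (subst integral_distr) (auto simp: case_prod_beta)
  also have "\<dots> = (\<integral>x. \<integral>y. iexp (t * (x + y)) \<partial>N \<partial>M)"
    using P.integral_fst'[of "\<lambda>z. iexp (t * (fst z + snd z))"]
    by (simp add: P.P.integrable_const_bound[where B = 1])
  also have "\<dots> = (\<integral>x. iexp (t * x) * char N t \<partial>M)"
    unfolding char_def by (simp add: distrib_left exp_add)
  finally show ?thesis by (simp add: char_def)
qed

lemma distr_density_uminus:
  assumes [measurable]: "g \<in> borel_measurable borel"
  shows "distr (density lborel g) borel uminus = density lborel (\<lambda>u::real. g (- u))"
proof (rule measure_eqI)
  fix A assume "A \<in> sets (distr (density lborel g) borel uminus)"
  then have A [measurable]: "A \<in> sets borel" by simp
  have "emeasure (distr (density lborel g) borel uminus) A = (\<integral>\<^sup>+u. g u * indicator A (- u) \<partial>lborel)"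
    using A by (subst nn_integral_indicator[symmetric], simp, subst nn_integral_distr, simp, simp)
      (simp add: nn_integral_density)
  also have "\<dots> = (\<integral>\<^sup>+u\<in>A. g (- u) \<partial>lborel)"
    by (subst nn_integral_real_affine[of _ "- 1" 0]) (auto simp: one_ennreal_def[symmetric])
  finally show "emeasure (distr (density lborel g) borel uminus) A = emeasure (density lborel (\<lambda>u. g (- u))) A"
    by (simp add: emeasure_density)
qed simp

text \<open>Only the second factor has a density, since \<open>mu1\<close> has an atom at the
  origin; translation of the inner integral and Fubini give the formula.\<close>

lemma convolution_density_right:
  assumes "finite_measure M" and sets [measurable_cong]: "sets M = sets borel"
    and g [measurable]: "g \<in> borel_measurable borel" and fin: "finite_measure (density lborel g)"
  shows "M \<star> density lborel g = density lborel (\<lambda>u::real. \<integral>\<^sup>+x. g (u - x) \<partial>M)"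
proof (rule measure_eqI)
  interpret M: finite_measure M by fact
  interpret L: pair_sigma_finite M lborel ..
  fix A assume "A \<in> sets (M \<star> density lborel g)"
  then have A [measurable]: "A \<in> sets borel" by simp
  have "emeasure (M \<star> density lborel g) A = (\<integral>\<^sup>+x. \<integral>\<^sup>+v. indicator A (x + v) \<partial>density lborel g \<partial>M)"
    by (rule convolution_emeasure') (use assms in auto)
  also have "\<dots> = (\<integral>\<^sup>+x. \<integral>\<^sup>+u. g (u - x) * indicator A u \<partial>lborel \<partial>M)"
  proof (intro nn_integral_cong)
    fix x
    have "(\<integral>\<^sup>+v. indicator A (x + v) \<partial>density lborel g) = (\<integral>\<^sup>+v. g v * indicator A (x + v) \<partial>lborel)"
      by (subst nn_integral_density) auto
    also have "\<dots> = (\<integral>\<^sup>+u. g (u - x) * indicator A u \<partial>lborel)"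
      by (subst nn_integral_real_affine[of _ 1 "- x"]) (auto simp: one_ennreal_def[symmetric])
    finally show "(\<integral>\<^sup>+v. indicator A (x + v) \<partial>density lborel g) = (\<integral>\<^sup>+u. g (u - x) * indicator A u \<partial>lborel)" .
  qed
  also have "\<dots> = (\<integral>\<^sup>+u. \<integral>\<^sup>+x. g (u - x) * indicator A u \<partial>M \<partial>lborel)"
    by (rule L.Fubini'[symmetric]) measurable
  also have "\<dots> = (\<integral>\<^sup>+u\<in>A. (\<integral>\<^sup>+x. g (u - x) \<partial>M) \<partial>lborel)"
    by (simp add: nn_integral_multc)
  finally show "emeasure (M \<star> density lborel g) A = emeasure (density lborel (\<lambda>u. \<integral>\<^sup>+x. g (u - x) \<partial>M)) A"
    by (simp add: emeasure_density)
qed simp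

section \<open>The second family as a convolution, and its limit\<close>

context limit_law
begin

lemma reflected_kappa:
  assumes "p > 0"
  shows "distr (\<kappa> p) borel uminus = density lborel (\<lambda>u. ennreal (p * dual_resolvent_density \<psi> W p u))"
proof -
  note [measurable] = resolvent_density_measurable[OF less_imp_le[OF assms]]
  show ?thesis
    unfolding kappa_density[OF assms] by (subst distr_density_uminus) (auto simp: dual_resolvent_density_def)
qed

lemma reflected_kappa_distribution: "real_distribution (distr (\<kappa> p) borel uminus)"
proof -
  interpret k: real_distribution "\<kappa> p" by (rule kappa_distribution)
  show ?thesis by (rule k.real_distribution_distr) simp
qed

text \<open>The factor \<open>q + l\<close> in the density of the reflected law cancels the
  denominator in the coefficient of \<open>mu1\<close>. The convolution has an extended nonnegative
  density, whereas \<open>mu2\<close> contains a Bochner integral; they agree wherever the former is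
  finite, which is almost everywhere because its total mass is one.\<close>

lemma mu2_eq:
  assumes l: "l > 0"
  shows "mu2 \<psi> W q l = (mu1 \<psi> W q l \<star> distr (\<kappa> (q + l)) borel uminus)"
proof -
  let ?\<phi> = "\<Phi> q" and ?\<beta> = "\<Phi> (q + l)" and ?p = "q + l"
  let ?g = "dual_resolvent_density \<psi> W ?p" and ?H = "H_fun \<psi> W q l"
  have p: "?p > 0" using l q by simp
  have \<beta>: "?\<phi> < ?\<beta>" using Phi_shift[OF l] by simp
  define a where "a = q * ?\<beta> / ((l + q) * ?\<phi>)"
  have a: "a > 0" using l q phi_pos \<beta> by (simp add: a_def)
  have ap: "q * ?\<beta> / ?\<phi> = a * ?p" using p by (simp add: a_def add.commute)
  note [measurable] = resolvent_density_measurable[OF less_imp_le[OF p]]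
  have g_meas [measurable]: "?g \<in> borel_measurable borel"
    unfolding dual_resolvent_density_def by measurable
  have g_nonneg: "AE u in lborel. 0 \<le> ?g u"
    using AE_borel_affine[of "- 1" "\<lambda>u. 0 \<le> resolvent_density \<psi> W ?p u" 0] resolvent_density_nonneg[OF p]
    by (simp add: dual_resolvent_density_def)
  have g_shift: "AE y in lborel. 0 \<le> ?g (u - y)" for u
    using AE_borel_affine[of "- 1" "\<lambda>u. 0 \<le> ?g u" u] g_nonneg by simp
  have H_nonneg: "AE y in lborel. y \<ge> 0 \<longrightarrow> 0 \<le> ?H y"
    using H_eq[OF l]
  proof eventually_elim
    case (elim y)
    then show ?case using H_mixture_nonneg[OF l, of y] \<beta> by (metis diff_gt_0_iff_gt zero_le_mult_iff not_less)
  qed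
  interpret mu1: real_distribution "mu1 \<psi> W q l" by (rule mu1_distribution[OF l])
  interpret k: real_distribution "distr (\<kappa> ?p) borel uminus" by (rule reflected_kappa_distribution)
  let ?G = "\<lambda>u. ennreal (?p * ?g u)"
  let ?k = "\<lambda>u. \<integral>\<^sup>+x. ?G (u - x) \<partial>mu1 \<psi> W q l"
  have conv: "mu1 \<psi> W q l \<star> distr (\<kappa> ?p) borel uminus = density lborel ?k"
    using k.finite_measure_axioms unfolding reflected_kappa[OF p]
    by (intro convolution_density_right mu1.finite_measure_axioms) auto
  have [measurable]: "?k \<in> borel_measurable borel" by measurable
  have "real_distribution (mu1 \<psi> W q l \<star> distr (\<kappa> ?p) borel uminus)"
  proof -
    interpret pair_prob_space "mu1 \<psi> W q l" "distr (\<kappa> ?p) borel uminus" ..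
    show ?thesis unfolding convolution_def by (rule P.real_distribution_distr) measurable
  qed
  then interpret c: real_distribution "density lborel ?k" unfolding conv .
  have "(\<integral>\<^sup>+u. ?k u \<partial>lborel) = 1"
    using c.emeasure_space_1 by (simp add: emeasure_density)
  then have fin: "AE u in lborel. ?k u \<noteq> \<infinity>"
    by (intro nn_integral_noteq_infinite) auto
  define h where "h y = indicator {0..} y * ?H y" for y
  have [measurable]: "h \<in> borel_measurable borel" unfolding h_def by measurable
  have LB: "(LBINT y:{0..}. ?H y * ?g (u - y)) = (\<integral>y. h y * ?g (u - y) \<partial>lborel)" for u
    unfolding set_lebesgue_integral_def h_def
    by (intro Bochner_Integration.integral_cong) auto
  have k_eq: "?k u = ennreal a * (?G u + ennreal ((?\<beta> - ?\<phi>) * ?p) * (\<integral>\<^sup>+y. ennreal (h y * ?g (u - y)) \<partial>lborel))" for u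
  proof -
    have dens: "density lborel (\<lambda>y. ennreal (indicator {0<..} y * ((?\<beta> - ?\<phi>) * ?H y))) = density lborel (\<lambda>y. ennreal ((?\<beta> - ?\<phi>) * (indicator {0<..} y * h y)))"
      by (rule arg_cong[where f = "density lborel"]) (auto simp: fun_eq_iff h_def indicator_def)
    let ?E = "density lborel (\<lambda>y. ennreal ((?\<beta> - ?\<phi>) * (indicator {0<..} y * h y)))"
    have "(\<lambda>x. ?G (u - x)) \<in> borel_measurable borel" by measurable
    then have meas: "(\<lambda>x. ?G (u - x)) \<in> borel_measurable L" if "sets L = sets borel" for L
      unfolding measurable_cong_sets[OF that refl] .
    have "?k u = ennreal a * (\<integral>\<^sup>+x. ?G (u - x) \<partial>add_measure (return borel 0) ?E)"
      unfolding mu1_def Let_def a_def dens by (intro nn_integral_scale_measure meas) simp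
    also have "(\<integral>\<^sup>+x. ?G (u - x) \<partial>add_measure (return borel 0) ?E)
        = (\<integral>\<^sup>+x. ?G (u - x) \<partial>return borel 0) + (\<integral>\<^sup>+x. ?G (u - x) \<partial>?E)"
      by (intro nn_integral_add_measure meas) simp_all
    also have "(\<integral>\<^sup>+x. ?G (u - x) \<partial>return borel 0) = ?G u"
      by (subst nn_integral_return) auto
    also have "(\<integral>\<^sup>+y. ?G (u - y) \<partial>density lborel (\<lambda>y. ennreal ((?\<beta> - ?\<phi>) * (indicator {0<..} y * h y))))
       = (\<integral>\<^sup>+y. ennreal ((?\<beta> - ?\<phi>) * (indicator {0<..} y * h y)) * ?G (u - y) \<partial>lborel)"
      by (rule nn_integral_density) auto
    also have "\<dots> = (\<integral>\<^sup>+y. ennreal ((?\<beta> - ?\<phi>) * ?p) * ennreal (h y * ?g (u - y)) \<partial>lborel)"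
      using H_nonneg g_shift[of u] AE_lborel_singleton[of "0::real"]
    proof (intro nn_integral_cong_AE, eventually_elim)
      case (elim y)
      show ?case
      proof (cases "y > 0")
        case True
        then have "h y \<ge> 0" "indicator {0<..} y * h y = h y" using elim by (auto simp: h_def)
        then show ?thesis using elim \<beta> p
          by (subst (1 2) ennreal_mult'[symmetric]) (auto simp: mult_ac)
      next
        case False
        then show ?thesis using elim by (auto simp: h_def indicator_def)
      qed
    qed
    also have "\<dots> = ennreal ((?\<beta> - ?\<phi>) * ?p) * (\<integral>\<^sup>+y. ennreal (h y * ?g (u - y)) \<partial>lborel)"
      by (rule nn_integral_cmult) measurable
    finally show ?thesis .
  qed
  have "density lborel ?k = density lborel
    (\<lambda>u. ennreal (q * ?\<beta> / ?\<phi> * (?g u + (?\<beta> - ?\<phi>) * (LBINT y:{0..}. ?H y * ?g (u - y)))))"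
  proof (rule density_cong)
    show "(\<lambda>u. ennreal (q * ?\<beta> / ?\<phi> * (?g u + (?\<beta> - ?\<phi>) * (LBINT y:{0..}. ?H y * ?g (u - y))))) \<in> borel_measurable lborel"
      unfolding LB by measurable
    show "AE u in lborel. ?k u = ennreal (q * ?\<beta> / ?\<phi> * (?g u + (?\<beta> - ?\<phi>) * (LBINT y:{0..}. ?H y * ?g (u - y))))"
      using fin g_nonneg
    proof eventually_elim
      case (elim u)
      let ?J = "\<integral>\<^sup>+y. ennreal (h y * ?g (u - y)) \<partial>lborel" and ?I = "\<integral>y. h y * ?g (u - y) \<partial>lborel"
      have "AE y in lborel. 0 \<le> h y * ?g (u - y)"
        using H_nonneg g_shift[of u] by eventually_elim (auto simp: h_def indicator_def)
      then have I: "?I = enn2real ?J" "?I \<ge> 0"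
        by (auto intro!: integral_eq_nn_integral integral_nonneg_AE)
      \<comment> \<open>An infinite \<open>?J\<close> would give the Bochner integral its default
        value zero, so finiteness has to be settled before the two integrals are identified.\<close>
      have "?J \<noteq> \<infinity>"
      proof
        assume "?J = \<infinity>"
        then have "?k u = \<infinity>"
          unfolding k_eq using a \<beta> p by (simp add: ennreal_mult_top ennreal_top_mult)
        then show False using elim by simp
      qed
      then have J: "?J = ennreal ?I" unfolding I(1) by (simp add: less_top)
      have "?k u = ennreal a * (?G u + ennreal ((?\<beta> - ?\<phi>) * ?p * ?I))"
        unfolding k_eq J using \<beta> p by (subst ennreal_mult') auto
      also have "?G u + ennreal ((?\<beta> - ?\<phi>) * ?p * ?I) = ennreal (?p * ?g u + (?\<beta> - ?\<phi>) * ?p * ?I)"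
        by (rule ennreal_plus[symmetric]) (use elim \<beta> p I in auto)
      also have "ennreal a * \<dots> = ennreal (a * (?p * ?g u + (?\<beta> - ?\<phi>) * ?p * ?I))"
        by (rule ennreal_mult'[symmetric]) (use a in simp)
      also have "a * (?p * ?g u + (?\<beta> - ?\<phi>) * ?p * ?I) = q * ?\<beta> / ?\<phi> * (?g u + (?\<beta> - ?\<phi>) * ?I)"
        unfolding ap by (simp add: algebra_simps)
      finally show ?case unfolding LB .
    qed
  qed measurable
  then show ?thesis unfolding conv mu2_def Let_def by simp
qed

lemma mu2_distribution:
  assumes l: "l > 0"
  shows "real_distribution (mu2 \<psi> W q l)"
proof -
  interpret mu1: real_distribution "mu1 \<psi> W q l" by (rule mu1_distribution[OF l])
  interpret k: real_distribution "distr (\<kappa> (q + l)) borel uminus" by (rule reflected_kappa_distribution)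
  interpret pair_prob_space "mu1 \<psi> W q l" "distr (\<kappa> (q + l)) borel uminus" ..
  show ?thesis unfolding mu2_eq[OF l] convolution_def by (rule P.real_distribution_distr) measurable
qed

text \<open>Characteristic functions turn the convolution into a product whose factors converge to
  that of \<open>\<mu>\<close> and to one; the continuity theorem returns to weak
  convergence.\<close>

lemma mu2_tendsto:
  assumes l: "\<And>n. l n > 0" "filterlim l at_top sequentially"
  shows "weak_conv_m (\<lambda>n. mu2 \<psi> W q (l n)) \<mu>"
proof (rule levy_continuity)
  show "real_distribution (mu2 \<psi> W q (l n))" for n using l(1) by (rule mu2_distribution)
  show "real_distribution \<mu>" by (rule mu_distr)
  fix t
  have 1: "(\<lambda>n. char (mu1 \<psi> W q (l n)) t) \<longlonglongrightarrow> char \<mu> t"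
    by (intro levy_continuity1 mu1_distribution mu1_tendsto mu_distr l)
  have "real_distribution (return borel (0::real))"
    unfolding real_distribution_def real_distribution_axioms_def by (simp add: prob_space_return)
  then have "(\<lambda>n. char (distr (\<kappa> (q + l n)) borel uminus) t) \<longlonglongrightarrow> char (return borel 0) t"
    using l q by (intro levy_continuity1 reflected_kappa_distribution kappa_tendsto
      filterlim_tendsto_add_at_top[OF tendsto_const]) (auto intro: add_pos_pos)
  also have "char (return borel 0) t = 1"
    unfolding char_def by (subst integral_return) auto
  finally have 2: "(\<lambda>n. char (distr (\<kappa> (q + l n)) borel uminus) t) \<longlonglongrightarrow> 1" .
  have "char (mu2 \<psi> W q (l n)) t = char (mu1 \<psi> W q (l n)) t * char (distr (\<kappa> (q + l n)) borel uminus) t" for n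
    unfolding mu2_eq[OF l(1)] by (intro char_convolution mu1_distribution reflected_kappa_distribution l)
  then show "(\<lambda>n. char (mu2 \<psi> W q (l n)) t) \<longlonglongrightarrow> char \<mu> t"
    using tendsto_mult[OF 1 2] by simp
qed

end

section \<open>Both families of measures and their common weak limit\<close>

theorem proposition5p2:
  fixes M :: "'a measure"
    and X Y :: "real \<Rightarrow> 'a \<Rightarrow> real"
    and \<psi> :: "real \<Rightarrow> real"
    and W :: "real \<Rightarrow> real \<Rightarrow> real"
    and q :: real
    and \<mu> :: "real measure"
  assumes "spectrally_positive M X"
    and "Y = (\<lambda>t \<omega>. - X t \<omega>)"
    and "\<psi> = laplace_exponent M Y"
    and "\<forall>p\<ge>0. is_scale_function \<psi> p (W p)"
    and "q > 0"
    and "real_distribution \<mu>"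
    and "AE y in \<mu>. 0 \<le> y"
    and "\<forall>\<theta>\<ge>0. (LINT y:{0..}|\<mu>. exp (- \<theta> * y)) = limit_laplace \<psi> q \<theta>"
  shows "(\<forall>l>0. real_distribution (mu1 \<psi> W q l) \<and> (AE y in mu1 \<psi> W q l. 0 \<le> y)) \<and>
    (\<forall>l>0. real_distribution (mu2 \<psi> W q l)) \<and>
    (\<forall>l::nat \<Rightarrow> real. (\<forall>n. l n > 0) \<and> filterlim l at_top sequentially \<longrightarrow>
       weak_conv_m (\<lambda>n. mu1 \<psi> W q (l n)) \<mu> \<and> weak_conv_m (\<lambda>n. mu2 \<psi> W q (l n)) \<mu>)"
proof -
  have levy: "levy_process M Y"
    using assms(1,2) by (simp add: spectrally_positive_def spectrally_negative_def)
  have "scale_functions M (Y 1) \<psi> W"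
    using levy assms(3,4)
    by (auto simp: scale_functions_def scale_functions_axioms_def levy_process_def laplace_exponent_def)
  with levy have "levy_scale M Y \<psi> W"
    by (simp add: levy_scale_def levy_scale_axioms_def)
  moreover have "limit_law_axioms \<psi> q \<mu>"
  proof (rule limit_law_axioms.intro)
    interpret levy_scale M Y \<psi> W by fact
    interpret mu: real_distribution \<mu> by fact
    show "(\<integral>y. exp (- t * y) \<partial>\<mu>) = q / right_inverse \<psi> q * ((t - right_inverse \<psi> q) / (\<psi> t - q))"
      if t: "t > right_inverse \<psi> q" for t
    proof -
      have "(\<integral>y. exp (- t * y) \<partial>\<mu>) = (LINT y:{0..}|\<mu>. exp (- t * y))"
        unfolding set_lebesgue_integral_def
        using assms(7) by (intro integral_cong_AE) (auto elim!: eventually_mono)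
      also have "\<dots> = limit_laplace \<psi> q t"
        using assms(8) t Phi_pos[OF assms(5)] by simp
      finally show ?thesis using t by (simp add: limit_laplace_def Let_def)
    qed
    show "0 < q" "real_distribution \<mu>" "AE y in \<mu>. 0 \<le> y" by (rule assms)+
  qed
  ultimately interpret limit_law M Y \<psi> W q \<mu>
    by (simp add: limit_law_def)
  show ?thesis
    using mu1_distribution mu2_distribution mu1_tendsto mu2_tendsto by blast
qed

end
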